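(* Let $M \subset \mathbb{C}P^n$ be a (real one-dimensional) curve of the complex projective space, with unit tangent vector field $T$, and let $\hat M$ be its pull-back to $S^{2n+1}$. Then $\hat{M}$ has flat normal bundle if and only if $$\langle A_{\xi}(T), T \rangle = 0$$ for all $\xi \in \nu M$ such that $\langle \xi, JT \rangle = 0$. Equivalently, $\hat{M}$ has flat normal bundle if and only if the curve $M$ is a holomorphic circle (K\"ahler-Frenet curve), namely $$\overline{\nabla}_T T = \kappa J T,$$ where $\kappa$ is a smooth function on $M$.
   Context: $\mathbb{C}P^n$ carries the Fubini–Study metric of holomorphic sectional curvature $4$, with complex structure $J$ and Levi-Civita connection $\overline\nabla$. The Hopf fibration $\pi: S^{2n+1}\to\mathbb{C}P^n$ is the quotient of the unit sphere of $\mathbb{C}^{n+1}$ by the action of $U(1)$ by multiplication, a Riemannian submersion; the pull-back of $M$ is $\hat M=\pi^{-1}(M)\subset S^{2n+1}$. $\nu M$ is the normal bundle of $M$ and $A_\xi$ the shape operator in the normal direction $\xi$. $\hat M$ has flat normal bundle if the curvature of the normal connection of $\hat M$ as a submanifold of $S^{2n+1}$ vanishes. *)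

theory Defs
  imports "HOL-Analysis.Analysis"
begin

section \<open>Smooth maps\<close>

primrec Ck_on :: "nat \<Rightarrow> ('a::real_normed_vector \<Rightarrow> 'b::real_normed_vector) \<Rightarrow> 'a set \<Rightarrow> bool" where
  "Ck_on 0 f U \<longleftrightarrow> continuous_on U f"
| "Ck_on (Suc k) f U \<longleftrightarrow>
     (\<forall>x\<in>U. f differentiable (at x)) \<and> (\<forall>v. Ck_on k (\<lambda>x. frechet_derivative f (at x) v) U)"

text \<open>Smoothness on an arbitrary subset means having local smooth extensions; on an open set this is
  the usual \<open>C\<^sup>\<infinity>\<close>, on an embedded submanifold it is smoothness in charts.\<close>

definition smooth_on :: "'a::real_normed_vector set \<Rightarrow> ('a \<Rightarrow> 'b::real_normed_vector) \<Rightarrow> bool" where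
  "smooth_on S f \<longleftrightarrow>
     (\<forall>x\<in>S. \<exists>U g. open U \<and> x \<in> U \<and> (\<forall>k. Ck_on k g U) \<and> (\<forall>y\<in>S \<inter> U. g y = f y))"

section \<open>Submanifolds of a Euclidean space\<close>

text \<open>\<open>S\<close> stands for an embedded submanifold of a Euclidean space. Vector fields along \<open>S\<close> are
  functions on the ambient space of which only the values on \<open>S\<close> matter.\<close>

definition curve_on :: "'a::euclidean_space set \<Rightarrow> real set \<Rightarrow> (real \<Rightarrow> 'a) \<Rightarrow> bool" where
  "curve_on S I c \<longleftrightarrow> open I \<and> smooth_on I c \<and> c ` I \<subseteq> S"

definition tangent_space :: "'a::euclidean_space set \<Rightarrow> 'a \<Rightarrow> 'a set" where
  "tangent_space S p =
     {vector_derivative c (at t) | I c t. curve_on S I c \<and> t \<in> I \<and> c t = p}"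

definition normal_space :: "'a::euclidean_space set \<Rightarrow> 'a set \<Rightarrow> 'a \<Rightarrow> 'a set" where
  "normal_space A S p = {\<xi> \<in> tangent_space A p. \<forall>v\<in>tangent_space S p. \<xi> \<bullet> v = 0}"

text \<open>Derivative at \<open>p\<close> of a map defined on \<open>S\<close> in the direction of a tangent vector \<open>v\<close> of \<open>S\<close>.\<close>

definition tangent_deriv ::
  "'a::euclidean_space set \<Rightarrow> ('a \<Rightarrow> 'b::real_normed_vector) \<Rightarrow> 'a \<Rightarrow> 'a \<Rightarrow> 'b" where
  "tangent_deriv S f p v =
     (THE w. \<forall>I c t. curve_on S I c \<and> t \<in> I \<and> c t = p \<and> vector_derivative c (at t) = v \<longrightarrow>
        ((f \<circ> c) has_vector_derivative w) (at t))"

definition orth_proj :: "'a::euclidean_space set \<Rightarrow> 'a \<Rightarrow> 'a" where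
  "orth_proj W v = (THE w. w \<in> W \<and> (\<forall>u\<in>W. (v - w) \<bullet> u = 0))"

text \<open>The Levi-Civita connection of a submanifold \<open>A\<close> of Euclidean space, applied to a vector field of
  \<open>A\<close> along \<open>S \<subseteq> A\<close>, is the tangential part of the Euclidean derivative; the normal connection of
  \<open>S\<close> in \<open>A\<close> is the normal part of the Levi-Civita connection of \<open>A\<close>.\<close>

definition submfd_conn ::
  "'a::euclidean_space set \<Rightarrow> 'a set \<Rightarrow> ('a \<Rightarrow> 'a) \<Rightarrow> ('a \<Rightarrow> 'a) \<Rightarrow> 'a \<Rightarrow> 'a" where
  "submfd_conn A S X Y p = orth_proj (tangent_space A p) (tangent_deriv S Y p (X p))"

definition normal_conn ::
  "'a::euclidean_space set \<Rightarrow> 'a set \<Rightarrow> ('a \<Rightarrow> 'a) \<Rightarrow> ('a \<Rightarrow> 'a) \<Rightarrow> 'a \<Rightarrow> 'a" where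
  "normal_conn A S X \<xi> p = orth_proj (normal_space A S p) (submfd_conn A S X \<xi> p)"

definition lie_bracket ::
  "'a::euclidean_space set \<Rightarrow> ('a \<Rightarrow> 'a) \<Rightarrow> ('a \<Rightarrow> 'a) \<Rightarrow> 'a \<Rightarrow> 'a" where
  "lie_bracket S X Y p = tangent_deriv S Y p (X p) - tangent_deriv S X p (Y p)"

definition normal_curvature ::
  "'a::euclidean_space set \<Rightarrow> 'a set \<Rightarrow> ('a \<Rightarrow> 'a) \<Rightarrow> ('a \<Rightarrow> 'a) \<Rightarrow> ('a \<Rightarrow> 'a) \<Rightarrow> 'a \<Rightarrow> 'a" where
  "normal_curvature A S X Y \<xi> p =
     normal_conn A S X (normal_conn A S Y \<xi>) p - normal_conn A S Y (normal_conn A S X \<xi>) p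
     - normal_conn A S (lie_bracket S X Y) \<xi> p"

definition flat_normal_bundle :: "'a::euclidean_space set \<Rightarrow> 'a set \<Rightarrow> bool" where
  "flat_normal_bundle A S \<longleftrightarrow>
     (\<forall>X Y \<xi>. smooth_on S X \<and> smooth_on S Y \<and> smooth_on S \<xi> \<and>
        (\<forall>p\<in>S. X p \<in> tangent_space S p \<and> Y p \<in> tangent_space S p \<and> \<xi> p \<in> normal_space A S p) \<longrightarrow>
        (\<forall>p\<in>S. normal_curvature A S X Y \<xi> p = 0))"

section \<open>Complex projective space as the quotient of the unit sphere\<close>

text \<open>With \<open>CARD('n) = n + 1\<close>, the points of \<open>\<complex>P\<^sup>n\<close> are the orbits of \<open>U(1)\<close> on the unit sphere of
  \<open>\<complex>\<^sup>n\<^sup>+\<^sup>1\<close>. The inner product of \<^typ>\<open>complex^'n\<close> is the real part of the Hermitian one.\<close>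

type_synonym 'n cpoint = "(complex^'n) set"

definition hopf :: "complex^'n \<Rightarrow> ('n::finite) cpoint" where
  "hopf p = {z *s p | z. cmod z = 1}"

definition CP :: "('n::finite) cpoint set" where
  "CP = hopf ` sphere 0 1"

definition hopf_preimage :: "('n::finite) cpoint set \<Rightarrow> (complex^'n) set" where
  "hopf_preimage M = {p \<in> sphere 0 1. hopf p \<in> M}"

definition cp_topology :: "('n::finite) cpoint topology" where
  "cp_topology =
     topology (\<lambda>U. U \<subseteq> CP \<and> openin (top_of_set (sphere 0 1)) (hopf_preimage U))"

text \<open>\<open>hopf\<close> is a submersion, so a map into \<open>\<complex>P\<^sup>n\<close> is smooth iff it has local smooth lifts to the
  sphere.\<close>

definition cp_smooth_on :: "'a::real_normed_vector set \<Rightarrow> ('a \<Rightarrow> ('n::finite) cpoint) \<Rightarrow> bool" where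
  "cp_smooth_on S f \<longleftrightarrow>
     (\<forall>x\<in>S. \<exists>U c. open U \<and> x \<in> U \<and> smooth_on U c \<and> c ` U \<subseteq> sphere 0 1 \<and>
        (\<forall>y\<in>S \<inter> U. hopf (c y) = f y))"

text \<open>The component orthogonal to \<open>p\<close> (the normal of the sphere) and to \<open>\<i>p\<close> (the fibre direction).\<close>

definition horizontal_part :: "complex^'n \<Rightarrow> complex^'n \<Rightarrow> complex^('n::finite)" where
  "horizontal_part p w = w - (w \<bullet> p) *\<^sub>R p - (w \<bullet> (\<i> *s p)) *\<^sub>R (\<i> *s p)"

text \<open>A tangent vector of \<open>\<complex>P\<^sup>n\<close> at \<open>x\<close> is represented by the set of all its horizontal lifts \<open>(p, v)\<close>,
  one for each \<open>p\<close> in the fibre \<open>x\<close>: the orbit of one of them under the differential of the action.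
  The image of a tangent vector \<open>w\<close> of the sphere at \<open>p\<close> under the differential of \<open>hopf\<close> is then the
  orbit of \<open>(p, horizontal_part p w)\<close>.\<close>

type_synonym 'n cvector = "((complex^'n) \<times> (complex^'n)) set"

definition dhopf :: "complex^'n \<Rightarrow> complex^'n \<Rightarrow> ('n::finite) cvector" where
  "dhopf p w = {(z *s p, z *s horizontal_part p w) | z. cmod z = 1}"

definition cp_tangent_space :: "('n::finite) cpoint \<Rightarrow> 'n cvector set" where
  "cp_tangent_space x = {dhopf p w | p w. p \<in> x \<and> w \<in> tangent_space (sphere 0 1) p}"

definition cp_add :: "('n::finite) cvector \<Rightarrow> 'n cvector \<Rightarrow> 'n cvector" where
  "cp_add X Y = {(p, v + w) | p v w. (p, v) \<in> X \<and> (p, w) \<in> Y}"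

definition cp_scale :: "real \<Rightarrow> ('n::finite) cvector \<Rightarrow> 'n cvector" where
  "cp_scale r X = {(p, r *\<^sub>R v) | p v. (p, v) \<in> X}"

definition cp_J :: "('n::finite) cvector \<Rightarrow> 'n cvector" where
  "cp_J X = {(p, \<i> *s v) | p v. (p, v) \<in> X}"

text \<open>The Fubini--Study metric of holomorphic sectional curvature \<open>4\<close>: the metric for which \<open>hopf\<close> is
  a Riemannian submersion from the unit sphere.\<close>

definition cp_inner :: "('n::finite) cvector \<Rightarrow> 'n cvector \<Rightarrow> real" where
  "cp_inner X Y = (THE r. \<exists>p v w. (p, v) \<in> X \<and> (p, w) \<in> Y \<and> r = v \<bullet> w)"

definition cp_velocity :: "(real \<Rightarrow> ('n::finite) cpoint) \<Rightarrow> real \<Rightarrow> 'n cvector" where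
  "cp_velocity \<gamma> t =
     (THE X. \<exists>U c. curve_on (sphere 0 1) U c \<and> t \<in> U \<and> (\<forall>s\<in>U. hopf (c s) = \<gamma> s) \<and>
        X = dhopf (c t) (vector_derivative c (at t)))"

text \<open>Smooth vector fields of \<open>\<complex>P\<^sup>n\<close> along a curve.\<close>

definition field_along ::
  "real set \<Rightarrow> (real \<Rightarrow> ('n::finite) cpoint) \<Rightarrow> (real \<Rightarrow> 'n cvector) \<Rightarrow> bool" where
  "field_along I \<gamma> X \<longleftrightarrow>
     (\<forall>t\<in>I. \<exists>U c v. open U \<and> t \<in> U \<and> smooth_on U c \<and> smooth_on U v \<and>
        (\<forall>s\<in>U. c s \<in> sphere 0 1 \<and> v s \<in> tangent_space (sphere 0 1) (c s)) \<and>
        (\<forall>s\<in>I \<inter> U. hopf (c s) = \<gamma> s \<and> X s = dhopf (c s) (v s)))"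

text \<open>The Levi-Civita connection in the form of its covariant derivative \<open>D \<gamma> X t\<close> of a vector field
  \<open>X\<close> along a curve \<open>\<gamma>\<close>. The last two clauses say that it is metric and torsion-free; by the Koszul
  computation for parametrized families of curves they determine the value of \<open>D\<close> on all smooth
  data (outside of which it is arbitrary).\<close>

definition levi_civita ::
  "((real \<Rightarrow> ('n::finite) cpoint) \<Rightarrow> (real \<Rightarrow> 'n cvector) \<Rightarrow> real \<Rightarrow> 'n cvector) \<Rightarrow> bool" where
  "levi_civita D \<longleftrightarrow>
     (\<forall>I \<gamma> X. open I \<and> field_along I \<gamma> X \<longrightarrow> field_along I \<gamma> (D \<gamma> X)) \<and>
     (\<forall>I \<gamma> X Y. open I \<and> field_along I \<gamma> X \<and> field_along I \<gamma> Y \<longrightarrow>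
        (\<forall>t\<in>I. D \<gamma> (\<lambda>s. cp_add (X s) (Y s)) t = cp_add (D \<gamma> X t) (D \<gamma> Y t))) \<and>
     (\<forall>I \<gamma> X f. open I \<and> field_along I \<gamma> X \<and> smooth_on I f \<longrightarrow>
        (\<forall>t\<in>I. D \<gamma> (\<lambda>s. cp_scale (f s) (X s)) t =
                cp_add (cp_scale (deriv f t) (X t)) (cp_scale (f t) (D \<gamma> X t)))) \<and>
     (\<forall>I \<gamma> X Y. open I \<and> field_along I \<gamma> X \<and> field_along I \<gamma> Y \<longrightarrow>
        (\<forall>t\<in>I. ((\<lambda>s. cp_inner (X s) (Y s)) has_real_derivative
                 cp_inner (D \<gamma> X t) (Y t) + cp_inner (X t) (D \<gamma> Y t)) (at t))) \<and>
     (\<forall>W f. open W \<and> cp_smooth_on W f \<longrightarrow>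
        (\<forall>(s, t)\<in>W.
           D (\<lambda>a. f (a, t)) (\<lambda>a. cp_velocity (\<lambda>b. f (a, b)) t) s =
           D (\<lambda>b. f (s, b)) (\<lambda>b. cp_velocity (\<lambda>a. f (a, b)) s) t))"

definition cp_conn ::
  "(real \<Rightarrow> ('n::finite) cpoint) \<Rightarrow> (real \<Rightarrow> 'n cvector) \<Rightarrow> real \<Rightarrow> 'n cvector" where
  "cp_conn = (SOME D. levi_civita D)"

section \<open>Curves in complex projective space\<close>

definition cp_curve_on :: "('n::finite) cpoint set \<Rightarrow> real set \<Rightarrow> (real \<Rightarrow> 'n cpoint) \<Rightarrow> bool" where
  "cp_curve_on M I \<gamma> \<longleftrightarrow> open I \<and> cp_smooth_on I \<gamma> \<and> \<gamma> ` I \<subseteq> M"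

text \<open>Regular parametrizations of the open pieces of \<open>M\<close>, that is, inverses of charts.\<close>

definition local_param :: "('n::finite) cpoint set \<Rightarrow> real set \<Rightarrow> (real \<Rightarrow> 'n cpoint) \<Rightarrow> bool" where
  "local_param M I \<gamma> \<longleftrightarrow>
     cp_curve_on M I \<gamma> \<and>
     openin (subtopology cp_topology M) (\<gamma> ` I) \<and>
     embedding_map (top_of_set I) cp_topology \<gamma> \<and>
     (\<forall>t\<in>I. cp_inner (cp_velocity \<gamma> t) (cp_velocity \<gamma> t) \<noteq> 0)"

text \<open>Embedded one-dimensional submanifolds of \<open>\<complex>P\<^sup>n\<close>.\<close>

definition curve_submanifold :: "('n::finite) cpoint set \<Rightarrow> bool" where
  "curve_submanifold M \<longleftrightarrow> M \<subseteq> CP \<and> (\<forall>x\<in>M. \<exists>I \<gamma>. local_param M I \<gamma> \<and> x \<in> \<gamma> ` I)"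

definition curve_tangent_space :: "('n::finite) cpoint set \<Rightarrow> 'n cpoint \<Rightarrow> 'n cvector set" where
  "curve_tangent_space M x = {cp_velocity \<gamma> t | I \<gamma> t. cp_curve_on M I \<gamma> \<and> t \<in> I \<and> \<gamma> t = x}"

definition curve_normal_space :: "('n::finite) cpoint set \<Rightarrow> 'n cpoint \<Rightarrow> 'n cvector set" where
  "curve_normal_space M x =
     {\<xi> \<in> cp_tangent_space x. \<forall>X\<in>curve_tangent_space M x. cp_inner \<xi> X = 0}"

definition unit_tangent_field :: "('n::finite) cpoint set \<Rightarrow> ('n cpoint \<Rightarrow> 'n cvector) \<Rightarrow> bool" where
  "unit_tangent_field M T \<longleftrightarrow>
     (\<forall>I \<gamma>. local_param M I \<gamma> \<longrightarrow> field_along I \<gamma> (T \<circ> \<gamma>)) \<and>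
     (\<forall>x\<in>M. T x \<in> curve_tangent_space M x \<and> cp_inner (T x) (T x) = 1)"

text \<open>The covariant derivative at \<open>x\<close>, with respect to the Levi-Civita connection of \<open>\<complex>P\<^sup>n\<close>, of a vector
  field \<open>Y\<close> along \<open>M\<close> in the direction of a tangent field \<open>X\<close> of \<open>M\<close>.\<close>

definition cov_deriv ::
  "('n::finite) cpoint set \<Rightarrow> ('n cpoint \<Rightarrow> 'n cvector) \<Rightarrow> ('n cpoint \<Rightarrow> 'n cvector) \<Rightarrow>
   'n cpoint \<Rightarrow> 'n cvector" where
  "cov_deriv M X Y x =
     (THE Z. \<forall>I \<gamma> t. cp_curve_on M I \<gamma> \<and> t \<in> I \<and> \<gamma> t = x \<and> cp_velocity \<gamma> t = X x \<longrightarrow>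
        Z = cp_conn \<gamma> (Y \<circ> \<gamma>) t)"

text \<open>\<open>A\<^sub>\<xi> X\<close> is minus the part tangent to \<open>M\<close> of the derivative in direction \<open>X\<close> of any extension of \<open>\<xi>\<close>
  to a normal field \<open>N\<close>.\<close>

definition shape_operator ::
  "('n::finite) cpoint set \<Rightarrow> 'n cpoint \<Rightarrow> 'n cvector \<Rightarrow> 'n cvector \<Rightarrow> 'n cvector" where
  "shape_operator M x \<xi> X =
     (THE Z. Z \<in> curve_tangent_space M x \<and>
        (\<forall>I \<gamma> t N. cp_curve_on M I \<gamma> \<and> t \<in> I \<and> \<gamma> t = x \<and> cp_velocity \<gamma> t = X \<and>
           field_along I \<gamma> N \<and> (\<forall>s\<in>I. N s \<in> curve_normal_space M (\<gamma> s)) \<and> N t = \<xi> \<longrightarrow>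
           (\<forall>Y\<in>curve_tangent_space M x. cp_inner Z Y = - cp_inner (cp_conn \<gamma> N t) Y)))"

definition smooth_fun_on_curve :: "('n::finite) cpoint set \<Rightarrow> ('n cpoint \<Rightarrow> real) \<Rightarrow> bool" where
  "smooth_fun_on_curve M \<kappa> \<longleftrightarrow> (\<forall>I \<gamma>. local_param M I \<gamma> \<longrightarrow> smooth_on I (\<kappa> \<circ> \<gamma>))"

definition holomorphic_circle :: "('n::finite) cpoint set \<Rightarrow> ('n cpoint \<Rightarrow> 'n cvector) \<Rightarrow> bool" where
  "holomorphic_circle M T \<longleftrightarrow>
     (\<exists>\<kappa>. smooth_fun_on_curve M \<kappa> \<and> (\<forall>x\<in>M. cov_deriv M T T x = cp_scale (\<kappa> x) (cp_J (T x))))"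

end

theory Submission
  imports Defs
begin

text \<open>
  Let \<open>E\<close> be the horizontal lift of \<open>T\<close> to the pull-back \<open>S\<close> of \<open>M\<close>, so that \<open>E p\<close> and \<open>\<i>p\<close> form an orthonormal
  frame of the surface \<open>S\<close>. The fibres are great circles and \<open>E\<close> is invariant under rotation, hence the second
  fundamental form of \<open>S\<close> in the sphere is \<open>h(\<i>p, \<i>p) = 0\<close>, \<open>h(E, \<i>p) = \<i>E\<close> and \<open>h(E, E) = H\<close>, where \<open>H\<close> is the
  normal part of the derivative of \<open>E\<close> along itself. The sphere has constant curvature, so the normal curvature
  of \<open>S\<close> is the commutator of its shape operators (Ricci):
  \<open>R(E, \<i>p) \<xi> = \<langle>\<xi>, \<i>E\<rangle> H - \<langle>\<xi>, H\<rangle> \<i>E\<close>. It vanishes for all normal \<open>\<xi>\<close> iff \<open>H\<close> is a multiple of \<open>\<i>E\<close>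
  (\<open>normal_curvature_eq\<close>, \<open>flat_normal_bundle_iff\<close>). The vector \<open>H\<close> is the horizontal lift of the
  covariant derivative of \<open>T\<close> along itself (\<open>cov_deriv_T\<close>), and \<open>\<i>E\<close> is the lift of \<open>JT\<close>; so this condition is the
  equation of a holomorphic circle, with \<open>\<kappa> = \<langle>H, \<i>E\<rangle>\<close>, which is smooth. Likewise the lift of \<open>\<xi>\<close> satisfies
  \<open>\<langle>A\<^sub>\<xi> T, T\<rangle> = \<langle>\<xi>, H\<rangle>\<close> (\<open>shape_operator_T\<close>), which turns the condition into the one on shape operators.

  Three things have to be supplied for this. The Levi-Civita connection of projective space is
  characterized by axioms only: it is constructed by differentiating horizontal lifts
  (\<open>levi_civita_fs_conn\<close>), and the Koszul argument shows that the axioms determine the derivative along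
  a curve of any field that agrees with the velocity at the point in question
  (\<open>levi_civita_velocity_unique\<close>). The field \<open>E\<close> has to be smooth and the tangent spaces of \<open>S\<close> have to be
  spanned by the frame, which follows from lifted charts of \<open>M\<close> (\<open>chart\<close>). Finally, the calculus of
  smooth maps is developed from the recursive definition of \<open>C\<^sup>k\<close>.
\<close>

section \<open>Calculus of smooth maps\<close>

lemma frechet_derivative_eqI:
  "(f has_derivative f') (at x) \<Longrightarrow> frechet_derivative f (at x) = f'"
  using frechet_derivative_at by metis

lemma Ck_on_lower: "Ck_on (Suc k) f U \<Longrightarrow> Ck_on k f U"
proof (induction k arbitrary: f)
  case 0
  then show ?case
    by (auto intro!: continuous_at_imp_continuous_on differentiable_imp_continuous_within)
qed auto

lemma Ck_on_subset: "Ck_on k f U \<Longrightarrow> V \<subseteq> U \<Longrightarrow> Ck_on k f V"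
  by (induction k arbitrary: f) (auto intro: continuous_on_subset)

lemma Ck_on_cong:
  assumes "open U" "\<And>x. x \<in> U \<Longrightarrow> f x = g x" "Ck_on k f U"
  shows "Ck_on k g U"
  using assms(2,3)
proof (induction k arbitrary: f g)
  case 0
  then show ?case using continuous_on_cong[of U U f g] by simp
next
  case (Suc k)
  have eq: "frechet_derivative f (at x) = frechet_derivative g (at x)" if "x \<in> U" for x
    using frechet_derivative_transform_within_open[of f x U g] Suc.prems that assms(1) by auto
  have "g differentiable (at x)" if "x \<in> U" for x
    by (rule differentiableI, rule has_derivative_transform_within_open[of f
        "frechet_derivative f (at x)" x UNIV U])
      (use Suc.prems that assms(1) in \<open>auto simp: frechet_derivative_works\<close>)
  moreover have "Ck_on k (\<lambda>x. frechet_derivative g (at x) v) U" for v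
    using Suc.IH[of "\<lambda>x. frechet_derivative f (at x) v" "\<lambda>x. frechet_derivative g (at x) v"]
      Suc.prems eq by auto
  ultimately show ?case by simp
qed

lemma Ck_on_local:
  assumes "\<And>x. x \<in> U \<Longrightarrow> \<exists>V. open V \<and> x \<in> V \<and> Ck_on k f V"
  shows "Ck_on k f U"
  using assms
proof (induction k arbitrary: f)
  case 0
  then show ?case
    by (simp add: continuous_on_eq_continuous_at)
       (metis continuous_at_imp_continuous_on continuous_on_eq_continuous_at)
next
  case (Suc k)
  then have "f differentiable (at x)" if "x \<in> U" for x using that by fastforce
  moreover have "Ck_on k (\<lambda>x. frechet_derivative f (at x) v) U" for v
    by (rule Suc.IH) (use Suc.prems in fastforce)
  ultimately show ?case by simp
qed

lemma Ck_on_const: "Ck_on k (\<lambda>x. c) U"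
  by (induction k arbitrary: c) auto

lemma Ck_on_linear: "bounded_linear f \<Longrightarrow> Ck_on k f U"
proof (induction k)
  case (Suc k)
  then have "frechet_derivative f (at x) = f" for x
    by (intro frechet_derivative_eqI bounded_linear_imp_has_derivative)
  then show ?case using Suc
    by (auto simp: Ck_on_const intro: bounded_linear_imp_differentiable)
qed (simp add: linear_continuous_on)

lemma Ck_on_SucI:
  assumes "open U" and "\<And>x. x \<in> U \<Longrightarrow> (f has_derivative f' x) (at x)"
    and "\<And>v. Ck_on k (\<lambda>x. f' x v) U"
  shows "Ck_on (Suc k) f U"
proof -
  have eq: "frechet_derivative f (at x) = f' x" if "x \<in> U" for x
    using assms that by (intro frechet_derivative_eqI)
  have "Ck_on k (\<lambda>x. frechet_derivative f (at x) v) U" for v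
    by (rule Ck_on_cong[OF assms(1) _ assms(3)]) (simp add: eq)
  then show ?thesis using assms(2) by (auto simp: differentiable_def)
qed

lemma Ck_on_SucD:
  assumes "Ck_on (Suc k) f U"
  shows "x \<in> U \<Longrightarrow> (f has_derivative frechet_derivative f (at x)) (at x)"
    and "Ck_on k (\<lambda>x. frechet_derivative f (at x) v) U"
  using assms by (auto simp: frechet_derivative_works)

lemma Ck_on_add:
  assumes "open U" "Ck_on k f U" "Ck_on k g U"
  shows "Ck_on k (\<lambda>x. f x + g x) U"
  using assms(2,3)
proof (induction k arbitrary: f g)
  case (Suc k)
  show ?case
    by (rule Ck_on_SucI[OF assms(1)
          has_derivative_add[OF Ck_on_SucD(1)[OF Suc.prems(1)] Ck_on_SucD(1)[OF Suc.prems(2)]]])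
       (assumption | intro Suc.IH Ck_on_SucD(2) Suc.prems)+
qed (simp add: continuous_on_add)

lemma Ck_on_bilinear:
  assumes "bounded_bilinear B" "open U" "Ck_on k f U" "Ck_on k g U"
  shows "Ck_on k (\<lambda>x. B (f x) (g x)) U"
  using assms(3,4)
proof (induction k arbitrary: f g)
  case 0
  then show ?case using bounded_bilinear.continuous_on[OF assms(1)] by auto
next
  case (Suc k)
  have "Ck_on k (\<lambda>x. B (f x) (frechet_derivative g (at x) v)
                   + B (frechet_derivative f (at x) v) (g x)) U" for v
    by (intro Ck_on_add assms(2) Suc.IH Ck_on_lower[OF Suc.prems(1)] Ck_on_lower[OF Suc.prems(2)]
        Ck_on_SucD(2)[OF Suc.prems(1)] Ck_on_SucD(2)[OF Suc.prems(2)])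
  then show ?case
    by (intro Ck_on_SucI[OF assms(2) bounded_bilinear.FDERIV[OF assms(1)
          Ck_on_SucD(1)[OF Suc.prems(1)] Ck_on_SucD(1)[OF Suc.prems(2)]]])
qed

lemma Ck_on_sum:
  assumes "open U" "\<And>i. i \<in> A \<Longrightarrow> Ck_on k (f i) U"
  shows "Ck_on k (\<lambda>x. \<Sum>i\<in>A. f i x) U"
  using assms(2)
proof (induction A rule: infinite_finite_induct)
  case (insert i A)
  then show ?case using Ck_on_add[OF assms(1), of k "f i" "\<lambda>x. \<Sum>i\<in>A. f i x"] by simp
qed (auto simp: Ck_on_const)

lemma linear_sum_Basis:
  fixes f :: "'a::euclidean_space \<Rightarrow> 'b::real_vector"
  assumes "linear f"
  shows "f v = (\<Sum>b\<in>Basis. (v \<bullet> b) *\<^sub>R f b)"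
proof -
  have "f v = f (\<Sum>b\<in>Basis. (v \<bullet> b) *\<^sub>R b)" by (simp add: euclidean_representation)
  also have "\<dots> = (\<Sum>b\<in>Basis. (v \<bullet> b) *\<^sub>R f b)"
    using assms by (simp add: linear_sum linear_scale)
  finally show ?thesis .
qed

lemma Ck_on_inner_const:
  assumes "open U" "Ck_on k f U"
  shows "Ck_on k (\<lambda>x. f x \<bullet> b) U"
  using Ck_on_bilinear[OF bounded_bilinear_inner assms(1) assms(2) Ck_on_const] .

text \<open>A linear map on a Euclidean space is determined by its values on the finite basis. This turns
  the derivative of a composition into a finite sum of products, to which the induction hypothesis
  applies.\<close>

lemma Ck_on_compose:
  fixes f :: "'a::real_normed_vector \<Rightarrow> 'b::euclidean_space"
  assumes "open U" "open V" "f ` U \<subseteq> V" "Ck_on k f U" "Ck_on k g V"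
  shows "Ck_on k (\<lambda>x. g (f x)) U"
  using assms(4,5)
proof (induction k arbitrary: g)
  case 0
  then show ?case using continuous_on_compose2[of V g U f] assms(3) by auto
next
  case (Suc k)
  let ?d = "\<lambda>x v. \<Sum>b\<in>Basis. (frechet_derivative f (at x) v \<bullet> b) *\<^sub>R frechet_derivative g (at (f x)) b"
  have der: "((\<lambda>x. g (f x)) has_derivative ?d x) (at x)" if "x \<in> U" for x
  proof -
    have g: "(g has_derivative frechet_derivative g (at (f x))) (at (f x))"
      using Ck_on_SucD(1)[OF Suc.prems(2)] that assms(3) by auto
    have "((\<lambda>x. g (f x)) has_derivative
        (\<lambda>v. frechet_derivative g (at (f x)) (frechet_derivative f (at x) v))) (at x)"
      using diff_chain_at[OF Ck_on_SucD(1)[OF Suc.prems(1) that] g] by (simp add: o_def)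
    moreover have "frechet_derivative g (at (f x)) (frechet_derivative f (at x) v) = ?d x v" for v
      by (rule linear_sum_Basis[OF has_derivative_linear[OF g]])
    ultimately show ?thesis by (simp only:)
  qed
  have "Ck_on k (\<lambda>x. ?d x v) U" for v
    by (intro Ck_on_sum Ck_on_bilinear[OF bounded_bilinear_scaleR] Ck_on_inner_const assms(1) Suc.IH
        Ck_on_lower[OF Suc.prems(1)] Ck_on_SucD(2)[OF Suc.prems(1)] Ck_on_SucD(2)[OF Suc.prems(2)])
  then show ?case by (intro Ck_on_SucI[OF assms(1) der])
qed

lemma Ck_on_inverse: "Ck_on k (inverse :: real \<Rightarrow> real) (- {0})"
proof (induction k)
  case (Suc k)
  have "Ck_on k (\<lambda>x::real. inverse x * (- v) * inverse x) (- {0})" for v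
    by (intro Ck_on_bilinear[OF bounded_bilinear_mult] Ck_on_const Suc) auto
  moreover have "(inverse has_derivative (\<lambda>v. inverse x * (- v) * inverse x)) (at x)"
    if "x \<in> - {0}" for x :: real
    using has_derivative_inverse'[of x UNIV] that by simp
  ultimately show ?case by (intro Ck_on_SucI[of "- {0}"]) auto
qed (auto intro!: continuous_intros)

lemma cis_has_derivative: "(cis has_derivative (\<lambda>v. v *\<^sub>R (\<i> * cis x))) (at x)"
proof -
  have "((\<lambda>t. cos t *\<^sub>R 1 + sin t *\<^sub>R \<i>) has_derivative (\<lambda>v. v *\<^sub>R (\<i> * cis x))) (at x)"
    by (rule derivative_eq_intros refl)+ (auto simp: complex_eq_iff algebra_simps)
  moreover have "(\<lambda>t. cos t *\<^sub>R 1 + sin t *\<^sub>R \<i>) = cis" by (auto simp: complex_eq_iff)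
  ultimately show ?thesis by metis
qed

lemma Ck_on_cis: "Ck_on k cis UNIV"
proof (induction k)
  case (Suc k)
  have "Ck_on k (\<lambda>x. v *\<^sub>R (\<i> * cis x)) UNIV" for v
    using Suc by (intro Ck_on_bilinear[OF bounded_bilinear_mult]
       Ck_on_bilinear[OF bounded_bilinear_scaleR] Ck_on_const) auto
  then show ?case by (intro Ck_on_SucI[OF _ cis_has_derivative]) auto
qed (auto intro!: continuous_intros)

text \<open>As \<^const>\<open>smooth_on\<close> asks for local extensions, its closure properties on arbitrary sets reduce to those
  of \<open>C\<^sup>k\<close> maps on open sets, by intersecting the domains of the extensions.\<close>

lemma smooth_on_openD:
  assumes "open U" "smooth_on U f"
  shows "Ck_on k f U"
proof (rule Ck_on_local)
  fix x assume "x \<in> U"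
  then obtain W g where W: "open W" "x \<in> W" "\<forall>k. Ck_on k g W" "\<forall>y\<in>U \<inter> W. g y = f y"
    using assms(2) unfolding smooth_on_def by fast
  have "Ck_on k f (U \<inter> W)"
    by (rule Ck_on_cong[of _ g]) (use W assms(1) in \<open>auto intro: Ck_on_subset[of k g W]\<close>)
  then show "\<exists>V. open V \<and> x \<in> V \<and> Ck_on k f V"
    using W \<open>x \<in> U\<close> assms(1) by (intro exI[of _ "U \<inter> W"]) auto
qed

lemma smooth_on_openI: "open U \<Longrightarrow> (\<And>k. Ck_on k f U) \<Longrightarrow> smooth_on U f"
  unfolding smooth_on_def by (intro ballI exI[of _ U] exI[of _ f]) auto

lemma smooth_on_local_extension:
  assumes "smooth_on S f" "x \<in> S"
  obtains U g where "open U" "x \<in> U" "smooth_on U g" "\<And>y. y \<in> S \<inter> U \<Longrightarrow> g y = f y"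
proof -
  obtain U g where "open U" "x \<in> U" "\<forall>k. Ck_on k g U" "\<forall>y\<in>S \<inter> U. g y = f y"
    using assms unfolding smooth_on_def by fast
  then show ?thesis using that[of U g] smooth_on_openI[of U g] by simp
qed

lemma smooth_onI_extension:
  assumes "\<And>x. x \<in> S \<Longrightarrow> \<exists>U g. open U \<and> x \<in> U \<and> smooth_on U g \<and> (\<forall>y\<in>S \<inter> U. g y = f y)"
  shows "smooth_on S f"
  unfolding smooth_on_def
proof
  fix x assume "x \<in> S"
  then obtain U g where "open U" "x \<in> U" "smooth_on U g" "\<forall>y\<in>S \<inter> U. g y = f y"
    using assms by blast
  then show "\<exists>U g. open U \<and> x \<in> U \<and> (\<forall>k. Ck_on k g U) \<and> (\<forall>y\<in>S \<inter> U. g y = f y)"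
    by (intro exI[of _ U] exI[of _ g]) (simp add: smooth_on_openD)
qed

lemma smooth_on_subset:
  assumes "smooth_on S f" "R \<subseteq> S"
  shows "smooth_on R f"
proof (rule smooth_onI_extension)
  fix x assume "x \<in> R"
  then obtain U g where "open U" "x \<in> U" "smooth_on U g" "\<And>y. y \<in> S \<inter> U \<Longrightarrow> g y = f y"
    using smooth_on_local_extension[OF assms(1), of x] assms(2) by blast
  then show "\<exists>U g. open U \<and> x \<in> U \<and> smooth_on U g \<and> (\<forall>y\<in>R \<inter> U. g y = f y)"
    using assms(2) by (intro exI[of _ U] exI[of _ g]) auto
qed

lemma smooth_on_cong:
  assumes "smooth_on S f" "\<And>x. x \<in> S \<Longrightarrow> f x = g x"
  shows "smooth_on S g"
proof (rule smooth_onI_extension)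
  fix x assume "x \<in> S"
  then obtain U h where "open U" "x \<in> U" "smooth_on U h" "\<And>y. y \<in> S \<inter> U \<Longrightarrow> h y = f y"
    using smooth_on_local_extension[OF assms(1), of x] by blast
  then show "\<exists>U h. open U \<and> x \<in> U \<and> smooth_on U h \<and> (\<forall>y\<in>S \<inter> U. h y = g y)"
    using assms(2) by (intro exI[of _ U] exI[of _ h]) auto
qed

lemma smooth_on_local:
  assumes "\<And>x. x \<in> S \<Longrightarrow> \<exists>U. open U \<and> x \<in> U \<and> smooth_on (S \<inter> U) f"
  shows "smooth_on S f"
proof (rule smooth_onI_extension)
  fix x assume x: "x \<in> S"
  then obtain U where U: "open U" "x \<in> U" "smooth_on (S \<inter> U) f" using assms by blast
  then obtain V g where V: "open V" "x \<in> V" "smooth_on V g" "\<And>y. y \<in> S \<inter> U \<inter> V \<Longrightarrow> g y = f y"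
    using smooth_on_local_extension[of "S \<inter> U" f x] x by blast
  show "\<exists>U g. open U \<and> x \<in> U \<and> smooth_on U g \<and> (\<forall>y\<in>S \<inter> U. g y = f y)"
    using U V smooth_on_subset[OF V(3), of "U \<inter> V"] by (intro exI[of _ "U \<inter> V"] exI[of _ g]) auto
qed

lemma smooth_on_const [intro, simp]: "smooth_on S (\<lambda>x. c)"
  by (rule smooth_on_subset[OF smooth_on_openI[OF open_UNIV Ck_on_const]]) simp

lemma smooth_on_linear: "bounded_linear f \<Longrightarrow> smooth_on S f"
  by (rule smooth_on_subset[OF smooth_on_openI[OF open_UNIV Ck_on_linear]]) auto

lemma smooth_on_ident [intro, simp]: "smooth_on S (\<lambda>x. x)"
  by (intro smooth_on_linear bounded_linear_ident)

lemma smooth_on_bilinear: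
  assumes "bounded_bilinear B" "smooth_on S f" "smooth_on S g"
  shows "smooth_on S (\<lambda>x. B (f x) (g x))"
proof (rule smooth_onI_extension)
  fix x assume x: "x \<in> S"
  obtain U f' where U: "open U" "x \<in> U" "smooth_on U f'" "\<And>y. y \<in> S \<inter> U \<Longrightarrow> f' y = f y"
    using smooth_on_local_extension[OF assms(2) x] by blast
  obtain V g' where V: "open V" "x \<in> V" "smooth_on V g'" "\<And>y. y \<in> S \<inter> V \<Longrightarrow> g' y = g y"
    using smooth_on_local_extension[OF assms(3) x] by blast
  have "smooth_on (U \<inter> V) (\<lambda>x. B (f' x) (g' x))"
    by (intro smooth_on_openI Ck_on_bilinear[OF assms(1)] open_Int U(1) V(1)
        Ck_on_subset[OF smooth_on_openD[OF U(1,3)]] Ck_on_subset[OF smooth_on_openD[OF V(1,3)]]) auto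
  then show "\<exists>U h. open U \<and> x \<in> U \<and> smooth_on U h \<and> (\<forall>y\<in>S \<inter> U. h y = B (f y) (g y))"
    using U V by (intro exI[of _ "U \<inter> V"] exI[of _ "\<lambda>x. B (f' x) (g' x)"]) auto
qed

lemma smooth_on_add:
  assumes "smooth_on S f" "smooth_on S g"
  shows "smooth_on S (\<lambda>x. f x + g x)"
proof (rule smooth_onI_extension)
  fix x assume x: "x \<in> S"
  obtain U f' where U: "open U" "x \<in> U" "smooth_on U f'" "\<And>y. y \<in> S \<inter> U \<Longrightarrow> f' y = f y"
    using smooth_on_local_extension[OF assms(1) x] by blast
  obtain V g' where V: "open V" "x \<in> V" "smooth_on V g'" "\<And>y. y \<in> S \<inter> V \<Longrightarrow> g' y = g y"
    using smooth_on_local_extension[OF assms(2) x] by blast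
  have "smooth_on (U \<inter> V) (\<lambda>x. f' x + g' x)"
    by (intro smooth_on_openI Ck_on_add open_Int U(1) V(1)
        Ck_on_subset[OF smooth_on_openD[OF U(1,3)]] Ck_on_subset[OF smooth_on_openD[OF V(1,3)]]) auto
  then show "\<exists>U h. open U \<and> x \<in> U \<and> smooth_on U h \<and> (\<forall>y\<in>S \<inter> U. h y = f y + g y)"
    using U V by (intro exI[of _ "U \<inter> V"] exI[of _ "\<lambda>x. f' x + g' x"]) auto
qed

lemma smooth_on_continuous:
  assumes "smooth_on S f"
  shows "continuous_on S f"
proof -
  have "continuous (at x within S) f" if x: "x \<in> S" for x
  proof -
    obtain U g where U: "open U" "x \<in> U" "smooth_on U g" "\<And>y. y \<in> S \<inter> U \<Longrightarrow> g y = f y"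
      using smooth_on_local_extension[OF assms x] by blast
    have "continuous (at x) g"
      using smooth_on_openD[OF U(1) U(3), of 0] U(1,2) by (simp add: continuous_on_eq_continuous_at)
    then have "(g \<longlongrightarrow> f x) (at x within S)"
      using U(4)[of x] x U(2) by (auto simp: continuous_at intro: tendsto_within_subset)
    moreover have "eventually (\<lambda>y. g y = f y) (at x within S)"
      using U by (auto simp: eventually_at_topological)
    ultimately show ?thesis
      by (simp add: continuous_within filterlim_cong)
  qed
  then show ?thesis by (simp add: continuous_on_eq_continuous_within)
qed

lemma smooth_on_compose:
  fixes f :: "'a::real_normed_vector \<Rightarrow> 'b::euclidean_space"
  assumes "smooth_on R g" "smooth_on S f" "f ` S \<subseteq> R"
  shows "smooth_on S (\<lambda>x. g (f x))"
proof (rule smooth_onI_extension)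
  fix x assume x: "x \<in> S"
  obtain U f' where U: "open U" "x \<in> U" "smooth_on U f'" "\<And>y. y \<in> S \<inter> U \<Longrightarrow> f' y = f y"
    using smooth_on_local_extension[OF assms(2) x] by blast
  obtain V g' where V: "open V" "f x \<in> V" "smooth_on V g'" "\<And>y. y \<in> R \<inter> V \<Longrightarrow> g' y = g y"
    using smooth_on_local_extension[OF assms(1), of "f x"] x assms(3) by blast
  let ?W = "U \<inter> f' -` V"
  have W: "open ?W"
    using continuous_open_preimage[OF smooth_on_continuous[OF U(3)] U(1) V(1)] .
  have "smooth_on ?W (\<lambda>x. g' (f' x))"
    by (intro smooth_on_openI W Ck_on_compose[OF W V(1) _ _ smooth_on_openD[OF V(1,3)]]
        Ck_on_subset[OF smooth_on_openD[OF U(1,3)]]) auto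
  then show "\<exists>U h. open U \<and> x \<in> U \<and> smooth_on U h \<and> (\<forall>y\<in>S \<inter> U. h y = g (f y))"
    using U V W x assms(3) by (intro exI[of _ ?W] exI[of _ "\<lambda>x. g' (f' x)"]) force+
qed

lemma smooth_on_linear_compose:
  fixes f :: "'a::real_normed_vector \<Rightarrow> 'b::euclidean_space"
  assumes "bounded_linear L" "smooth_on S f"
  shows "smooth_on S (\<lambda>x. L (f x))"
  using smooth_on_compose[OF smooth_on_linear[OF assms(1), of UNIV] assms(2)] by simp

lemma smooth_on_scaleR:
  "smooth_on S f \<Longrightarrow> smooth_on S g \<Longrightarrow> smooth_on S (\<lambda>x. f x *\<^sub>R g x)"
  by (rule smooth_on_bilinear[OF bounded_bilinear_scaleR])

lemma smooth_on_mult: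
  fixes f g :: "_ \<Rightarrow> 'b::real_normed_algebra"
  shows "smooth_on S f \<Longrightarrow> smooth_on S g \<Longrightarrow> smooth_on S (\<lambda>x. f x * g x)"
  by (rule smooth_on_bilinear[OF bounded_bilinear_mult])

lemma smooth_on_inner:
  fixes f g :: "_ \<Rightarrow> 'b::real_inner"
  shows "smooth_on S f \<Longrightarrow> smooth_on S g \<Longrightarrow> smooth_on S (\<lambda>x. f x \<bullet> g x)"
  by (rule smooth_on_bilinear[OF bounded_bilinear_inner])

lemma smooth_on_minus: "smooth_on S f \<Longrightarrow> smooth_on S (\<lambda>x. - f x)"
  using smooth_on_scaleR[OF smooth_on_const[of S "-1"], of f] by simp

lemma smooth_on_diff:
  "smooth_on S f \<Longrightarrow> smooth_on S g \<Longrightarrow> smooth_on S (\<lambda>x. f x - g x)"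
  using smooth_on_add[OF _ smooth_on_minus, of S f g] by simp

lemma smooth_on_sum:
  "(\<And>i. i \<in> A \<Longrightarrow> smooth_on S (f i)) \<Longrightarrow> smooth_on S (\<lambda>x. \<Sum>i\<in>A. f i x)"
  by (induction A rule: infinite_finite_induct) (auto intro: smooth_on_add)

lemma smooth_on_inverse:
  fixes f :: "_ \<Rightarrow> real"
  assumes "smooth_on S f" "\<And>x. x \<in> S \<Longrightarrow> f x \<noteq> 0"
  shows "smooth_on S (\<lambda>x. inverse (f x))"
  by (rule smooth_on_compose[OF smooth_on_openI[OF _ Ck_on_inverse] assms(1)])
    (use assms(2) in \<open>auto simp: open_Compl\<close>)

lemma smooth_on_cis: "smooth_on S f \<Longrightarrow> smooth_on S (\<lambda>x. cis (f x))"
  using smooth_on_compose[OF smooth_on_openI[OF open_UNIV Ck_on_cis], of S f] by auto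

lemma smooth_on_has_derivative:
  "open U \<Longrightarrow> smooth_on U f \<Longrightarrow> x \<in> U \<Longrightarrow> (f has_derivative frechet_derivative f (at x)) (at x)"
  using Ck_on_SucD(1)[OF smooth_on_openD[of U f "Suc 0"]] by blast

lemma smooth_on_frechet:
  fixes f :: "'a::euclidean_space \<Rightarrow> 'b::real_normed_vector"
  assumes "open U" "smooth_on U f" "smooth_on U Y"
  shows "smooth_on U (\<lambda>x. frechet_derivative f (at x) (Y x))"
proof -
  have "smooth_on U (\<lambda>x. frechet_derivative f (at x) b)" for b
    using Ck_on_SucD(2)[OF smooth_on_openD[OF assms(1,2)]] assms(1) by (intro smooth_on_openI)
  then have "smooth_on U (\<lambda>x. \<Sum>b\<in>Basis. (Y x \<bullet> b) *\<^sub>R frechet_derivative f (at x) b)"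
    using assms by (intro smooth_on_sum smooth_on_scaleR smooth_on_inner) auto
  then show ?thesis
    by (rule smooth_on_cong)
       (metis linear_sum_Basis has_derivative_linear smooth_on_has_derivative[OF assms(1,2)])
qed

lemma smooth_on_has_vector_derivative:
  assumes "open I" "smooth_on I c" "t \<in> I"
  shows "(c has_vector_derivative vector_derivative c (at t)) (at t)"
  using smooth_on_has_derivative[OF assms] differentiableI vector_derivative_works by blast

lemma smooth_on_vector_derivative:
  assumes "open I" "smooth_on I c"
  shows "smooth_on I (\<lambda>t. vector_derivative c (at t))"
proof (rule smooth_on_cong[OF smooth_on_frechet[OF assms smooth_on_const[of _ 1]]])
  fix t assume "t \<in> I"
  then show "frechet_derivative c (at t) 1 = vector_derivative c (at t)"
    using frechet_derivative_eq_vector_derivative[of c t]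
      differentiableI[OF smooth_on_has_derivative[OF assms]] by simp
qed

text \<open>Both mixed partial derivatives are, up to a mean-value error in the base point, the second
  difference of \<open>f\<close> over the same small parallelogram.\<close>

lemma second_difference_mean_value:
  fixes f :: "'a::euclidean_space \<Rightarrow> real"
  assumes U: "open U" "smooth_on U f" and h: "0 < h"
    and sub: "\<And>s t. 0 \<le> s \<Longrightarrow> s \<le> h \<Longrightarrow> 0 \<le> t \<Longrightarrow> t \<le> h \<Longrightarrow> x + s *\<^sub>R u + t *\<^sub>R v \<in> U"
  obtains s t where "0 < s" "s < h" "0 < t" "t < h"
    "f (x + h *\<^sub>R u + h *\<^sub>R v) - f (x + h *\<^sub>R u) - f (x + h *\<^sub>R v) + f x
      = h * h * frechet_derivative (\<lambda>y. frechet_derivative f (at y) u) (at (x + s *\<^sub>R u + t *\<^sub>R v)) v"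
proof -
  let ?Du = "\<lambda>y. frechet_derivative f (at y) u"
  have dir: "((\<lambda>r. F (y + r *\<^sub>R w)) has_real_derivative frechet_derivative F (at (y + r *\<^sub>R w)) w) (at r)"
    if "smooth_on U F" "y + r *\<^sub>R w \<in> U" for F :: "'a \<Rightarrow> real" and y w r
  proof -
    have F: "(F has_derivative frechet_derivative F (at (y + r *\<^sub>R w))) (at (y + r *\<^sub>R w))"
      using smooth_on_has_derivative[OF U(1) that] .
    have "((\<lambda>r. y + r *\<^sub>R w) has_derivative (\<lambda>d. d *\<^sub>R w)) (at r)"
      by (auto intro!: derivative_eq_intros)
    from diff_chain_at[OF this F] linear_scale[OF has_derivative_linear[OF F]]
    show ?thesis by (simp add: o_def has_field_derivative_def mult_commute_abs)
  qed
  let ?g = "\<lambda>r. f ((x + h *\<^sub>R v) + r *\<^sub>R u) - f (x + r *\<^sub>R u)"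
  have "(?g has_real_derivative ?Du ((x + h *\<^sub>R v) + r *\<^sub>R u) - ?Du (x + r *\<^sub>R u)) (at r)"
    if "0 \<le> r" "r \<le> h" for r
    using dir[OF U(2), of "x + h *\<^sub>R v" r u] dir[OF U(2), of x r u] sub[of r h] sub[of r 0] that h
    by (intro DERIV_diff) (auto simp: algebra_simps)
  from MVT2[OF h this] obtain s where s: "0 < s" "s < h"
    "?g h - ?g 0 = h * (?Du ((x + h *\<^sub>R v) + s *\<^sub>R u) - ?Du (x + s *\<^sub>R u))" by auto
  have sm: "smooth_on U ?Du" using smooth_on_frechet[OF U] by auto
  have "((\<lambda>r. ?Du (x + s *\<^sub>R u + r *\<^sub>R v)) has_real_derivative
      frechet_derivative ?Du (at (x + s *\<^sub>R u + r *\<^sub>R v)) v) (at r)" if "0 \<le> r" "r \<le> h" for r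
    using dir[OF sm, of "x + s *\<^sub>R u" r v] sub[of s r] that s by auto
  from MVT2[OF h this] obtain t where t: "0 < t" "t < h"
    "?Du (x + s *\<^sub>R u + h *\<^sub>R v) - ?Du (x + s *\<^sub>R u + 0 *\<^sub>R v)
      = h * frechet_derivative ?Du (at (x + s *\<^sub>R u + t *\<^sub>R v)) v" by auto
  show ?thesis
    using that[OF s(1,2) t(1,2)] s(3) t(3) by (simp add: algebra_simps)
qed

lemma frechet_derivative_commute_real:
  fixes f :: "'a::euclidean_space \<Rightarrow> real"
  assumes U: "open U" "smooth_on U f" "x \<in> U"
  shows "frechet_derivative (\<lambda>y. frechet_derivative f (at y) u) (at x) v =
         frechet_derivative (\<lambda>y. frechet_derivative f (at y) v) (at x) u"
proof -
  define A where "A = (\<lambda>y. frechet_derivative (\<lambda>y. frechet_derivative f (at y) u) (at y) v)"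
  define B where "B = (\<lambda>y. frechet_derivative (\<lambda>y. frechet_derivative f (at y) v) (at y) u)"
  have cont: "continuous (at x) A" "continuous (at x) B"
    unfolding A_def B_def using U
    by (auto intro!: continuous_on_interior[OF smooth_on_continuous] smooth_on_frechet
        simp: interior_open)
  have "\<bar>A x - B x\<bar> < e" if "e > 0" for e
  proof -
    obtain d1 where d1: "d1 > 0" "\<And>y. dist y x < d1 \<Longrightarrow> \<bar>A y - A x\<bar> < e/2"
      using cont(1) \<open>e > 0\<close> unfolding continuous_at_eps_delta dist_real_def by (metis half_gt_zero)
    obtain d2 where d2: "d2 > 0" "\<And>y. dist y x < d2 \<Longrightarrow> \<bar>B y - B x\<bar> < e/2"
      using cont(2) \<open>e > 0\<close> unfolding continuous_at_eps_delta dist_real_def by (metis half_gt_zero)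
    obtain d3 where d3: "d3 > 0" "\<And>y. dist y x < d3 \<Longrightarrow> y \<in> U"
      using U(1,3) unfolding open_dist by blast
    define d where "d = min d1 (min d2 d3)"
    have d: "d > 0" "d \<le> d1" "d \<le> d2" "d \<le> d3" using d1 d2 d3 by (auto simp: d_def)
    define h where "h = d / (2 * (norm u + norm v + 1))"
    have n: "0 < norm u + norm v + 1" by (simp add: add_nonneg_pos)
    have h: "h > 0" using d(1) n by (simp add: h_def)
    have hd: "h * (norm u + norm v) < d"
    proof -
      have "h * (norm u + norm v) \<le> h * (norm u + norm v + 1)" using h by simp
      also have "\<dots> = d / 2" using n by (simp add: h_def field_simps)
      finally show ?thesis using d(1) by simp
    qed
    have near: "dist (x + s *\<^sub>R a + t *\<^sub>R b) x < d"
      if "0 \<le> s" "s \<le> h" "0 \<le> t" "t \<le> h" "norm a + norm b = norm u + norm v" for s t a b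
    proof -
      have "dist (x + s *\<^sub>R a + t *\<^sub>R b) x \<le> s * norm a + t * norm b"
        using norm_triangle_ineq[of "s *\<^sub>R a" "t *\<^sub>R b"] that by (simp add: dist_norm)
      also have "\<dots> \<le> h * norm a + h * norm b" using that by (intro add_mono mult_right_mono) auto
      also have "\<dots> = h * (norm u + norm v)" using that by (metis distrib_left)
      finally show ?thesis using hd by simp
    qed
    obtain s t where st: "0 < s" "s < h" "0 < t" "t < h"
      "f (x + h *\<^sub>R u + h *\<^sub>R v) - f (x + h *\<^sub>R u) - f (x + h *\<^sub>R v) + f x
        = h * h * A (x + s *\<^sub>R u + t *\<^sub>R v)"
      using second_difference_mean_value[OF U(1,2) h, of x u v] near d3(2) d(4)
      unfolding A_def by (smt (verit, best))
    obtain s' t' where st': "0 < s'" "s' < h" "0 < t'" "t' < h"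
      "f (x + h *\<^sub>R v + h *\<^sub>R u) - f (x + h *\<^sub>R v) - f (x + h *\<^sub>R u) + f x
        = h * h * B (x + s' *\<^sub>R v + t' *\<^sub>R u)"
      using second_difference_mean_value[OF U(1,2) h, of x v u] near d3(2) d(4)
      unfolding B_def by (smt (verit, best))
    have "h * h * A (x + s *\<^sub>R u + t *\<^sub>R v) = h * h * B (x + s' *\<^sub>R v + t' *\<^sub>R u)"
      using st(5) st'(5) by (simp add: algebra_simps)
    then have "A (x + s *\<^sub>R u + t *\<^sub>R v) = B (x + s' *\<^sub>R v + t' *\<^sub>R u)" using h by simp
    moreover have "\<bar>A (x + s *\<^sub>R u + t *\<^sub>R v) - A x\<bar> < e/2"
      using near[of s t u v] st d by (intro d1(2)) auto
    moreover have "\<bar>B (x + s' *\<^sub>R v + t' *\<^sub>R u) - B x\<bar> < e/2"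
      using near[of s' t' v u] st' d by (intro d2(2)) auto
    ultimately show ?thesis by linarith
  qed
  from this[of "\<bar>A x - B x\<bar>"] show ?thesis unfolding A_def B_def by force
qed

lemma frechet_derivative_inner_const:
  assumes "(f has_derivative f') (at x)"
  shows "frechet_derivative (\<lambda>y. f y \<bullet> w) (at x) v = f' v \<bullet> w"
  using frechet_derivative_eqI[OF has_derivative_inner_left[OF assms]] by metis

lemma frechet_derivative_commute:
  fixes f :: "'a::euclidean_space \<Rightarrow> 'b::euclidean_space"
  assumes U: "open U" "smooth_on U f" "x \<in> U"
  shows "frechet_derivative (\<lambda>y. frechet_derivative f (at y) u) (at x) v =
         frechet_derivative (\<lambda>y. frechet_derivative f (at y) v) (at x) u"
proof (rule euclidean_eqI)
  fix b :: 'b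
  have *: "frechet_derivative (\<lambda>y. frechet_derivative (\<lambda>z. f z \<bullet> b) (at y) u) (at x) v =
        frechet_derivative (\<lambda>y. frechet_derivative f (at y) u) (at x) v \<bullet> b" for u v
  proof -
    have "smooth_on U (\<lambda>y. frechet_derivative f (at y) u)" using smooth_on_frechet[OF U(1,2)] by auto
    note d = smooth_on_has_derivative[OF U(1) this U(3)]
    have "frechet_derivative (\<lambda>z. f z \<bullet> b) (at y) u = frechet_derivative f (at y) u \<bullet> b" if "y \<in> U" for y
      by (rule frechet_derivative_inner_const[OF smooth_on_has_derivative[OF U(1,2) that]])
    then have "((\<lambda>y. frechet_derivative (\<lambda>z. f z \<bullet> b) (at y) u) has_derivative
        (\<lambda>v. frechet_derivative (\<lambda>y. frechet_derivative f (at y) u) (at x) v \<bullet> b)) (at x)"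
      by (intro has_derivative_transform_within_open[OF has_derivative_inner_left[OF d] U(1,3)]) simp
    then show ?thesis by (simp add: frechet_derivative_eqI)
  qed
  have "smooth_on U (\<lambda>z. f z \<bullet> b)" using U by (intro smooth_on_inner) auto
  from frechet_derivative_commute_real[OF U(1) this U(3), of u v]
  show "frechet_derivative (\<lambda>y. frechet_derivative f (at y) u) (at x) v \<bullet> b =
        frechet_derivative (\<lambda>y. frechet_derivative f (at y) v) (at x) u \<bullet> b"
    unfolding * .
qed

text \<open>Expanding the direction in the finite basis reduces this to the product rule for a coefficient of
  \<open>Y\<close> and a partial derivative of \<open>f\<close>.\<close>

lemma has_derivative_frechet_along:
  fixes f :: "'a::euclidean_space \<Rightarrow> 'b::euclidean_space"
  assumes U: "open U" "smooth_on U f" "x \<in> U" and Y: "(Y has_derivative Y') (at x)"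
  shows "((\<lambda>y. frechet_derivative f (at y) (Y y)) has_derivative
    (\<lambda>u. frechet_derivative (\<lambda>y. frechet_derivative f (at y) (Y x)) (at x) u
        + frechet_derivative f (at x) (Y' u))) (at x)"
proof -
  let ?D = "\<lambda>b y. frechet_derivative f (at y) b"
  have D: "(?D b has_derivative frechet_derivative (?D b) (at x)) (at x)" for b
    by (rule smooth_on_has_derivative[OF U(1) smooth_on_frechet[OF U(1,2)] U(3)]) auto
  have rep: "?D w y = (\<Sum>b\<in>Basis. (w \<bullet> b) *\<^sub>R ?D b y)" if "y \<in> U" for y w
    by (rule linear_sum_Basis[OF has_derivative_linear[OF smooth_on_has_derivative[OF U(1,2) that]]])
  have "((\<lambda>y. \<Sum>b\<in>Basis. (Y y \<bullet> b) *\<^sub>R ?D b y) has_derivative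
      (\<lambda>u. \<Sum>b\<in>Basis. (Y x \<bullet> b) *\<^sub>R frechet_derivative (?D b) (at x) u + (Y' u \<bullet> b) *\<^sub>R ?D b x)) (at x)"
    by (intro has_derivative_sum has_derivative_scaleR has_derivative_inner_left Y D)
  moreover have "frechet_derivative (?D (Y x)) (at x) = 
      (\<lambda>u. \<Sum>b\<in>Basis. (Y x \<bullet> b) *\<^sub>R frechet_derivative (?D b) (at x) u)"
  proof (rule frechet_derivative_eqI,
      rule has_derivative_transform_within_open[OF _ U(1,3), of "\<lambda>y. \<Sum>b\<in>Basis. (Y x \<bullet> b) *\<^sub>R ?D b y"])
    show "((\<lambda>y. \<Sum>b\<in>Basis. (Y x \<bullet> b) *\<^sub>R ?D b y) has_derivative
       (\<lambda>u. \<Sum>b\<in>Basis. (Y x \<bullet> b) *\<^sub>R frechet_derivative (?D b) (at x) u)) (at x)"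
      by (intro has_derivative_sum has_derivative_scaleR_right D)
    show "(\<Sum>b\<in>Basis. (Y x \<bullet> b) *\<^sub>R ?D b y) = ?D (Y x) y" if "y \<in> U" for y
      using rep[OF that, of "Y x"] by metis
  qed
  moreover have "?D (Y' u) x = (\<Sum>b\<in>Basis. (Y' u \<bullet> b) *\<^sub>R ?D b x)" for u by (rule rep[OF U(3)])
  ultimately have "((\<lambda>y. \<Sum>b\<in>Basis. (Y y \<bullet> b) *\<^sub>R ?D b y) has_derivative
    (\<lambda>u. frechet_derivative (?D (Y x)) (at x) u + ?D (Y' u) x)) (at x)"
    by (simp add: sum.distrib)
  then show ?thesis
    by (rule has_derivative_transform_within_open[OF _ U(1,3)]) (metis rep)
qed

text \<open>By continuity the derivative stays away from \<open>0\<close> near \<open>s\<close>, so the inverse function theorem provides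
  a differentiable inverse, whose higher regularity then follows from the formula for its derivative.\<close>

lemma smooth_local_inverse:
  fixes g :: "real \<Rightarrow> real"
  assumes U: "open U" "smooth_on U g" "s \<in> U" and nz: "vector_derivative g (at s) \<noteq> 0"
  obtains V J h where "open V" "s \<in> V" "V \<subseteq> U" "open J" "g ` V \<subseteq> J" "smooth_on J h"
    "\<And>t. t \<in> V \<Longrightarrow> h (g t) = t" "h ` J \<subseteq> V" "\<And>y. y \<in> J \<Longrightarrow> g (h y) = y"
proof -
  define g' where "g' t = vector_derivative g (at t)" for t
  have dg: "(g has_real_derivative g' t) (at t)" if "t \<in> U" for t
    using smooth_on_has_vector_derivative[OF U(1,2) that]
    unfolding g'_def by (simp add: has_real_derivative_iff_has_vector_derivative)
  have smg': "smooth_on U g'" unfolding g'_def using smooth_on_vector_derivative[OF U(1,2)] .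
  define U0 where "U0 = U \<inter> g' -` (- {0})"
  have U0: "open U0" "s \<in> U0" "U0 \<subseteq> U"
    unfolding U0_def using continuous_open_preimage[OF smooth_on_continuous[OF smg'] U(1), of "- {0}"] U nz
    by (auto simp: g'_def)
  have 1: "(g has_derivative blinfun_apply (blinfun_scaleR_right (g' t))) (at t)" if "t \<in> U0" for t
    using dg[of t] that U0 by (auto simp: has_field_derivative_def scaleR_conv_of_real[abs_def] fun_eq_iff)
  have 2: "continuous_on U0 (\<lambda>t. blinfun_scaleR_right (g' t))"
    using continuous_on_subset[OF smooth_on_continuous[OF smg'] U0(3)]
    by (intro bounded_linear.continuous_on[OF bounded_linear_blinfun_scaleR_right])
  have 3: "blinfun_scaleR_right (inverse (g' s)) o\<^sub>L blinfun_scaleR_right (g' s) = id_blinfun"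
    using nz by (intro blinfun_eqI) (simp add: g'_def)
  obtain V W J h h' where H: "open V" "V \<subseteq> U0" "s \<in> V" "open J" "g s \<in> J" "homeomorphism V J g h"
      "\<And>y. y \<in> J \<Longrightarrow> (h has_derivative (h' y)) (at y)"
    by (rule inverse_function_theorem[OF U0(1) 1 2 U0(2) 3]) blast+
  have hg: "h ` J \<subseteq> V" "\<And>t. t \<in> V \<Longrightarrow> h (g t) = t" "\<And>y. y \<in> J \<Longrightarrow> g (h y) = y" "g ` V \<subseteq> J"
    using H(6) by (auto simp: homeomorphism_def)
  have dh: "(h has_derivative (\<lambda>v. v * inverse (g' (h y)))) (at y)" if "y \<in> J" for y
  proof -
    have hy: "h y \<in> U0" using that hg(1) H(2) by blast
    have "(h has_real_derivative inverse (g' (h y))) (at y)"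
    proof (rule has_field_derivative_inverse_basic[where f = g])
      show "(g has_real_derivative g' (h y)) (at (h y))" using dg hy U0 by auto
      show "g' (h y) \<noteq> 0" using hy by (auto simp: U0_def)
      show "continuous (at y) h" using has_derivative_continuous[OF H(7)[OF that]] .
    qed (use H(4) that hg(3) in auto)
    then show ?thesis by (simp add: has_field_derivative_def mult_commute_abs)
  qed
  \<comment> \<open>bootstrapping: \<open>h'\<close> is \<open>1 / g'\<close> composed with \<open>h\<close>\<close>
  have "Ck_on k h J" for k
  proof (induction k)
    case 0
    then show ?case using H(6) by (simp add: homeomorphism_def)
  next
    case (Suc k)
    have g'h: "Ck_on k (\<lambda>y. g' (h y)) J"
      by (rule Ck_on_compose[OF H(4) U(1) _ Suc smooth_on_openD[OF U(1) smg']])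
        (use U0 H(2) hg(1) in blast)
    have "g' (h y) \<noteq> 0" if "y \<in> J" for y
      using hg(1) H(2) that unfolding U0_def by blast
    then have "Ck_on k (\<lambda>y. inverse (g' (h y))) J"
      by (intro Ck_on_compose[OF H(4) _ _ g'h Ck_on_inverse]) auto
    then have "Ck_on k (\<lambda>y. v * inverse (g' (h y))) J" for v
      by (intro Ck_on_bilinear[OF bounded_bilinear_mult] Ck_on_const H(4))
    then show ?case by (intro Ck_on_SucI[OF H(4) dh])
  qed
  then have "smooth_on J h" by (intro smooth_on_openI H(4))
  then show ?thesis using that[of V J h] H hg U0(3) by blast
qed

section \<open>The Hermitian form and the Hopf map\<close>

definition herm :: "complex^'n \<Rightarrow> complex^'n \<Rightarrow> complex" where
  "herm p q = (\<Sum>i\<in>UNIV. p $ i * cnj (q $ i))"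

lemma bounded_bilinear_herm: "bounded_bilinear (herm :: complex^'n::finite \<Rightarrow> _)"
  unfolding bilinear_conv_bounded_bilinear[symmetric] bilinear_def
  by (auto simp: herm_def linear_iff algebra_simps sum.distrib scaleR_sum_right)

lemma bounded_bilinear_smult:
  "bounded_bilinear ((*s) :: complex \<Rightarrow> complex^'n::finite \<Rightarrow> complex^'n)"
  unfolding bilinear_conv_bounded_bilinear[symmetric] bilinear_def
  by (auto simp: linear_iff vec_eq_iff algebra_simps)

lemmas smooth_on_herm = smooth_on_bilinear[OF bounded_bilinear_herm]
lemmas smooth_on_smult = smooth_on_bilinear[OF bounded_bilinear_smult]

lemma herm_add_left: "herm (p + q) r = herm p r + herm q r"
  and herm_add_right: "herm p (q + r) = herm p q + herm p r"
  and herm_diff_left: "herm (p - q) r = herm p r - herm q r"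
  and herm_diff_right: "herm p (q - r) = herm p q - herm p r"
  and herm_minus_left: "herm (- p) q = - herm p q"
  and herm_minus_right: "herm p (- q) = - herm p q"
  and herm_smult_left: "herm (z *s p) q = z * herm p q"
  and herm_smult_right: "herm p (z *s q) = cnj z * herm p q"
  and herm_scaleR_left: "herm (a *\<^sub>R p) q = of_real a * herm p q"
  and herm_scaleR_right: "herm p (a *\<^sub>R q) = of_real a * herm p q"
  and herm_zero_left: "herm 0 q = 0"
  and herm_zero_right: "herm p 0 = 0"
  by (simp_all add: herm_def algebra_simps sum.distrib sum_subtractf sum_negf sum_distrib_left
      scaleR_conv_of_real[where 'a=complex])

lemmas herm_simps = herm_add_left herm_add_right herm_diff_left herm_diff_right herm_minus_left
  herm_minus_right herm_smult_left herm_smult_right herm_scaleR_left herm_scaleR_right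
  herm_zero_left herm_zero_right

lemma cnj_herm: "cnj (herm p q) = herm q p"
  by (simp add: herm_def mult.commute)

lemma inner_eq_Re_herm: "p \<bullet> q = Re (herm p q)"
  by (simp add: herm_def inner_vec_def inner_complex_def)

lemma inner_times_i: "p \<bullet> (\<i> *s q) = Im (herm p q)"
  by (simp add: inner_eq_Re_herm herm_simps)

lemma herm_eq_inner: "herm p q = Complex (p \<bullet> q) (p \<bullet> (\<i> *s q))"
  by (simp add: inner_eq_Re_herm inner_times_i[unfolded inner_eq_Re_herm] complex_eq_iff)

lemma herm_self: "norm p = 1 \<Longrightarrow> herm p p = 1"
  using cnj_herm[of p p] 
  by (simp add: complex_eq_iff norm_eq_1 inner_eq_Re_herm)

lemma horizontal_part_eq: "horizontal_part p w = w - herm w p *s p"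
  by (simp add: horizontal_part_def herm_eq_inner vec_eq_iff complex_eq_iff algebra_simps)

lemma horizontal_part_add: "horizontal_part p (v + w) = horizontal_part p v + horizontal_part p w"
  and horizontal_part_diff: "horizontal_part p (v - w) = horizontal_part p v - horizontal_part p w"
  and horizontal_part_scaleR: "horizontal_part p (r *\<^sub>R v) = r *\<^sub>R horizontal_part p v"
  and horizontal_part_smult: "horizontal_part p (z *s v) = z *s horizontal_part p v"
  by (simp_all add: horizontal_part_eq herm_simps vec_eq_iff algebra_simps scaleR_conv_of_real[where 'a=complex])

lemma horizontal_part_fibre: "norm p = 1 \<Longrightarrow> horizontal_part p (z *s p) = 0"
  by (simp add: horizontal_part_eq herm_simps herm_self)

lemma herm_horizontal_part: "norm p = 1 \<Longrightarrow> herm (horizontal_part p w) p = 0"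
  by (simp add: horizontal_part_eq herm_simps herm_self)

lemma horizontal_part_ident: "herm w p = 0 \<Longrightarrow> horizontal_part p w = w"
  by (simp add: horizontal_part_eq)

lemma unit_cnj_mult: "cmod z = 1 \<Longrightarrow> cnj z * z = 1" "cmod z = 1 \<Longrightarrow> z * cnj z = 1"
  by (simp_all add: complex_norm_square[symmetric] mult.commute[of _ z])

lemma herm_rotate: "cmod z = 1 \<Longrightarrow> herm (z *s v) (z *s w) = herm v w"
  by (simp add: herm_simps mult.assoc[symmetric] unit_cnj_mult)

lemma horizontal_part_rotate:
  "cmod z = 1 \<Longrightarrow> horizontal_part (z *s p) (z *s w) = z *s horizontal_part p w"
  by (simp add: horizontal_part_eq herm_rotate vec_eq_iff algebra_simps)

lemma inner_smult_unit: "cmod z = 1 \<Longrightarrow> (z *s v) \<bullet> (z *s w) = v \<bullet> w"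
  by (simp add: inner_eq_Re_herm herm_rotate)

lemma norm_smult_unit: "cmod z = 1 \<Longrightarrow> norm (z *s p) = norm p"
  by (simp add: norm_eq_sqrt_inner inner_smult_unit)

lemma smult_left_cancel: "norm (p::complex^'n::finite) = 1 \<Longrightarrow> z *s p = z' *s p \<Longrightarrow> z = z'"
  using herm_self[of p] by (metis herm_smult_left mult.right_neutral)

lemma hopf_rotate:
  assumes z: "cmod z = 1"
  shows "hopf (z *s p) = hopf p"
proof (intro equalityI subsetI)
  fix q assume "q \<in> hopf (z *s p)"
  then obtain u where "cmod u = 1" "q = u *s (z *s p)" by (auto simp: hopf_def)
  then show "q \<in> hopf p"
    using z unfolding hopf_def by (auto intro!: exI[of _ "u * z"] simp: norm_mult)
next
  fix q assume "q \<in> hopf p"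
  then obtain u where u: "cmod u = 1" "q = u *s p" by (auto simp: hopf_def)
  have "q = (u * cnj z) *s (z *s p)" using unit_cnj_mult[OF z] by (simp add: u mult.assoc)
  then show "q \<in> hopf (z *s p)"
    using z u(1) unfolding hopf_def by (intro CollectI exI[of _ "u * cnj z"]) (simp add: norm_mult)
qed

lemma hopf_eqD:
  assumes "norm p = 1" "hopf q = hopf p"
  shows "q = herm q p *s p" "cmod (herm q p) = 1"
proof -
  have "q \<in> hopf q" unfolding hopf_def by (auto intro!: exI[of _ 1])
  then obtain z where "q = z *s p" "cmod z = 1" using assms(2) by (auto simp: hopf_def)
  then show "q = herm q p *s p" "cmod (herm q p) = 1"
    using herm_self[OF assms(1)] by (simp_all add: herm_simps)
qed

section \<open>Tangent vectors of projective space\<close>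

lemma mem_dhopf_rotate:
  "(q, u) \<in> dhopf p v \<longleftrightarrow> (\<exists>z. cmod z = 1 \<and> q = z *s p \<and> u = z *s horizontal_part p v)"
  by (auto simp: dhopf_def)

lemma dhopf_rotate:
  assumes z: "cmod z = 1"
  shows "dhopf (z *s p) (z *s w) = dhopf p w"
proof (rule set_eqI, clarify)
  fix q a
  let ?h = "horizontal_part p w"
  show "(q, a) \<in> dhopf (z *s p) (z *s w) \<longleftrightarrow> (q, a) \<in> dhopf p w"
    unfolding mem_dhopf_rotate horizontal_part_rotate[OF z]
  proof
    assume "\<exists>u. cmod u = 1 \<and> q = u *s (z *s p) \<and> a = u *s (z *s ?h)"
    then obtain u where "cmod u = 1" "q = u *s (z *s p)" "a = u *s (z *s ?h)" by blast
    then show "\<exists>u. cmod u = 1 \<and> q = u *s p \<and> a = u *s ?h"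
      using z by (intro exI[of _ "u * z"]) (simp add: norm_mult)
  next
    assume "\<exists>u. cmod u = 1 \<and> q = u *s p \<and> a = u *s ?h"
    then obtain u where "cmod u = 1" "q = u *s p" "a = u *s ?h" by blast
    then show "\<exists>u. cmod u = 1 \<and> q = u *s (z *s p) \<and> a = u *s (z *s ?h)"
      using z unit_cnj_mult[OF z] by (intro exI[of _ "u * cnj z"]) (simp add: norm_mult mult.assoc)
  qed
qed

lemma mem_dhopf:
  assumes "norm p = 1"
  shows "(p, u) \<in> dhopf p v \<longleftrightarrow> u = horizontal_part p v"
proof
  assume "(p, u) \<in> dhopf p v"
  then obtain z where "p = z *s p" "u = z *s horizontal_part p v" by (auto simp: mem_dhopf_rotate)
  then show "u = horizontal_part p v" using smult_left_cancel[OF assms, of 1 z] by simp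
qed (auto simp: mem_dhopf_rotate intro!: exI[of _ 1])

lemma dhopf_eq_iff:
  assumes "norm p = 1"
  shows "dhopf p v = dhopf p w \<longleftrightarrow> horizontal_part p v = horizontal_part p w"
proof
  assume "dhopf p v = dhopf p w"
  then show "horizontal_part p v = horizontal_part p w" using mem_dhopf[OF assms] by metis
qed (simp add: dhopf_def)

lemma dhopf_horizontal_part: "norm p = 1 \<Longrightarrow> dhopf p (horizontal_part p v) = dhopf p v"
  by (simp add: dhopf_eq_iff horizontal_part_ident herm_horizontal_part)

lemma dhopf_add_fibre: "norm p = 1 \<Longrightarrow> dhopf p (v + z *s p) = dhopf p v"
  by (simp add: dhopf_eq_iff horizontal_part_add horizontal_part_fibre)

lemma dhopf_vectors_unique:
  assumes "norm p = 1" "(q, u) \<in> dhopf p v" "(q, u') \<in> dhopf p w"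
  obtains z where "cmod z = 1" "u = z *s horizontal_part p v" "u' = z *s horizontal_part p w"
  using assms smult_left_cancel[OF assms(1)] unfolding mem_dhopf_rotate by metis

lemma cp_inner_dhopf:
  assumes "norm p = 1"
  shows "cp_inner (dhopf p v) (dhopf p w) = horizontal_part p v \<bullet> horizontal_part p w"
  unfolding cp_inner_def
proof (rule the_equality)
  show "\<exists>q a b. (q, a) \<in> dhopf p v \<and> (q, b) \<in> dhopf p w
      \<and> horizontal_part p v \<bullet> horizontal_part p w = a \<bullet> b"
    using mem_dhopf[OF assms] by blast
next
  fix r assume "\<exists>q a b. (q, a) \<in> dhopf p v \<and> (q, b) \<in> dhopf p w \<and> r = a \<bullet> b"
  then show "r = horizontal_part p v \<bullet> horizontal_part p w"
    using dhopf_vectors_unique[OF assms] inner_smult_unit by metis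
qed

lemma cp_add_dhopf:
  assumes "norm p = 1"
  shows "cp_add (dhopf p v) (dhopf p w) = dhopf p (v + w)"
proof (rule set_eqI, clarify)
  fix q a
  show "(q, a) \<in> cp_add (dhopf p v) (dhopf p w) \<longleftrightarrow> (q, a) \<in> dhopf p (v + w)"
  proof
    assume "(q, a) \<in> cp_add (dhopf p v) (dhopf p w)"
    then obtain b c where bc: "(q, b) \<in> dhopf p v" "(q, c) \<in> dhopf p w" "a = b + c"
      by (auto simp: cp_add_def)
    then obtain z where "cmod z = 1" "q = z *s p" "b = z *s horizontal_part p v"
      using mem_dhopf_rotate by metis
    moreover obtain z' where "cmod z' = 1" "q = z' *s p" "c = z' *s horizontal_part p w"
      using bc mem_dhopf_rotate by metis
    ultimately show "(q, a) \<in> dhopf p (v + w)"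
      using smult_left_cancel[OF assms, of z z'] bc(3)
      by (auto simp: mem_dhopf_rotate horizontal_part_add vector_add_ldistrib)
  next
    assume "(q, a) \<in> dhopf p (v + w)"
    then show "(q, a) \<in> cp_add (dhopf p v) (dhopf p w)"
      by (auto simp: cp_add_def mem_dhopf_rotate horizontal_part_add vector_add_ldistrib)
  qed
qed

text \<open>Real scaling and multiplication by \<open>\<i>\<close> commute with the circle action, so they act on orbits of
  horizontal vectors.\<close>

lemma dhopf_map:
  assumes "\<And>z u. f (z *s u) = z *s f u" "f (horizontal_part p v) = horizontal_part p w"
  shows "{(q, f u) | q u. (q, u) \<in> dhopf p v} = dhopf p w"
proof (rule set_eqI, clarify)
  fix q a
  have "(\<exists>u. a = f u \<and> (q, u) \<in> dhopf p v) \<longleftrightarrow> (q, a) \<in> dhopf p w"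
    unfolding mem_dhopf_rotate by (metis assms)
  then show "(q, a) \<in> {(q, f u) | q u. (q, u) \<in> dhopf p v} \<longleftrightarrow> (q, a) \<in> dhopf p w" by simp
qed

lemma cp_scale_dhopf: "cp_scale r (dhopf p v) = dhopf p (r *\<^sub>R v)"
  unfolding cp_scale_def
  by (rule dhopf_map) (simp_all add: vec_eq_iff horizontal_part_scaleR)

lemma cp_J_dhopf: "cp_J (dhopf p v) = dhopf p (\<i> *s v)"
  unfolding cp_J_def
  by (rule dhopf_map) (simp_all add: vec_eq_iff horizontal_part_smult)

lemma curve_onD:
  assumes "curve_on S I c"
  shows "open I" "smooth_on I c" "t \<in> I \<Longrightarrow> c t \<in> S"
    "t \<in> I \<Longrightarrow> (c has_vector_derivative vector_derivative c (at t)) (at t)"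
  using assms smooth_on_has_vector_derivative unfolding curve_on_def by blast+

lemma curve_on_subset: "curve_on S I c \<Longrightarrow> open J \<Longrightarrow> J \<subseteq> I \<Longrightarrow> curve_on S J c"
  using smooth_on_subset unfolding curve_on_def by blast

text \<open>Inverse stereographic projection of the line in direction \<open>v\<close>, for \<open>v\<close> tangent to the sphere at \<open>p\<close>. Being
  rational, it makes the smoothness of curves and variations on the sphere immediate.\<close>

definition stereo :: "'a::real_inner \<Rightarrow> 'a \<Rightarrow> real \<Rightarrow> 'a" where
  "stereo p v b = inverse (1 + b * b * (v \<bullet> v) / 4) *\<^sub>R ((1 - b * b * (v \<bullet> v) / 4) *\<^sub>R p + b *\<^sub>R v)"

lemma stereo_0 [simp]: "stereo p v 0 = p"
  by (simp add: stereo_def)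

lemma stereo_denominator: "0 < 1 + b * b * (v \<bullet> v) / (4::real)"
  by (simp add: add_pos_nonneg power2_eq_square[symmetric])

lemma norm_stereo:
  assumes "norm p = 1" "v \<bullet> p = 0"
  shows "norm (stereo p v b) = 1"
proof -
  define q where "q = b * b * (v \<bullet> v) / 4"
  have q: "1 + q > 0" using stereo_denominator by (simp add: q_def)
  have "((1 - q) *\<^sub>R p + b *\<^sub>R v) \<bullet> ((1 - q) *\<^sub>R p + b *\<^sub>R v) = (1 - q)\<^sup>2 + 4 * q"
    using assms by (simp add: inner_add_left inner_add_right inner_commute[of p v] norm_eq_1
        power2_eq_square q_def)
  then have "stereo p v b \<bullet> stereo p v b = ((1 - q)\<^sup>2 + 4 * q) / (1 + q)\<^sup>2"
    by (simp add: stereo_def q_def[symmetric] power2_eq_square divide_simps)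
  also have "(1 - q)\<^sup>2 + 4 * q = (1 + q)\<^sup>2" by (simp add: power2_eq_square algebra_simps)
  finally show ?thesis using q by (simp add: norm_eq_1)
qed

lemma smooth_on_stereo:
  assumes "smooth_on S p" "smooth_on S v" "smooth_on S b"
  shows "smooth_on S (\<lambda>x. stereo (p x) (v x) (b x))"
proof -
  have "smooth_on S (\<lambda>x. b x * b x * (v x \<bullet> v x) / 4)"
    unfolding divide_inverse by (intro smooth_on_mult smooth_on_inner assms smooth_on_const)
  note q = this
  have "1 + b x * b x * (v x \<bullet> v x) / 4 \<noteq> 0" for x using stereo_denominator[of "b x" "v x"] by simp
  then show ?thesis unfolding stereo_def
    by (intro smooth_on_scaleR smooth_on_inverse smooth_on_add smooth_on_diff smooth_on_const q assms)
qed

lemma stereo_has_vector_derivative: "(stereo p v has_vector_derivative v) (at 0)"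
proof -
  have "((\<lambda>b. inverse (1 + b * b * (v \<bullet> v) / 4)) has_real_derivative 0) (at 0)"
    by (auto intro!: derivative_eq_intros)
  moreover have "((\<lambda>b. (1 - b * b * (v \<bullet> v) / 4) *\<^sub>R p + b *\<^sub>R v) has_vector_derivative v) (at 0)"
    by (auto intro!: derivative_eq_intros)
  ultimately show ?thesis
    unfolding stereo_def by (auto dest: has_vector_derivative_scaleR)
qed

lemma tangent_space_sphere:
  fixes p :: "'a::euclidean_space"
  assumes "norm p = 1"
  shows "tangent_space (sphere 0 1) p = {v. v \<bullet> p = 0}"
proof (intro equalityI subsetI, goal_cases)
  case (1 v)
  then obtain I c t where c: "curve_on (sphere 0 1) I c" "t \<in> I" "c t = p" "v = vector_derivative c (at t)"
    by (auto simp: tangent_space_def)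
  note d = curve_onD(4)[OF c(1,2), folded c(4)]
  have "((\<lambda>s. c s \<bullet> c s) has_vector_derivative (c t \<bullet> v + v \<bullet> c t)) (at t)"
    by (rule bounded_bilinear.has_vector_derivative[OF bounded_bilinear_inner d d])
  moreover have "((\<lambda>s. c s \<bullet> c s) has_vector_derivative 0) (at t)"
    by (rule has_vector_derivative_transform_within_open[OF has_vector_derivative_const
          curve_onD(1)[OF c(1)] c(2), of 1])
      (use curve_onD(3)[OF c(1)] in \<open>auto simp: norm_eq_1[symmetric]\<close>)
  ultimately have "c t \<bullet> v + v \<bullet> c t = 0" by (rule vector_derivative_unique_at)
  then show ?case using c(3) by (simp add: inner_commute)
next
  case (2 v)
  have "curve_on (sphere 0 1) UNIV (stereo p v)"
    using smooth_on_stereo[of UNIV "\<lambda>_. p" "\<lambda>_. v" "\<lambda>b. b"] norm_stereo[OF assms, of v] 2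
    by (auto simp: curve_on_def)
  moreover have "vector_derivative (stereo p v) (at 0) = v"
    by (rule vector_derivative_at[OF stereo_has_vector_derivative])
  ultimately show ?case unfolding tangent_space_def
    by (intro CollectI exI[of _ UNIV] exI[of _ "stereo p v"] exI[of _ 0]) simp
qed

lemma herm_tangent_sphere_Re:
  "norm p = 1 \<Longrightarrow> v \<in> tangent_space (sphere 0 1) p \<longleftrightarrow> Re (herm v p) = 0"
  by (simp add: tangent_space_sphere inner_eq_Re_herm)

lemma tangent_space_sphereI: "norm p = 1 \<Longrightarrow> herm v p = 0 \<Longrightarrow> v \<in> tangent_space (sphere 0 1) p"
  by (simp add: herm_tangent_sphere_Re)

lemma cp_tangent_space_hopf:
  assumes "norm p = 1"
  shows "cp_tangent_space (hopf p) = {dhopf p w | w. herm w p = 0}"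
proof (intro equalityI subsetI, goal_cases)
  case (1 X)
  then obtain q w where q: "q \<in> hopf p" "X = dhopf q w" by (auto simp: cp_tangent_space_def)
  then obtain z where z: "cmod z = 1" "q = z *s p" by (auto simp: hopf_def)
  have "w = z *s (cnj z *s w)" using unit_cnj_mult[OF z(1)] by simp
  then have "X = dhopf p (cnj z *s w)" using q z dhopf_rotate[OF z(1), of p "cnj z *s w"] by simp
  then have "X = dhopf p (horizontal_part p (cnj z *s w))" using dhopf_horizontal_part[OF assms] by simp
  then show ?case using herm_horizontal_part[OF assms] by auto
next
  case (2 X)
  moreover have "p \<in> hopf p" by (auto simp: hopf_def intro!: exI[of _ 1])
  ultimately show ?case using tangent_space_sphereI[OF assms] by (auto simp: cp_tangent_space_def)
qed

lemma smult_has_vector_derivative: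
  "(z has_vector_derivative z') (at t) \<Longrightarrow> (c has_vector_derivative c') (at t) \<Longrightarrow>
   ((\<lambda>s. z s *s c s) has_vector_derivative (z t *s c' + z' *s c t)) (at t)"
  for z :: "real \<Rightarrow> complex" and c :: "real \<Rightarrow> complex^'n::finite"
  by (rule bounded_bilinear.has_vector_derivative[OF bounded_bilinear_smult])

lemma herm_has_vector_derivative:
  "(v has_vector_derivative v') (at t) \<Longrightarrow> (c has_vector_derivative c') (at t) \<Longrightarrow>
   ((\<lambda>s. herm (v s) (c s)) has_vector_derivative (herm (v t) c' + herm v' (c t))) (at t)"
  for v c :: "real \<Rightarrow> complex^'n::finite"
  by (rule bounded_bilinear.has_vector_derivative[OF bounded_bilinear_herm])

text \<open>Two lifts of the same curve differ by a smooth phase, which the Hermitian form computes.\<close>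

lemma lift_phase:
  fixes c d :: "real \<Rightarrow> complex^'n::finite"
  assumes z_def: "z = (\<lambda>s. herm (d s) (c s))" and c: "curve_on (sphere 0 1) U c" and d: "curve_on (sphere 0 1) V d"
    and eq: "\<forall>s\<in>U \<inter> V. hopf (c s) = hopf (d s)" and t: "t \<in> U" "t \<in> V"
  shows "(z has_vector_derivative vector_derivative z (at t)) (at t)"
    and "\<forall>s\<in>U \<inter> V. d s = z s *s c s \<and> cmod (z s) = 1"
    and "vector_derivative d (at t)
      = z t *s vector_derivative c (at t) + vector_derivative z (at t) *s c t"
proof -
  have op: "open (U \<inter> V)" using curve_onD(1)[OF c] curve_onD(1)[OF d] by auto
  have sm: "smooth_on (U \<inter> V) z" unfolding z_def
    using smooth_on_subset[OF curve_onD(2)[OF c]] smooth_on_subset[OF curve_onD(2)[OF d]]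
    by (intro smooth_on_herm) auto
  have z: "d s = z s *s c s" "cmod (z s) = 1" if "s \<in> U \<inter> V" for s
    unfolding z_def using hopf_eqD[of "c s" "d s"] bspec[OF eq that] curve_onD(3)[OF c, of s] that
    by simp_all
  show dz: "(z has_vector_derivative vector_derivative z (at t)) (at t)"
    using smooth_on_has_vector_derivative[OF op sm, of t] t by simp
  show "\<forall>s\<in>U \<inter> V. d s = z s *s c s \<and> cmod (z s) = 1" using z by simp
  have "(d has_vector_derivative
      z t *s vector_derivative c (at t) + vector_derivative z (at t) *s c t) (at t)"
    by (rule has_vector_derivative_transform_within_open[OF
          smult_has_vector_derivative[OF dz curve_onD(4)[OF c t(1)]] op])
      (simp_all add: t z(1))
  then show "vector_derivative d (at t)
      = z t *s vector_derivative c (at t) + vector_derivative z (at t) *s c t"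
    by (rule vector_derivative_at)
qed

text \<open>A varying phase adds to the velocity of a lift a multiple of the point itself, which has no
  horizontal part.\<close>

lemma cp_velocity_eq:
  assumes c: "curve_on (sphere 0 1) U c" and t: "t \<in> U" and \<gamma>: "\<And>s. s \<in> U \<Longrightarrow> hopf (c s) = \<gamma> s"
  shows "cp_velocity \<gamma> t = dhopf (c t) (vector_derivative c (at t))"
  unfolding cp_velocity_def
proof (rule the_equality)
  show "\<exists>U' d. curve_on (sphere 0 1) U' d \<and> t \<in> U' \<and> (\<forall>s\<in>U'. hopf (d s) = \<gamma> s) \<and>
      dhopf (c t) (vector_derivative c (at t)) = dhopf (d t) (vector_derivative d (at t))"
    using assms by blast
next
  fix X
  assume "\<exists>V d. curve_on (sphere 0 1) V d \<and> t \<in> V \<and> (\<forall>s\<in>V. hopf (d s) = \<gamma> s) \<and>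
      X = dhopf (d t) (vector_derivative d (at t))"
  then obtain V d where d: "curve_on (sphere 0 1) V d" "t \<in> V" "\<forall>s\<in>V. hopf (d s) = \<gamma> s"
    "X = dhopf (d t) (vector_derivative d (at t))" by blast
  have same: "\<forall>s\<in>U \<inter> V. hopf (c s) = hopf (d s)" using \<gamma> d(3) by simp
  define z where "z = (\<lambda>s. herm (d s) (c s))"
  define z' where "z' = vector_derivative z (at t)"
  note z = lift_phase(2,3)[OF z_def c d(1) same t d(2), folded z'_def]
  have zt: "cmod (z t) = 1" "d t = z t *s c t" using z(1) t d(2) by auto
  have "vector_derivative d (at t)
      = z t *s (vector_derivative c (at t) + (cnj (z t) * z') *s c t)"
    using unit_cnj_mult[OF zt(1)] by (simp add: z(2) vector_add_ldistrib mult.assoc[symmetric])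
  then have "X = dhopf (c t) (vector_derivative c (at t) + (cnj (z t) * z') *s c t)"
    using d(4) zt(2) dhopf_rotate[OF zt(1)] by metis
  then show "X = dhopf (c t) (vector_derivative c (at t))"
    using dhopf_add_fibre curve_onD(3)[OF c t] by simp
qed

section \<open>The Levi-Civita connection of projective space\<close>

definition lift_of :: "real set \<Rightarrow> (real \<Rightarrow> complex^'n) \<Rightarrow> (real \<Rightarrow> ('n::finite) cpoint) \<Rightarrow> bool" where
  "lift_of U c \<gamma> \<longleftrightarrow> curve_on (sphere 0 1) U c \<and> (\<forall>s\<in>U. hopf (c s) = \<gamma> s)"

text \<open>The lifted field is horizontal, whereas the lifted curve may move along the fibres. Such lifts
  are given by smoothness alone; a horizontal lift of the curve would require solving a differential
  equation.\<close>

definition field_lift :: "real set \<Rightarrow> (real \<Rightarrow> complex^'n) \<Rightarrow> (real \<Rightarrow> complex^'n) \<Rightarrow>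
    (real \<Rightarrow> ('n::finite) cpoint) \<Rightarrow> (real \<Rightarrow> 'n cvector) \<Rightarrow> bool" where
  "field_lift U c v \<gamma> X \<longleftrightarrow> lift_of U c \<gamma> \<and> smooth_on U v \<and>
     (\<forall>s\<in>U. herm (v s) (c s) = 0 \<and> X s = dhopf (c s) (v s))"

lemma lift_ofD:
  assumes "lift_of U c \<gamma>"
  shows "open U" "smooth_on U c" "curve_on (sphere 0 1) U c" "t \<in> U \<Longrightarrow> norm (c t) = 1"
    "t \<in> U \<Longrightarrow> hopf (c t) = \<gamma> t"
    "t \<in> U \<Longrightarrow> (c has_vector_derivative vector_derivative c (at t)) (at t)"
    "t \<in> U \<Longrightarrow> cp_velocity \<gamma> t = dhopf (c t) (vector_derivative c (at t))"
  using assms curve_onD[of "sphere 0 1" U c] cp_velocity_eq[of U c t \<gamma>] unfolding lift_of_def by auto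

lemma field_liftD:
  assumes "field_lift U c v \<gamma> X"
  shows "lift_of U c \<gamma>" "smooth_on U v" "t \<in> U \<Longrightarrow> herm (v t) (c t) = 0"
    "t \<in> U \<Longrightarrow> X t = dhopf (c t) (v t)"
    "t \<in> U \<Longrightarrow> (v has_vector_derivative vector_derivative v (at t)) (at t)"
  using assms lift_ofD(1) smooth_on_has_vector_derivative unfolding field_lift_def by blast+

lemma lift_of_subset: "lift_of U c \<gamma> \<Longrightarrow> open V \<Longrightarrow> V \<subseteq> U \<Longrightarrow> lift_of V c \<gamma>"
  using curve_on_subset unfolding lift_of_def by blast

lemma field_lift_subset: "field_lift U c v \<gamma> X \<Longrightarrow> open V \<Longrightarrow> V \<subseteq> U \<Longrightarrow> field_lift V c v \<gamma> X"
  using lift_of_subset smooth_on_subset unfolding field_lift_def by blast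

lemma smooth_on_horizontal_part:
  fixes c v :: "'a::real_normed_vector \<Rightarrow> complex^'n::finite"
  shows "smooth_on S c \<Longrightarrow> smooth_on S v \<Longrightarrow> smooth_on S (\<lambda>s. horizontal_part (c s) (v s))"
  unfolding horizontal_part_eq by (intro smooth_on_diff smooth_on_smult smooth_on_herm)

lemma field_lift_horizontal_part:
  assumes "lift_of U c \<gamma>" "smooth_on U v" "\<And>s. s \<in> U \<Longrightarrow> X s = dhopf (c s) (v s)"
  shows "field_lift U c (\<lambda>s. horizontal_part (c s) (v s)) \<gamma> X"
  using assms lift_ofD[OF assms(1)]
  by (auto simp: field_lift_def herm_horizontal_part dhopf_horizontal_part
      intro: smooth_on_horizontal_part)

lemma field_along_lift:
  assumes "field_along I \<gamma> X" "open I" "t \<in> I"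
  obtains U c v where "t \<in> U" "U \<subseteq> I" "field_lift U c v \<gamma> X"
proof -
  obtain U c v where U: "open U" "t \<in> U" "smooth_on U c" "smooth_on U v"
    "\<forall>s\<in>U. c s \<in> sphere 0 1 \<and> v s \<in> tangent_space (sphere 0 1) (c s)"
    "\<forall>s\<in>I \<inter> U. hopf (c s) = \<gamma> s \<and> X s = dhopf (c s) (v s)"
    using assms(1,3) unfolding field_along_def by metis
  have "lift_of (I \<inter> U) c \<gamma>"
    using U assms(2) smooth_on_subset[OF U(3)] unfolding lift_of_def curve_on_def by auto
  then have "field_lift (I \<inter> U) c (\<lambda>s. horizontal_part (c s) (v s)) \<gamma> X"
    using U(6) smooth_on_subset[OF U(4)] by (intro field_lift_horizontal_part) auto
  then show ?thesis using that[of "I \<inter> U"] U(2) assms(3) by blast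
qed

lemma field_alongI:
  assumes "\<And>t. t \<in> I \<Longrightarrow> \<exists>U c v. t \<in> U \<and> field_lift U c v \<gamma> X"
  shows "field_along I \<gamma> X"
  unfolding field_along_def
proof
  fix t assume "t \<in> I"
  then obtain U c v where U: "t \<in> U" "field_lift U c v \<gamma> X" using assms by blast
  note L = field_liftD[OF U(2)]
  have "open U \<and> t \<in> U \<and> smooth_on U c \<and> smooth_on U v \<and>
      (\<forall>s\<in>U. c s \<in> sphere 0 1 \<and> v s \<in> tangent_space (sphere 0 1) (c s)) \<and>
      (\<forall>s\<in>I \<inter> U. hopf (c s) = \<gamma> s \<and> X s = dhopf (c s) (v s))"
    using U(1) L lift_ofD[OF L(1)] by (auto intro!: tangent_space_sphereI)
  then show "\<exists>U c v. open U \<and> t \<in> U \<and> smooth_on U c \<and> smooth_on U v \<and>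
      (\<forall>s\<in>U. c s \<in> sphere 0 1 \<and> v s \<in> tangent_space (sphere 0 1) (c s)) \<and>
      (\<forall>s\<in>I \<inter> U. hopf (c s) = \<gamma> s \<and> X s = dhopf (c s) (v s))" by blast
qed

lemma field_lift_imp_field_along: "field_lift U c v \<gamma> X \<Longrightarrow> field_along U \<gamma> X"
  by (rule field_alongI) blast

lemma horizontal_unique:
  "norm p = 1 \<Longrightarrow> herm v p = 0 \<Longrightarrow> herm w p = 0 \<Longrightarrow> dhopf p v = dhopf p w \<Longrightarrow> v = w"
  by (simp add: dhopf_eq_iff horizontal_part_ident)

lemma field_lift_change:
  assumes v: "field_lift U c v \<gamma> X" and d: "lift_of V d \<gamma>"
  shows "field_lift (U \<inter> V) d (\<lambda>s. herm (d s) (c s) *s v s) \<gamma> X"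
proof -
  note c = field_liftD(1)[OF v]
  have op: "open (U \<inter> V)" using lift_ofD(1)[OF c] lift_ofD(1)[OF d] by auto
  have z: "d s = herm (d s) (c s) *s c s" "cmod (herm (d s) (c s)) = 1" if "s \<in> U \<inter> V" for s
    using hopf_eqD[of "c s" "d s"] lift_ofD(4,5)[OF c, of s] lift_ofD(5)[OF d, of s] that by auto
  have "herm (herm (d s) (c s) *s v s) (d s) = 0 \<and> X s = dhopf (d s) (herm (d s) (c s) *s v s)"
    if "s \<in> U \<inter> V" for s
  proof -
    have "herm (herm (d s) (c s) *s v s) (herm (d s) (c s) *s c s) = 0"
      using field_liftD(3)[OF v, of s] that herm_rotate[OF z(2)[OF that], of "v s" "c s"] by simp
    moreover have "dhopf (herm (d s) (c s) *s c s) (herm (d s) (c s) *s v s) = X s"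
      using field_liftD(4)[OF v, of s] that dhopf_rotate[OF z(2)[OF that]] by simp
    ultimately show ?thesis using z(1)[OF that] by simp
  qed
  moreover have "smooth_on (U \<inter> V) (\<lambda>s. herm (d s) (c s) *s v s)"
    using smooth_on_subset[OF lift_ofD(2)[OF c]] smooth_on_subset[OF lift_ofD(2)[OF d]]
      smooth_on_subset[OF field_liftD(2)[OF v]]
    by (intro smooth_on_smult smooth_on_herm) auto
  ultimately show ?thesis
    using lift_of_subset[OF d op] by (auto simp: field_lift_def)
qed

lemma field_along_common_lift:
  assumes "field_along I \<gamma> X" "field_along I \<gamma> Y" "open I" "t \<in> I"
  obtains U c v w where "t \<in> U" "U \<subseteq> I" "field_lift U c v \<gamma> X" "field_lift U c w \<gamma> Y"
proof -
  obtain U c v where U: "t \<in> U" "U \<subseteq> I" "field_lift U c v \<gamma> X"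
    using field_along_lift[OF assms(1,3,4)] by metis
  obtain V d w where V: "t \<in> V" "V \<subseteq> I" "field_lift V d w \<gamma> Y"
    using field_along_lift[OF assms(2-4)] by metis
  note Y = field_lift_change[OF V(3) field_liftD(1)[OF U(3)]]
  have "open (V \<inter> U)" using lift_ofD(1) field_liftD(1) U(3) V(3) by blast
  then show ?thesis
    using that[OF _ _ field_lift_subset[OF U(3)] Y] U(1,2) V(1) by auto
qed

text \<open>Along a lift \<open>c\<close> that need not be horizontal, the covariant derivative of the horizontal lift
  \<open>v\<close> is its Euclidean derivative, corrected for the rotation of \<open>c\<close> in the fibre and projected to the
  horizontal space. The correction makes the result independent of the lift.\<close>

definition cov_lift :: "(real \<Rightarrow> complex^'n) \<Rightarrow> (real \<Rightarrow> complex^'n) \<Rightarrow> real \<Rightarrow> complex^('n::finite)" where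
  "cov_lift c v t = horizontal_part (c t)
     (vector_derivative v (at t) - herm (vector_derivative c (at t)) (c t) *s v t)"

definition fs_conn ::
  "(real \<Rightarrow> ('n::finite) cpoint) \<Rightarrow> (real \<Rightarrow> 'n cvector) \<Rightarrow> real \<Rightarrow> 'n cvector" where
  "fs_conn \<gamma> X t =
     (THE Z. \<exists>U c v. t \<in> U \<and> field_lift U c v \<gamma> X \<and> Z = dhopf (c t) (cov_lift c v t))"

text \<open>If \<open>d = z c\<close> then \<open>w = z v\<close>, and the terms with \<open>z'\<close> in \<open>w'\<close> and in \<open>\<langle>d', d\<rangle> w\<close> are equal.\<close>

lemma dhopf_cov_lift_unique:
  assumes v: "field_lift U c v \<gamma> X" and w: "field_lift V d w \<gamma> X" and t: "t \<in> U" "t \<in> V"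
  shows "dhopf (d t) (cov_lift d w t) = dhopf (c t) (cov_lift c v t)"
proof -
  note c = field_liftD(1)[OF v] and d = field_liftD(1)[OF w]
  have op: "open (U \<inter> V)" using lift_ofD(1)[OF c] lift_ofD(1)[OF d] by auto
  have same: "\<forall>s\<in>U \<inter> V. hopf (c s) = hopf (d s)"
    using lift_ofD(5)[OF c] lift_ofD(5)[OF d] by simp
  define z where "z = (\<lambda>s. herm (d s) (c s))"
  define z' where "z' = vector_derivative z (at t)"
  note phase = lift_phase[OF z_def lift_ofD(3)[OF c] lift_ofD(3)[OF d] same t, folded z'_def]
  note dz = phase(1) and z = phase(2) and dd = phase(3)
  have w_eq: "w s = z s *s v s" if "s \<in> U \<inter> V" for s
    using field_liftD(3,4)[OF w, of s] field_liftD(3,4)[OF field_lift_change[OF v d], of s]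
      lift_ofD(4)[OF d, of s] that horizontal_unique[of "d s" "w s" "z s *s v s"]
    by (simp add: z_def)
  have "(w has_vector_derivative z t *s vector_derivative v (at t) + z' *s v t) (at t)"
    by (rule has_vector_derivative_transform_within_open[OF
          smult_has_vector_derivative[OF dz field_liftD(5)[OF v t(1)]] op]) (use t w_eq in simp_all)
  then have dw: "vector_derivative w (at t) = z t *s vector_derivative v (at t) + z' *s v t"
    by (rule vector_derivative_at)
  have zt: "cmod (z t) = 1" "d t = z t *s c t" "w t = z t *s v t" using z w_eq t by auto
  have "herm (vector_derivative d (at t)) (d t)
      = herm (vector_derivative c (at t)) (c t) + z' * cnj (z t)"
    using herm_self[OF lift_ofD(4)[OF c t(1)]]
    by (simp add: dd zt(2) herm_add_left herm_rotate[OF zt(1)]) (simp add: herm_simps)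
  then have rot: "vector_derivative w (at t) - herm (vector_derivative d (at t)) (d t) *s w t
      = z t *s (vector_derivative v (at t) - herm (vector_derivative c (at t)) (c t) *s v t)"
    using unit_cnj_mult[OF zt(1)]
    by (simp add: dw zt(3) vec_eq_iff algebra_simps) 
  have "cov_lift d w t = z t *s cov_lift c v t"
    unfolding cov_lift_def rot unfolding zt(2) by (rule horizontal_part_rotate[OF zt(1)])
  then show ?thesis using dhopf_rotate[OF zt(1)] zt(2) by simp
qed

lemma fs_conn_eq:
  assumes "field_lift U c v \<gamma> X" "t \<in> U"
  shows "fs_conn \<gamma> X t = dhopf (c t) (cov_lift c v t)"
  unfolding fs_conn_def
  by (rule the_equality) (use assms dhopf_cov_lift_unique in blast)+

lemma smooth_on_cov_lift:
  assumes "open U" "smooth_on U c" "smooth_on U v"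
  shows "smooth_on U (cov_lift c v)"
  using smooth_on_horizontal_part[OF assms(2) smooth_on_diff[OF smooth_on_vector_derivative[OF assms(1,3)]
      smooth_on_smult[OF smooth_on_herm[OF smooth_on_vector_derivative[OF assms(1,2)] assms(2)] assms(3)]]]
  unfolding cov_lift_def .

lemma field_lift_fs_conn:
  assumes "field_lift U c v \<gamma> X"
  shows "field_lift U c (cov_lift c v) \<gamma> (fs_conn \<gamma> X)"
proof -
  note L = field_liftD[OF assms]
  note c = lift_ofD[OF L(1)]
  have "herm (cov_lift c v s) (c s) = 0" if "s \<in> U" for s
    using herm_horizontal_part[OF c(4)[OF that]] by (simp add: cov_lift_def)
  then show ?thesis
    using L(1) smooth_on_cov_lift[OF c(1,2) L(2)] fs_conn_eq[OF assms] by (auto simp: field_lift_def)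
qed

lemma cov_lift_horizontal_part:
  assumes c: "(c has_vector_derivative c') (at t)" "norm (c t) = 1"
    and u: "(u has_vector_derivative u') (at t)"
  shows "cov_lift c (\<lambda>s. horizontal_part (c s) (u s)) t =
    horizontal_part (c t) (u' - herm (u t) (c t) *s c' - herm c' (c t) *s u t)"
proof -
  have "((\<lambda>s. horizontal_part (c s) (u s)) has_vector_derivative
      u' - (herm (u t) (c t) *s c' + (herm (u t) c' + herm u' (c t)) *s c t)) (at t)"
    unfolding horizontal_part_eq
    by (intro has_vector_derivative_diff u smult_has_vector_derivative herm_has_vector_derivative c)
  note d = vector_derivative_at[OF this]
  let ?k = "herm (u t) c' + herm u' (c t) - herm c' (c t) * herm (u t) (c t)"
  have "cov_lift c (\<lambda>s. horizontal_part (c s) (u s)) t = horizontal_part (c t)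
      (u' - herm (u t) (c t) *s c' - herm c' (c t) *s u t - ?k *s c t)"
    unfolding cov_lift_def d vector_derivative_at[OF c(1)]
    by (rule arg_cong[where f = "horizontal_part (c t)"])
       (simp add: horizontal_part_eq vec_eq_iff algebra_simps)
  then show ?thesis
    by (simp only: horizontal_part_diff[of _ _ "?k *s c t"] horizontal_part_fibre[OF c(2)] diff_zero)
qed

lemma herm_velocity_imaginary:
  assumes "lift_of U c \<gamma>" "t \<in> U"
  shows "Re (herm (vector_derivative c (at t)) (c t)) = 0"
proof -
  have "vector_derivative c (at t) \<in> tangent_space (sphere 0 1) (c t)"
    using lift_ofD(3)[OF assms(1)] assms(2) by (auto simp: tangent_space_def)
  then show ?thesis using herm_tangent_sphere_Re lift_ofD(4)[OF assms] by blast
qed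

lemma inner_cov_lift:
  assumes "norm (c t) = 1" "herm w (c t) = 0"
  shows "cov_lift c v t \<bullet> w
    = vector_derivative v (at t) \<bullet> w - Re (herm (vector_derivative c (at t)) (c t) * herm (v t) w)"
  using assms(2) cnj_herm[of w "c t"]
  by (simp add: cov_lift_def inner_eq_Re_herm horizontal_part_eq herm_simps)

text \<open>The correction term is skew, since \<open>\<langle>c', c\<rangle>\<close> is imaginary; what remains is the product rule.\<close>

lemma fs_conn_metric:
  assumes v: "field_lift U c v \<gamma> X" and w: "field_lift U c w \<gamma> Y" and t: "t \<in> U"
  shows "((\<lambda>s. cp_inner (X s) (Y s)) has_real_derivative
    cp_inner (fs_conn \<gamma> X t) (Y t) + cp_inner (X t) (fs_conn \<gamma> Y t)) (at t)"
proof -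
  note c = lift_ofD[OF field_liftD(1)[OF v]]
  let ?v' = "vector_derivative v (at t)" and ?w' = "vector_derivative w (at t)"
  have inner: "cp_inner (dhopf (c s) a) (dhopf (c s) b) = a \<bullet> b"
    if "s \<in> U" "herm a (c s) = 0" "herm b (c s) = 0" for s a b
    using cp_inner_dhopf[OF c(4)] that by (simp add: horizontal_part_ident)
  have "((\<lambda>s. v s \<bullet> w s) has_vector_derivative v t \<bullet> ?w' + ?v' \<bullet> w t) (at t)"
    by (rule bounded_bilinear.has_vector_derivative[OF bounded_bilinear_inner
          field_liftD(5)[OF v t] field_liftD(5)[OF w t]])
  then have "((\<lambda>s. cp_inner (X s) (Y s)) has_vector_derivative v t \<bullet> ?w' + ?v' \<bullet> w t) (at t)"
    by (rule has_vector_derivative_transform_within_open[OF _ c(1) t])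
       (use inner field_liftD(3,4)[OF v] field_liftD(3,4)[OF w] in simp)
  moreover have "cov_lift c v t \<bullet> w t + v t \<bullet> cov_lift c w t = v t \<bullet> ?w' + ?v' \<bullet> w t"
    using inner_cov_lift[where v=v and c=c and t=t, OF c(4)[OF t] field_liftD(3)[OF w t]]
      inner_cov_lift[where v=w and c=c and t=t, OF c(4)[OF t] field_liftD(3)[OF v t]]
      herm_velocity_imaginary[OF field_liftD(1)[OF v] t] cnj_herm[of "v t" "w t", symmetric]
    by (simp add: inner_commute)
  moreover have "cp_inner (fs_conn \<gamma> X t) (Y t) = cov_lift c v t \<bullet> w t"
    "cp_inner (X t) (fs_conn \<gamma> Y t) = v t \<bullet> cov_lift c w t"
    using inner[OF t] field_liftD(3,4)[OF v t] field_liftD(3,4)[OF w t]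
      field_liftD(3,4)[OF field_lift_fs_conn[OF v] t] field_liftD(3,4)[OF field_lift_fs_conn[OF w] t]
    by simp_all
  ultimately show ?thesis by (simp add: has_real_derivative_iff_has_vector_derivative)
qed

lemma fs_conn_add:
  assumes v: "field_lift U c v \<gamma> X" and w: "field_lift U c w \<gamma> Y" and t: "t \<in> U"
  shows "fs_conn \<gamma> (\<lambda>s. cp_add (X s) (Y s)) t = cp_add (fs_conn \<gamma> X t) (fs_conn \<gamma> Y t)"
proof -
  note c = lift_ofD[OF field_liftD(1)[OF v]]
  have "field_lift U c (\<lambda>s. v s + w s) \<gamma> (\<lambda>s. cp_add (X s) (Y s))"
    using field_liftD[OF v] field_liftD[OF w] c(4)
    by (auto simp: field_lift_def herm_simps cp_add_dhopf intro: smooth_on_add)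
  moreover have "cov_lift c (\<lambda>s. v s + w s) t = cov_lift c v t + cov_lift c w t"
    unfolding cov_lift_def
      vector_derivative_at[OF has_vector_derivative_add[OF field_liftD(5)[OF v t] field_liftD(5)[OF w t]]]
    by (simp add: horizontal_part_add[symmetric] vector_add_ldistrib algebra_simps)
  ultimately show ?thesis
    using fs_conn_eq[OF v t] fs_conn_eq[OF w t] fs_conn_eq[OF _ t] c(4)[OF t]
    by (metis cp_add_dhopf)
qed

lemma fs_conn_scale:
  assumes v: "field_lift U c v \<gamma> X" and f: "smooth_on U f" and t: "t \<in> U"
  shows "fs_conn \<gamma> (\<lambda>s. cp_scale (f s) (X s)) t
    = cp_add (cp_scale (deriv f t) (X t)) (cp_scale (f t) (fs_conn \<gamma> X t))"
proof -
  note c = lift_ofD[OF field_liftD(1)[OF v]]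
  have "field_lift U c (\<lambda>s. f s *\<^sub>R v s) \<gamma> (\<lambda>s. cp_scale (f s) (X s))"
    using field_liftD[OF v] f
    by (auto simp: field_lift_def herm_simps cp_scale_dhopf intro: smooth_on_scaleR)
  moreover have "cov_lift c (\<lambda>s. f s *\<^sub>R v s) t = deriv f t *\<^sub>R v t + f t *\<^sub>R cov_lift c v t"
  proof -
    have "(f has_real_derivative deriv f t) (at t)"
      using smooth_on_has_vector_derivative[OF c(1) f t] DERIV_imp_deriv
      by (metis has_real_derivative_iff_has_vector_derivative)
    then have "((\<lambda>s. f s *\<^sub>R v s) has_vector_derivative
        f t *\<^sub>R vector_derivative v (at t) + deriv f t *\<^sub>R v t) (at t)"
      by (rule has_vector_derivative_scaleR[OF _ field_liftD(5)[OF v t]])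
    note d = vector_derivative_at[OF this]
    show ?thesis
      unfolding cov_lift_def d using field_liftD(3)[OF v t]
      by (simp add: horizontal_part_eq herm_simps vec_eq_iff algebra_simps
          scaleR_conv_of_real[where 'a=complex])
  qed
  ultimately show ?thesis
    using fs_conn_eq[OF v t] fs_conn_eq[OF _ t] c(4)[OF t] field_liftD(4)[OF v t]
    by (metis cp_add_dhopf cp_scale_dhopf)
qed

lemma smooth_on_line:
  fixes G :: "'a::euclidean_space \<Rightarrow> 'b::real_normed_vector"
  assumes "open U" "smooth_on U G"
  shows "open {r. p + r *\<^sub>R e \<in> U}" "smooth_on {r. p + r *\<^sub>R e \<in> U} (\<lambda>r. G (p + r *\<^sub>R e))"
    "p + r *\<^sub>R e \<in> U \<Longrightarrow>
      ((\<lambda>r. G (p + r *\<^sub>R e)) has_vector_derivative frechet_derivative G (at (p + r *\<^sub>R e)) e) (at r)"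
proof -
  have "open ((\<lambda>r. p + r *\<^sub>R e) -` U)"
    by (intro open_vimage assms(1) continuous_intros)
  then show "open {r. p + r *\<^sub>R e \<in> U}" by (simp add: vimage_def)
  show "smooth_on {r. p + r *\<^sub>R e \<in> U} (\<lambda>r. G (p + r *\<^sub>R e))"
    by (rule smooth_on_compose[OF assms(2)])
       (auto intro!: smooth_on_add smooth_on_scaleR)
  assume "p + r *\<^sub>R e \<in> U"
  note G = smooth_on_has_derivative[OF assms this]
  have "((\<lambda>r. p + r *\<^sub>R e) has_derivative (\<lambda>d. d *\<^sub>R e)) (at r)"
    by (auto intro!: derivative_eq_intros)
  from diff_chain_at[OF this G] linear_scale[OF has_derivative_linear[OF G]]
  show "((\<lambda>r. G (p + r *\<^sub>R e)) has_vector_derivative frechet_derivative G (at (p + r *\<^sub>R e)) e) (at r)"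
    by (simp add: o_def has_vector_derivative_def)
qed

lemmas smooth_on_slice1 = smooth_on_line[where p = "(0::real, t::real)" and e = "(1, 0)" for t, simplified]
lemmas smooth_on_slice2 = smooth_on_line[where p = "(s::real, 0::real)" and e = "(0, 1)" for s, simplified]

text \<open>The torsion identity for a parametrized surface compares the covariant derivatives of these two fields,
  so their lifts are read off from one lift of the surface.\<close>

lemma coordinate_fields:
  fixes F :: "real \<times> real \<Rightarrow> complex^'n::finite"
  assumes U: "open U" "smooth_on U F" "F ` U \<subseteq> sphere 0 1" "\<And>y. y \<in> U \<Longrightarrow> hopf (F y) = f y"
  shows "field_lift {a. (a, t) \<in> U} (\<lambda>a. F (a, t))
      (\<lambda>a. horizontal_part (F (a, t)) (frechet_derivative F (at (a, t)) (0, 1)))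
      (\<lambda>a. f (a, t)) (\<lambda>a. cp_velocity (\<lambda>b. f (a, b)) t)"
    and "field_lift {b. (s, b) \<in> U} (\<lambda>b. F (s, b))
      (\<lambda>b. horizontal_part (F (s, b)) (frechet_derivative F (at (s, b)) (1, 0)))
      (\<lambda>b. f (s, b)) (\<lambda>b. cp_velocity (\<lambda>a. f (a, b)) s)"
proof -
  have 1: "lift_of {a. (a, t) \<in> U} (\<lambda>a. F (a, t)) (\<lambda>a. f (a, t))" for t
    using U smooth_on_slice1(1,2)[OF U(1,2)] by (auto simp: lift_of_def curve_on_def)
  have 2: "lift_of {b. (s, b) \<in> U} (\<lambda>b. F (s, b)) (\<lambda>b. f (s, b))" for s
    using U smooth_on_slice2(1,2)[OF U(1,2)] by (auto simp: lift_of_def curve_on_def)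
  have d1: "vector_derivative (\<lambda>a. F (a, b)) (at a) = frechet_derivative F (at (a, b)) (1, 0)"
    and d2: "vector_derivative (\<lambda>b. F (a, b)) (at b) = frechet_derivative F (at (a, b)) (0, 1)"
    if "(a, b) \<in> U" for a b
    using vector_derivative_at[OF smooth_on_slice1(3)[OF U(1,2) that]]
      vector_derivative_at[OF smooth_on_slice2(3)[OF U(1,2) that]] by auto
  have sm: "smooth_on U (\<lambda>y. frechet_derivative F (at y) e)" for e
    by (rule smooth_on_frechet[OF U(1,2)]) simp
  show "field_lift {a. (a, t) \<in> U} (\<lambda>a. F (a, t))
      (\<lambda>a. horizontal_part (F (a, t)) (frechet_derivative F (at (a, t)) (0, 1)))
      (\<lambda>a. f (a, t)) (\<lambda>a. cp_velocity (\<lambda>b. f (a, b)) t)"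
    using lift_ofD(7)[OF 2] d2 smooth_on_slice1(2)[OF U(1) sm]
    by (intro field_lift_horizontal_part 1) auto
  show "field_lift {b. (s, b) \<in> U} (\<lambda>b. F (s, b))
      (\<lambda>b. horizontal_part (F (s, b)) (frechet_derivative F (at (s, b)) (1, 0)))
      (\<lambda>b. f (s, b)) (\<lambda>b. cp_velocity (\<lambda>a. f (a, b)) s)"
    using lift_ofD(7)[OF 1] d1 smooth_on_slice2(2)[OF U(1) sm]
    by (intro field_lift_horizontal_part 2) auto
qed

text \<open>Exchanging the two parameters exchanges the two correction terms, and the second derivatives
  commute.\<close>

lemma fs_conn_torsion_free:
  fixes F :: "real \<times> real \<Rightarrow> complex^'n::finite"
  assumes U: "open U" "smooth_on U F" "F ` U \<subseteq> sphere 0 1" "\<And>y. y \<in> U \<Longrightarrow> hopf (F y) = f y"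
    and st: "(s, t) \<in> U"
  shows "fs_conn (\<lambda>a. f (a, t)) (\<lambda>a. cp_velocity (\<lambda>b. f (a, b)) t) s
       = fs_conn (\<lambda>b. f (s, b)) (\<lambda>b. cp_velocity (\<lambda>a. f (a, b)) s) t"
proof -
  let ?F1 = "\<lambda>y. frechet_derivative F (at y) (1, 0)" and ?F2 = "\<lambda>y. frechet_derivative F (at y) (0, 1)"
  let ?p = "F (s, t)"
  have n: "norm ?p = 1" using U(3) st by auto
  have sm: "smooth_on U (\<lambda>y. frechet_derivative F (at y) e)" for e
    by (rule smooth_on_frechet[OF U(1,2)]) simp
  note d1 = smooth_on_slice1(3)[OF U(1) _ st] and d2 = smooth_on_slice2(3)[OF U(1) _ st]
  have "fs_conn (\<lambda>a. f (a, t)) (\<lambda>a. cp_velocity (\<lambda>b. f (a, b)) t) s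
      = dhopf ?p (horizontal_part ?p (frechet_derivative ?F2 (at (s, t)) (1, 0)
          - herm (?F2 (s, t)) ?p *s ?F1 (s, t) - herm (?F1 (s, t)) ?p *s ?F2 (s, t)))"
    using fs_conn_eq[OF coordinate_fields(1)[OF U, of t], of s] st
      cov_lift_horizontal_part[OF d1[OF U(2)] n d1[OF sm]] by simp
  moreover have "fs_conn (\<lambda>b. f (s, b)) (\<lambda>b. cp_velocity (\<lambda>a. f (a, b)) s) t
      = dhopf ?p (horizontal_part ?p (frechet_derivative ?F1 (at (s, t)) (0, 1)
          - herm (?F1 (s, t)) ?p *s ?F2 (s, t) - herm (?F2 (s, t)) ?p *s ?F1 (s, t)))"
    using fs_conn_eq[OF coordinate_fields(2)[OF U, of s], of t] st
      cov_lift_horizontal_part[OF d2[OF U(2)] n d2[OF sm]] by simp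
  moreover have "frechet_derivative ?F2 (at (s, t)) (1, 0) = frechet_derivative ?F1 (at (s, t)) (0, 1)"
    using frechet_derivative_commute[OF U(1,2) st] .
  ultimately show ?thesis by (simp add: algebra_simps)
qed

theorem levi_civita_fs_conn: "levi_civita (fs_conn :: (real \<Rightarrow> ('n::finite) cpoint) \<Rightarrow> _)"
  unfolding levi_civita_def
proof (intro conjI allI impI, goal_cases)
  case (1 I \<gamma> X)
  show ?case
  proof (rule field_alongI)
    fix t assume "t \<in> I"
    then obtain U c v where U: "t \<in> U" "U \<subseteq> I" "field_lift U c v \<gamma> X"
      using 1 field_along_lift by blast
    show "\<exists>U c v. t \<in> U \<and> field_lift U c v \<gamma> (fs_conn \<gamma> X)"
      using U(1) field_lift_fs_conn[OF U(3)] by blast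
  qed
next
  case (2 I \<gamma> X Y)
  show ?case
  proof
    fix t assume t: "t \<in> I"
    obtain U c v w where U: "t \<in> U" "U \<subseteq> I" "field_lift U c v \<gamma> X" "field_lift U c w \<gamma> Y"
      by (rule field_along_common_lift[of I \<gamma> X Y t]) (use 2 t in auto)
    show "fs_conn \<gamma> (\<lambda>s. cp_add (X s) (Y s)) t = cp_add (fs_conn \<gamma> X t) (fs_conn \<gamma> Y t)"
      by (rule fs_conn_add[OF U(3,4,1)])
  qed
next
  case (3 I \<gamma> X f)
  show ?case
  proof
    fix t assume t: "t \<in> I"
    obtain U c v where U: "t \<in> U" "U \<subseteq> I" "field_lift U c v \<gamma> X"
      by (rule field_along_lift[of I \<gamma> X t]) (use 3 t in auto)
    show "fs_conn \<gamma> (\<lambda>s. cp_scale (f s) (X s)) t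
        = cp_add (cp_scale (deriv f t) (X t)) (cp_scale (f t) (fs_conn \<gamma> X t))"
      using fs_conn_scale[OF U(3) smooth_on_subset[OF _ U(2)] U(1)] 3 by blast
  qed
next
  case (4 I \<gamma> X Y)
  show ?case
  proof
    fix t assume t: "t \<in> I"
    obtain U c v w where U: "t \<in> U" "U \<subseteq> I" "field_lift U c v \<gamma> X" "field_lift U c w \<gamma> Y"
      by (rule field_along_common_lift[of I \<gamma> X Y t]) (use 4 t in auto)
    show "((\<lambda>s. cp_inner (X s) (Y s)) has_real_derivative
        cp_inner (fs_conn \<gamma> X t) (Y t) + cp_inner (X t) (fs_conn \<gamma> Y t)) (at t)"
      by (rule fs_conn_metric[OF U(3,4,1)])
  qed
next
  case (5 W f)
  show ?case
  proof clarify
    fix s t assume st: "(s, t) \<in> W"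
    have W: "open W" "cp_smooth_on W f" using 5 by auto
    from W(2) st obtain V F where V: "open V" "(s, t) \<in> V" "smooth_on V F" "F ` V \<subseteq> sphere 0 1"
      "\<forall>y\<in>W \<inter> V. hopf (F y) = f y"
      unfolding cp_smooth_on_def by fast
    have sub: "smooth_on (W \<inter> V) F" "F ` (W \<inter> V) \<subseteq> sphere 0 1"
      using smooth_on_subset[OF V(3)] V(4) by auto
    show "fs_conn (\<lambda>a. f (a, t)) (\<lambda>a. cp_velocity (\<lambda>b. f (a, b)) t) s
        = fs_conn (\<lambda>b. f (s, b)) (\<lambda>b. cp_velocity (\<lambda>a. f (a, b)) s) t"
      by (rule fs_conn_torsion_free[OF open_Int[OF W(1) V(1)] sub])
         (use V(2,5) st in simp_all)
  qed
qed

lemma cp_inner_commute: "cp_inner X Y = cp_inner Y X"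
proof -
  have "(\<exists>p v w. (p, v) \<in> X \<and> (p, w) \<in> Y \<and> r = v \<bullet> w) \<longleftrightarrow>
      (\<exists>p v w. (p, v) \<in> Y \<and> (p, w) \<in> X \<and> r = v \<bullet> w)" for r
    using inner_commute by metis
  then show ?thesis unfolding cp_inner_def by (simp only:)
qed

lemma levi_civita_field_along:
  assumes "levi_civita D" "open I" "field_along I \<gamma> X"
  shows "field_along I \<gamma> (D \<gamma> X)"
  by (rule assms(1)[unfolded levi_civita_def, THEN conjunct1, rule_format]) (simp add: assms)

lemma levi_civita_metric:
  assumes "levi_civita D" "open I" "field_along I \<gamma> X" "field_along I \<gamma> Y" "t \<in> I"
  shows "((\<lambda>s. cp_inner (X s) (Y s)) has_real_derivative
    cp_inner (D \<gamma> X t) (Y t) + cp_inner (X t) (D \<gamma> Y t)) (at t)"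
  by (rule assms(1)[unfolded levi_civita_def, THEN conjunct2, THEN conjunct2, THEN conjunct2,
        THEN conjunct1, rule_format, OF _ assms(5)]) (simp add: assms)

lemma levi_civita_torsion_free:
  assumes "levi_civita D" "open W" "cp_smooth_on W f" "(s, t) \<in> W"
  shows "D (\<lambda>a. f (a, t)) (\<lambda>a. cp_velocity (\<lambda>b. f (a, b)) t) s =
         D (\<lambda>b. f (s, b)) (\<lambda>b. cp_velocity (\<lambda>a. f (a, b)) s) t"
  using assms(1)[unfolded levi_civita_def, THEN conjunct2, THEN conjunct2, THEN conjunct2,
        THEN conjunct2, THEN spec, THEN spec, THEN mp, OF conjI[OF assms(2,3)], THEN bspec, OF assms(4)]
  by simp

text \<open>A tangent vector at \<open>\<gamma> t\<close> extends to the variation field \<open>Z\<close> of a family of curves.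
  The metric property gives \<open>\<langle>D X, Z\<rangle>\<close> in terms of \<open>\<langle>X, D Z\<rangle>\<close>; where \<open>X\<close> is the velocity of \<open>\<gamma>\<close>, the
  absence of torsion turns \<open>D Z\<close> into the derivative of the velocities across the family, so that
  \<open>\<langle>X, D Z\<rangle>\<close> is half the derivative of their squared lengths. Hence all of it is determined by the
  metric.\<close>

lemma levi_civita_velocity_unique:
  fixes D D' :: "(real \<Rightarrow> ('n::finite) cpoint) \<Rightarrow> (real \<Rightarrow> 'n cvector) \<Rightarrow> real \<Rightarrow> 'n cvector"
  assumes D: "levi_civita D" "levi_civita D'" and X: "field_lift U c v \<gamma> X" and t: "t \<in> U"
    and vel: "X t = cp_velocity \<gamma> t"
  shows "D \<gamma> X t = D' \<gamma> X t"
proof -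
  note c = lift_ofD[OF field_liftD(1)[OF X]]
  have inner_eq: "cp_inner (D \<gamma> X t) (dhopf (c t) z) = cp_inner (D' \<gamma> X t) (dhopf (c t) z)" for z
  proof -
    define F where "F y = stereo (c (fst y)) (horizontal_part (c (fst y)) z) (snd y)" for y
    \<comment> \<open>\<open>D\<close> takes total functions, so the middle curve of the family has to agree with \<open>\<gamma>\<close> outside \<open>U\<close> too\<close>
    define f where "f y = (if fst y \<in> U then hopf (F y) else \<gamma> (fst y))" for y :: "real \<times> real"
    let ?W = "U \<times> UNIV :: (real \<times> real) set"
    have W: "open ?W" using c(1) by (simp add: open_Times)
    have "smooth_on ?W (\<lambda>y. c (fst y))"
      by (rule smooth_on_compose[OF c(2) smooth_on_linear[OF bounded_linear_fst]]) auto
    moreover have "smooth_on ?W (\<lambda>y. snd y)" by (rule smooth_on_linear[OF bounded_linear_snd])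
    ultimately have F: "smooth_on ?W F"
      unfolding F_def by (intro smooth_on_stereo smooth_on_horizontal_part smooth_on_const)
    have Fs: "F ` ?W \<subseteq> sphere 0 1"
      using norm_stereo c(4) herm_horizontal_part[OF c(4)]
      by (force simp: F_def inner_eq_Re_herm)
    have Ff: "\<And>y. y \<in> ?W \<Longrightarrow> hopf (F y) = f y" by (auto simp: f_def)
    have f0: "(\<lambda>a. f (a, 0)) = \<gamma>" using c(5) by (auto simp: f_def F_def fun_eq_iff)
    define Z where "Z a = cp_velocity (\<lambda>b. f (a, b)) 0" for a
    define B where "B b = cp_velocity (\<lambda>a. f (a, b)) t" for b
    define \<beta> where "\<beta> b = f (t, b)" for b
    note cf = coordinate_fields[OF W F Fs Ff]
    have ZU: "field_along U \<gamma> Z"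
      using field_lift_imp_field_along[OF cf(1)[of 0]] by (simp add: f0 Z_def[abs_def])
    have B\<beta>: "field_along UNIV \<beta> B"
      using field_lift_imp_field_along[OF cf(2)[of t]] t by (simp add: B_def[abs_def] \<beta>_def[abs_def])
    have XU: "field_along U \<gamma> X" by (rule field_lift_imp_field_along[OF X])
    have B0: "B 0 = X t" by (simp add: B_def f0 vel)
    have Zt: "Z t = dhopf (c t) z"
    proof -
      have "frechet_derivative F (at (t, 0)) (0, 1) = horizontal_part (c t) z"
      proof (rule vector_derivative_unique_at)
        have "(\<lambda>b. F (t, b)) = stereo (c t) (horizontal_part (c t) z)" by (simp add: F_def fun_eq_iff)
        then show "(stereo (c t) (horizontal_part (c t) z) has_vector_derivative
            frechet_derivative F (at (t, 0)) (0, 1)) (at 0)"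
          using smooth_on_slice2(3)[OF W F, of t 0] t by simp
      qed (rule stereo_has_vector_derivative)
      moreover have "F (t, 0) = c t" by (simp add: F_def)
      ultimately show ?thesis
        using field_liftD(4)[OF cf(1)[of 0], of t] t c(4)[OF t]
        by (simp add: Z_def dhopf_horizontal_part)
    qed
    have cps: "cp_smooth_on ?W f"
      unfolding cp_smooth_on_def using W F Fs Ff by blast
    have key: "((\<lambda>s. cp_inner (X s) (Z s)) has_real_derivative
          cp_inner (D \<gamma> X t) (Z t) + cp_inner (X t) (D \<beta> B 0)) (at t)"
      "((\<lambda>b. cp_inner (B b) (B b)) has_real_derivative 2 * cp_inner (X t) (D \<beta> B 0)) (at 0)"
      if D: "levi_civita D" for D :: "(real \<Rightarrow> 'n cpoint) \<Rightarrow> (real \<Rightarrow> 'n cvector) \<Rightarrow> real \<Rightarrow> 'n cvector"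
    proof -
      have "D \<gamma> Z t = D \<beta> B 0"
        using levi_civita_torsion_free[OF D W cps, of t 0] t by (simp add: f0 Z_def[abs_def] B_def[abs_def] \<beta>_def[abs_def])
      then show "((\<lambda>s. cp_inner (X s) (Z s)) has_real_derivative
          cp_inner (D \<gamma> X t) (Z t) + cp_inner (X t) (D \<beta> B 0)) (at t)"
        using levi_civita_metric[OF D c(1) XU ZU t] by simp
      show "((\<lambda>b. cp_inner (B b) (B b)) has_real_derivative 2 * cp_inner (X t) (D \<beta> B 0)) (at 0)"
        using levi_civita_metric[OF D open_UNIV B\<beta> B\<beta>, of 0] cp_inner_commute[of "D \<beta> B 0" "X t"]
        by (simp add: B0)
    qed
    show ?thesis
      using DERIV_unique[OF key(1)[OF D(1)] key(1)[OF D(2)]]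
        DERIV_unique[OF key(2)[OF D(1)] key(2)[OF D(2)]] Zt by simp
  qed
  have tangent: "\<exists>w. herm w (c t) = 0 \<and> D \<gamma> X t = dhopf (c t) w"
    if D: "levi_civita D" for D :: "(real \<Rightarrow> 'n cpoint) \<Rightarrow> (real \<Rightarrow> 'n cvector) \<Rightarrow> real \<Rightarrow> 'n cvector"
  proof -
    have "field_along U \<gamma> (D \<gamma> X)"
      by (rule levi_civita_field_along[OF D c(1) field_lift_imp_field_along[OF X]])
    then obtain V d w where V: "t \<in> V" "V \<subseteq> U" "field_lift V d w \<gamma> (D \<gamma> X)"
      by (rule field_along_lift[OF _ c(1) t])
    have "t \<in> V \<inter> U" using V(1) t by simp
    note L = field_liftD(3,4)[OF field_lift_change[OF V(3) field_liftD(1)[OF X]] this]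
    show ?thesis by (rule exI, rule conjI, rule L(1), rule L(2))
  qed
  obtain w w' where w: "herm w (c t) = 0" "D \<gamma> X t = dhopf (c t) w"
    "herm w' (c t) = 0" "D' \<gamma> X t = dhopf (c t) w'"
    using tangent[OF D(1)] tangent[OF D(2)] by blast
  have "w \<bullet> (w - w') = w' \<bullet> (w - w')"
    using inner_eq[of "w - w'"] w cp_inner_dhopf[OF c(4)[OF t]]
    by (simp add: horizontal_part_ident herm_simps)
  then have "(w - w') \<bullet> (w - w') = 0" by (simp add: inner_diff_left)
  then show ?thesis using w by simp
qed

lemma levi_civita_cp_conn: "levi_civita cp_conn"
  unfolding cp_conn_def using levi_civita_fs_conn by (rule someI[of levi_civita])

lemma cp_conn_eq_fs_conn:
  "field_lift U c v \<gamma> X \<Longrightarrow> t \<in> U \<Longrightarrow> X t = cp_velocity \<gamma> t \<Longrightarrow> cp_conn \<gamma> X t = fs_conn \<gamma> X t"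
  by (rule levi_civita_velocity_unique[OF levi_civita_cp_conn levi_civita_fs_conn])

section \<open>Normal curvature of circle-invariant surfaces in the sphere\<close>

lemma has_vector_derivative_along_curve:
  fixes f g :: "'a::euclidean_space \<Rightarrow> 'b::real_normed_vector"
  assumes c: "curve_on S I c" "t \<in> I" and g: "(g has_derivative g') (at (c t))"
    and U: "open U" "c t \<in> U" "\<And>y. y \<in> S \<inter> U \<Longrightarrow> g y = f y"
  shows "((f \<circ> c) has_vector_derivative g' (vector_derivative c (at t))) (at t)"
proof -
  note c' = curve_onD[OF c(1)]
  have "((g \<circ> c) has_vector_derivative g' (vector_derivative c (at t))) (at t)"
    using diff_chain_at[OF c'(4)[OF c(2), unfolded has_vector_derivative_def] g]
      linear_scale[OF has_derivative_linear[OF g]]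
    by (simp add: has_vector_derivative_def o_def)
  note d = this
  have op: "open (I \<inter> c -` U)"
    using continuous_open_preimage[OF smooth_on_continuous[OF c'(2)] c'(1) U(1)] .
  show ?thesis
    by (rule has_vector_derivative_transform_within_open[OF d op])
       (use U c(2) c'(3) in auto)
qed

lemma tangent_deriv_eq:
  fixes f g :: "'a::euclidean_space \<Rightarrow> 'b::real_normed_vector"
  assumes v: "v \<in> tangent_space S p" and g: "(g has_derivative g') (at p)"
    and U: "open U" "p \<in> U" "\<And>y. y \<in> S \<inter> U \<Longrightarrow> g y = f y"
  shows "tangent_deriv S f p v = g' v"
  unfolding tangent_deriv_def
proof (rule the_equality)
  show "\<forall>I c t. curve_on S I c \<and> t \<in> I \<and> c t = p \<and> vector_derivative c (at t) = v \<longrightarrow>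
      ((f \<circ> c) has_vector_derivative g' v) (at t)"
    using has_vector_derivative_along_curve[of S _ _ _ g g' U f] g U by blast
next
  fix w assume w: "\<forall>I c t. curve_on S I c \<and> t \<in> I \<and> c t = p \<and> vector_derivative c (at t) = v \<longrightarrow>
      ((f \<circ> c) has_vector_derivative w) (at t)"
  obtain I c t where c: "curve_on S I c" "t \<in> I" "c t = p" "vector_derivative c (at t) = v"
    using v by (auto simp: tangent_space_def)
  have "((f \<circ> c) has_vector_derivative w) (at t)" using w c by blast
  moreover have "((f \<circ> c) has_vector_derivative g' v) (at t)"
    using has_vector_derivative_along_curve[OF c(1,2), of g g' U f] g U c by simp
  ultimately show "w = g' v" by (rule vector_derivative_unique_at)
qed

lemma derivative_eq_on_tangent_space:
  fixes g h :: "'a::euclidean_space \<Rightarrow> 'b::real_normed_vector"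
  assumes "v \<in> tangent_space S p" "(g has_derivative g') (at p)" "(h has_derivative h') (at p)"
    and "open U" "p \<in> U" "\<And>y. y \<in> S \<inter> U \<Longrightarrow> g y = h y"
  shows "g' v = h' v"
  using tangent_deriv_eq[OF assms(1,2,4-6)] tangent_deriv_eq[OF assms(1,3,4,5), of h] by simp

lemma orth_proj_eqI:
  assumes "w \<in> W" "\<And>u. u \<in> W \<Longrightarrow> (v - w) \<bullet> u = 0" "\<And>a b. a \<in> W \<Longrightarrow> b \<in> W \<Longrightarrow> a - b \<in> W"
  shows "orth_proj W v = w"
  unfolding orth_proj_def
proof (rule the_equality)
  fix w' assume w': "w' \<in> W \<and> (\<forall>u\<in>W. (v - w') \<bullet> u = 0)"
  then have "(v - w) \<bullet> (w' - w) = 0" "(v - w') \<bullet> (w' - w) = 0" using assms by auto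
  then have "(w' - w) \<bullet> (w' - w) = 0" by (simp add: inner_diff_left)
  then show "w' = w" by simp
qed (use assms in auto)

text \<open>A surface in the sphere that is a union of fibres, with an equivariant horizontal unit field \<open>E\<close>
  completing the fibre direction \<open>\<i>p\<close> to an orthonormal frame.\<close>

locale circle_surface =
  fixes S :: "(complex^'n::finite) set" and E :: "complex^'n \<Rightarrow> complex^'n"
  assumes norm_S: "p \<in> S \<Longrightarrow> norm p = 1"
    and rotate_S: "p \<in> S \<Longrightarrow> cmod z = 1 \<Longrightarrow> z *s p \<in> S"
    and smooth_E: "smooth_on S E"
    and unit_E: "p \<in> S \<Longrightarrow> E p \<bullet> E p = 1"
    and horizontal_E: "p \<in> S \<Longrightarrow> herm (E p) p = 0"
    and rotate_E: "p \<in> S \<Longrightarrow> cmod z = 1 \<Longrightarrow> E (z *s p) = z *s E p"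
    and tangent_S: "p \<in> S \<Longrightarrow> tangent_space S p = {a *\<^sub>R E p + b *\<^sub>R (\<i> *s p) | a b. True}"
begin

text \<open>The orthogonal projection to the normal space of \<open>S\<close> in the sphere.\<close>

definition nproj :: "complex^'n \<Rightarrow> complex^'n \<Rightarrow> complex^'n" where
  "nproj p w = horizontal_part p w - (w \<bullet> E p) *\<^sub>R E p"

text \<open>The normal part of this vector is the entry \<open>h(E, E)\<close> of the second fundamental form, the only one that
  the fibration does not determine.\<close>

definition curvature_vector :: "complex^'n \<Rightarrow> complex^'n" where
  "curvature_vector p = tangent_deriv S E p (E p)"

lemma frame_inner:
  assumes "p \<in> S"
  shows "p \<bullet> p = 1" "E p \<bullet> p = 0" "p \<bullet> E p = 0" "E p \<bullet> (\<i> *s p) = 0" "(\<i> *s p) \<bullet> E p = 0"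
    "p \<bullet> (\<i> *s p) = 0" "(\<i> *s p) \<bullet> p = 0" "(\<i> *s p) \<bullet> (\<i> *s p) = 1"
    "(\<i> *s E p) \<bullet> p = 0" "(\<i> *s E p) \<bullet> (\<i> *s p) = 0" "(\<i> *s E p) \<bullet> E p = 0"
    "E p \<bullet> (\<i> *s E p) = 0" "(\<i> *s E p) \<bullet> (\<i> *s E p) = 1"
  using norm_S[OF assms] horizontal_E[OF assms] unit_E[OF assms] herm_self[OF norm_S[OF assms]]
    cnj_herm[of "E p" p] cnj_herm[of "E p" "E p"]
  by (simp_all add: inner_eq_Re_herm herm_simps complex_eq_iff)

lemma nproj_add: "nproj p (v + w) = nproj p v + nproj p w"
  and nproj_diff: "nproj p (v - w) = nproj p v - nproj p w"
  and nproj_scaleR: "nproj p (r *\<^sub>R v) = r *\<^sub>R nproj p v"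
  by (simp_all add: nproj_def horizontal_part_add horizontal_part_diff horizontal_part_scaleR
      inner_add_left inner_diff_left algebra_simps)

lemma nproj_expand: "nproj p w = w - (w \<bullet> p) *\<^sub>R p - (w \<bullet> (\<i> *s p)) *\<^sub>R (\<i> *s p) - (w \<bullet> E p) *\<^sub>R E p"
  by (simp add: nproj_def horizontal_part_def)

lemma nproj_frame:
  assumes "p \<in> S"
  shows "nproj p p = 0" "nproj p (\<i> *s p) = 0" "nproj p (E p) = 0" "nproj p (\<i> *s E p) = \<i> *s E p"
  by (simp_all add: nproj_expand frame_inner[OF assms] unit_E[OF assms])

lemma normal_space_S:
  assumes "p \<in> S"
  shows "normal_space (sphere 0 1) S p = {\<xi>. herm \<xi> p = 0 \<and> \<xi> \<bullet> E p = 0}"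
proof (intro set_eqI iffI)
  fix \<xi> assume \<xi>: "\<xi> \<in> normal_space (sphere 0 1) S p"
  have "E p \<in> tangent_space S p" "\<i> *s p \<in> tangent_space S p"
    unfolding tangent_S[OF assms] by (force intro: exI[of _ 1] exI[of _ 0])+
  then have "\<xi> \<bullet> p = 0" "\<xi> \<bullet> (\<i> *s p) = 0" "\<xi> \<bullet> E p = 0"
    using \<xi> norm_S[OF assms] by (auto simp: normal_space_def tangent_space_sphere)
  then show "\<xi> \<in> {\<xi>. herm \<xi> p = 0 \<and> \<xi> \<bullet> E p = 0}" by (simp add: herm_eq_inner complex_eq_iff)
next
  fix \<xi> assume "\<xi> \<in> {\<xi>. herm \<xi> p = 0 \<and> \<xi> \<bullet> E p = 0}"
  then have "\<xi> \<bullet> p = 0" "\<xi> \<bullet> (\<i> *s p) = 0" "\<xi> \<bullet> E p = 0"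
    by (simp_all add: herm_eq_inner complex_eq_iff)
  then show "\<xi> \<in> normal_space (sphere 0 1) S p"
    using norm_S[OF assms] by (auto simp: normal_space_def tangent_space_sphere tangent_S[OF assms]
        inner_add_right)
qed

lemma normal_vector_inner:
  assumes "\<xi> \<in> normal_space (sphere 0 1) S p" "p \<in> S"
  shows "\<xi> \<bullet> p = 0" "\<xi> \<bullet> (\<i> *s p) = 0" "\<xi> \<bullet> E p = 0"
  using assms by (simp_all add: normal_space_S herm_eq_inner complex_eq_iff)

lemma nproj_normal: "p \<in> S \<Longrightarrow> nproj p w \<in> normal_space (sphere 0 1) S p"
  using norm_S[of p] horizontal_E[of p] unit_E[of p] frame_inner[of p]
  by (simp add: normal_space_S nproj_def herm_simps herm_horizontal_part)
     (simp add: horizontal_part_def inner_diff_left)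

lemma inner_nproj:
  "\<xi> \<in> normal_space (sphere 0 1) S p \<Longrightarrow> p \<in> S \<Longrightarrow> \<xi> \<bullet> nproj p w = \<xi> \<bullet> w"
  using normal_vector_inner by (simp add: nproj_expand inner_diff_right)

lemma normal_conn_eq:
  assumes "p \<in> S"
  shows "normal_conn (sphere 0 1) S X \<xi> p = nproj p (tangent_deriv S \<xi> p (X p))"
proof -
  let ?w = "tangent_deriv S \<xi> p (X p)"
  have "orth_proj (tangent_space (sphere 0 1) p) ?w = ?w - (?w \<bullet> p) *\<^sub>R p"
    unfolding tangent_space_sphere[OF norm_S[OF assms]]
    by (rule orth_proj_eqI) (auto simp: inner_diff_left inner_diff_right frame_inner[OF assms] inner_commute)
  moreover have "orth_proj (normal_space (sphere 0 1) S p) v = nproj p v" for v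
  proof (rule orth_proj_eqI)
    fix u assume "u \<in> normal_space (sphere 0 1) S p"
    then show "(v - nproj p v) \<bullet> u = 0"
      using inner_nproj[OF _ assms, of u v] by (simp add: inner_diff_left inner_diff_right inner_commute)
  next
    fix a b assume "a \<in> normal_space (sphere 0 1) S p" "b \<in> normal_space (sphere 0 1) S p"
    then show "a - b \<in> normal_space (sphere 0 1) S p"
      by (simp add: normal_space_S[OF assms] herm_simps inner_diff_left)
  qed (rule nproj_normal[OF assms])
  ultimately show ?thesis
    by (simp add: normal_conn_def submfd_conn_def nproj_diff nproj_scaleR nproj_frame[OF assms])
qed

lemma E_tangent: "p \<in> S \<Longrightarrow> E p \<in> tangent_space S p"
  and ip_tangent: "p \<in> S \<Longrightarrow> \<i> *s p \<in> tangent_space S p"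
  unfolding tangent_S by (force intro: exI[of _ 1] exI[of _ 0])+

lemma tangent_vector_eq:
  assumes "p \<in> S" "v \<in> tangent_space S p"
  shows "v = (v \<bullet> E p) *\<^sub>R E p + (v \<bullet> (\<i> *s p)) *\<^sub>R (\<i> *s p)"
  using assms frame_inner[OF assms(1)] unit_E[OF assms(1)] unfolding tangent_S[OF assms(1)]
  by (auto simp: inner_add_left)

lemma nproj_tangent:
  assumes p: "p \<in> S" and u: "u \<in> tangent_space S p"
  shows "nproj p u = 0" "nproj p (\<i> *s u) = (u \<bullet> E p) *\<^sub>R (\<i> *s E p)"
proof -
  define a b where "a = u \<bullet> E p" and "b = u \<bullet> (\<i> *s p)"
  have u_eq: "u = a *\<^sub>R E p + b *\<^sub>R (\<i> *s p)" unfolding a_def b_def by (rule tangent_vector_eq[OF p u])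
  have iu: "\<i> *s u = a *\<^sub>R (\<i> *s E p) - b *\<^sub>R p" unfolding u_eq by (simp add: vec_eq_iff algebra_simps)
  show "nproj p u = 0" unfolding u_eq
    by (simp add: nproj_add nproj_scaleR nproj_frame[OF p])
  show "nproj p (\<i> *s u) = (u \<bullet> E p) *\<^sub>R (\<i> *s E p)" unfolding iu
    by (simp add: nproj_diff nproj_scaleR nproj_frame[OF p] a_def)
qed

lemma tangent_vectorI:
  assumes "p \<in> S" "nproj p v = 0" "v \<bullet> p = 0"
  shows "v \<in> tangent_space S p"
proof -
  have "v = (v \<bullet> E p) *\<^sub>R E p + (v \<bullet> (\<i> *s p)) *\<^sub>R (\<i> *s p)"
    using assms(2,3) by (simp add: nproj_expand algebra_simps)
  then show ?thesis unfolding tangent_S[OF assms(1)] by blast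
qed

lemma smooth_on_nproj:
  "smooth_on S v \<Longrightarrow> smooth_on S (\<lambda>p. nproj p (v p))"
  unfolding nproj_def
  by (intro smooth_on_diff smooth_on_scaleR smooth_on_inner smooth_on_horizontal_part smooth_E) auto

text \<open>The differential of \<open>E\<close> at a point of \<open>S\<close>, computed with any local extension: in the fibre
  direction equivariance makes it multiplication by \<open>\<i>\<close>.\<close>

lemma derivative_E:
  assumes p: "p \<in> S" and U: "open U" "p \<in> U" "\<And>q. q \<in> S \<inter> U \<Longrightarrow> E' q = E q"
    and E': "(E' has_derivative DE) (at p)" and v: "v \<in> tangent_space S p"
  shows "DE v = (v \<bullet> E p) *\<^sub>R curvature_vector p + (v \<bullet> (\<i> *s p)) *\<^sub>R (\<i> *s E p)"
proof -
  have H: "curvature_vector p = DE (E p)"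
    unfolding curvature_vector_def by (rule tangent_deriv_eq[OF E_tangent[OF p] E' U])
  let ?c = "\<lambda>\<theta>. cis \<theta> *s p"
  have c: "curve_on S UNIV ?c"
    using rotate_S[OF p] smooth_on_smult[OF smooth_on_cis[OF smooth_on_ident] smooth_on_const]
    by (auto simp: curve_on_def)
  have d: "((\<lambda>\<theta>. cis \<theta> *s u) has_vector_derivative \<i> *s u) (at 0)" for u :: "complex^'n"
  proof -
    have "(cis has_vector_derivative \<i>) (at 0)"
      using cis_has_derivative[of 0] by (simp add: has_vector_derivative_def)
    from smult_has_vector_derivative[OF this has_vector_derivative_const[of u]] show ?thesis by simp
  qed
  have "((E \<circ> ?c) has_vector_derivative DE (vector_derivative ?c (at 0))) (at 0)"
    by (rule has_vector_derivative_along_curve[OF c, of 0 E' DE U]) (use E' U in auto)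
  moreover have "E \<circ> ?c = (\<lambda>\<theta>. cis \<theta> *s E p)" using rotate_E[OF p] by (auto simp: fun_eq_iff)
  ultimately have "DE (\<i> *s p) = \<i> *s E p"
    using d[of "E p"] vector_derivative_at[OF d[of p]] vector_derivative_unique_at by metis
  moreover have "DE v = DE ((v \<bullet> E p) *\<^sub>R E p + (v \<bullet> (\<i> *s p)) *\<^sub>R (\<i> *s p))"
    using tangent_vector_eq[OF p v] by simp
  ultimately show ?thesis
    using H has_derivative_linear[OF E'] by (simp add: linear_add linear_scale)
qed

lemma inner_curvature_vector_E:
  assumes p: "p \<in> S"
  shows "curvature_vector p \<bullet> E p = 0"
proof -
  obtain U E' where U: "open U" "p \<in> U" "smooth_on U E'" "\<And>q. q \<in> S \<inter> U \<Longrightarrow> E' q = E q"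
    using smooth_on_local_extension[OF smooth_E p] by metis
  note d = smooth_on_has_derivative[OF U(1,3,2)]
  have H: "curvature_vector p = frechet_derivative E' (at p) (E p)"
    unfolding curvature_vector_def by (rule tangent_deriv_eq[OF E_tangent[OF p] d U(1,2,4)])
  have "E' p \<bullet> frechet_derivative E' (at p) (E p) + frechet_derivative E' (at p) (E p) \<bullet> E' p = 0"
    by (rule derivative_eq_on_tangent_space[OF E_tangent[OF p] has_derivative_inner[OF d d]
          has_derivative_const[of 1] U(1,2)]) (use U(4) unit_E in auto)
  then show ?thesis using U(2,4) p by (simp add: H inner_commute)
qed

lemma has_derivative_times_i: "((\<lambda>q. \<i> *s q) has_derivative (\<lambda>u. \<i> *s u)) (at (p :: complex^'n))"
  by (intro bounded_linear_imp_has_derivative bounded_bilinear.bounded_linear_right[OF bounded_bilinear_smult])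

text \<open>Differentiating the projection itself produces multiples of \<open>p\<close>, \<open>\<i>p\<close> and \<open>E p\<close>, which the projection at
  \<open>p\<close> kills, and multiples of the derivatives of these vectors, which give the last two terms.\<close>

lemma tangent_deriv_nproj:
  assumes p: "p \<in> S" and U: "open U" "p \<in> U" "smooth_on U W" and u: "u \<in> tangent_space S p"
    and f: "\<And>q. q \<in> S \<inter> U \<Longrightarrow> f q = nproj q (W q)"
  shows "nproj p (tangent_deriv S f p u) = nproj p (frechet_derivative W (at p) u)
    - (W p \<bullet> (\<i> *s p)) *\<^sub>R (u \<bullet> E p) *\<^sub>R (\<i> *s E p)
    - (W p \<bullet> E p) *\<^sub>R ((u \<bullet> E p) *\<^sub>R nproj p (curvature_vector p) + (u \<bullet> (\<i> *s p)) *\<^sub>R (\<i> *s E p))"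
proof -
  obtain V E' where V: "open V" "p \<in> V" "smooth_on V E'" "\<And>q. q \<in> S \<inter> V \<Longrightarrow> E' q = E q"
    using smooth_on_local_extension[OF smooth_E p] by metis
  let ?DE = "frechet_derivative E' (at p)" and ?DW = "frechet_derivative W (at p)"
  note E' = smooth_on_has_derivative[OF V(1,3,2)] and W = smooth_on_has_derivative[OF U(1,3,2)]
  let ?g = "\<lambda>q. W q - (W q \<bullet> q) *\<^sub>R q - (W q \<bullet> (\<i> *s q)) *\<^sub>R (\<i> *s q) - (W q \<bullet> E' q) *\<^sub>R E' q"
  let ?g' = "\<lambda>u. ?DW u - ((W p \<bullet> p) *\<^sub>R u + (W p \<bullet> u + ?DW u \<bullet> p) *\<^sub>R p)
    - ((W p \<bullet> (\<i> *s p)) *\<^sub>R (\<i> *s u) + (W p \<bullet> (\<i> *s u) + ?DW u \<bullet> (\<i> *s p)) *\<^sub>R (\<i> *s p))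
    - ((W p \<bullet> E' p) *\<^sub>R ?DE u + (W p \<bullet> ?DE u + ?DW u \<bullet> E' p) *\<^sub>R E' p)"
  have g: "(?g has_derivative ?g') (at p)"
    by (intro has_derivative_diff has_derivative_scaleR has_derivative_inner W E'
        has_derivative_times_i has_derivative_ident)
  have Ep: "E' p = E p" using V(2,4) p by simp
  have "tangent_deriv S f p u = ?g' u"
    by (rule tangent_deriv_eq[OF u g open_Int[OF U(1) V(1)]])
       (use U V f in \<open>simp_all add: nproj_expand\<close>)
  moreover have DE: "?DE u = (u \<bullet> E p) *\<^sub>R curvature_vector p + (u \<bullet> (\<i> *s p)) *\<^sub>R (\<i> *s E p)"
    by (rule derivative_E[OF p V(1,2,4) E' u])
  moreover note nproj_tangent[OF p u]
  ultimately show ?thesis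
    by (simp add: nproj_add nproj_diff nproj_scaleR nproj_frame[OF p] Ep)
qed

text \<open>Expanding both fields in the frame shows that the normal part of the derivative of \<open>Y\<close> along \<open>X\<close> is
  symmetric in \<open>X\<close> and \<open>Y\<close>, so that it cancels in the bracket.\<close>

lemma lie_bracket_tangent:
  assumes p: "p \<in> S" and U: "open U" "p \<in> U"
    and X: "smooth_on U X'" "\<And>q. q \<in> S \<inter> U \<Longrightarrow> X' q = X q"
    and Y: "smooth_on U Y'" "\<And>q. q \<in> S \<inter> U \<Longrightarrow> Y' q = Y q"
    and t: "\<And>q. q \<in> S \<Longrightarrow> X q \<in> tangent_space S q" "\<And>q. q \<in> S \<Longrightarrow> Y q \<in> tangent_space S q"
  shows "frechet_derivative Y' (at p) (X p) - frechet_derivative X' (at p) (Y p) \<in> tangent_space S p"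
proof (rule tangent_vectorI[OF p])
  obtain V E' where V: "open V" "p \<in> V" "smooth_on V E'" "\<And>q. q \<in> S \<inter> V \<Longrightarrow> E' q = E q"
    using smooth_on_local_extension[OF smooth_E p] by metis
  note E' = smooth_on_has_derivative[OF V(1,3,2)]
  have Ep: "E' p = E p" using V(2,4) p by simp
  have op: "open (U \<inter> V)" "p \<in> U \<inter> V" using U V by auto
  have nderiv: "nproj p (frechet_derivative Z' (at p) w)
      = (Z p \<bullet> E p) *\<^sub>R ((w \<bullet> E p) *\<^sub>R nproj p (curvature_vector p) + (w \<bullet> (\<i> *s p)) *\<^sub>R (\<i> *s E p))
        + (Z p \<bullet> (\<i> *s p)) *\<^sub>R (w \<bullet> E p) *\<^sub>R (\<i> *s E p)"
    and pderiv: "frechet_derivative Z' (at p) w \<bullet> p + Z p \<bullet> w = 0"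
    if Z: "smooth_on U Z'" "\<And>q. q \<in> S \<inter> U \<Longrightarrow> Z' q = Z q" "\<And>q. q \<in> S \<Longrightarrow> Z q \<in> tangent_space S q"
      and w: "w \<in> tangent_space S p" for Z' Z w
  proof -
    note dZ = smooth_on_has_derivative[OF U(1) Z(1) U(2)]
    have Zp: "Z' p = Z p" using Z(2) U p by simp
    let ?DZ = "frechet_derivative Z' (at p)" and ?DE = "frechet_derivative E' (at p)"
    have "?DZ w = ((Z' p \<bullet> E' p) *\<^sub>R ?DE w + (Z' p \<bullet> ?DE w + ?DZ w \<bullet> E' p) *\<^sub>R E' p)
       + ((Z' p \<bullet> (\<i> *s p)) *\<^sub>R (\<i> *s w) + (Z' p \<bullet> (\<i> *s w) + ?DZ w \<bullet> (\<i> *s p)) *\<^sub>R (\<i> *s p))"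
      by (rule derivative_eq_on_tangent_space[OF w dZ _ op, of "\<lambda>q. (Z' q \<bullet> E' q) *\<^sub>R E' q + (Z' q \<bullet> (\<i> *s q)) *\<^sub>R (\<i> *s q)"],
          intro has_derivative_add has_derivative_scaleR has_derivative_inner dZ E' has_derivative_times_i)
         (use Z V(4) tangent_vector_eq in force)
    then have "nproj p (?DZ w) = (Z p \<bullet> E p) *\<^sub>R nproj p (?DE w) + (Z p \<bullet> (\<i> *s p)) *\<^sub>R nproj p (\<i> *s w)"
      by (metis (no_types, lifting) Ep Zp nproj_add nproj_scaleR nproj_frame(2,3)[OF p] add_0_right scaleR_zero_right)
    moreover have "?DE w = (w \<bullet> E p) *\<^sub>R curvature_vector p + (w \<bullet> (\<i> *s p)) *\<^sub>R (\<i> *s E p)"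
      by (rule derivative_E[OF p V(1,2,4) E' w])
    moreover note nproj_tangent(2)[OF p w]
    ultimately show "nproj p (?DZ w)
      = (Z p \<bullet> E p) *\<^sub>R ((w \<bullet> E p) *\<^sub>R nproj p (curvature_vector p) + (w \<bullet> (\<i> *s p)) *\<^sub>R (\<i> *s E p))
        + (Z p \<bullet> (\<i> *s p)) *\<^sub>R (w \<bullet> E p) *\<^sub>R (\<i> *s E p)"
      by (simp add: nproj_add nproj_scaleR nproj_frame[OF p])
    have "Z' p \<bullet> w + ?DZ w \<bullet> p = 0"
    proof (rule derivative_eq_on_tangent_space[OF w has_derivative_inner[OF dZ has_derivative_ident]
          has_derivative_const[of 0] U])
      fix q assume q: "q \<in> S \<inter> U"
      then have "Z' q \<in> tangent_space S q" using Z by simp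
      then show "Z' q \<bullet> q = 0" using q frame_inner[of q] by (auto simp: tangent_S inner_add_left)
    qed
    then show "?DZ w \<bullet> p + Z p \<bullet> w = 0" by (simp add: Zp)
  qed
  note nY = nderiv[where Z' = Y' and Z = Y, OF Y t(2) t(1)[OF p]]
    and nX = nderiv[where Z' = X' and Z = X, OF X t(1) t(2)[OF p]]
  show "nproj p (frechet_derivative Y' (at p) (X p) - frechet_derivative X' (at p) (Y p)) = 0"
    using nX nY by (simp add: nproj_diff algebra_simps)
  show "(frechet_derivative Y' (at p) (X p) - frechet_derivative X' (at p) (Y p)) \<bullet> p = 0"
    using pderiv[OF Y t(2) t(1)[OF p]] pderiv[OF X t(1) t(2)[OF p]]
    by (simp add: inner_diff_left inner_diff_right inner_commute)
qed

text \<open>As \<open>\<xi>\<close> is orthogonal to \<open>\<i>q\<close> and \<open>E q\<close> along \<open>S\<close>, the components of its derivative in these directions are,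
  up to sign, the products of \<open>\<xi>\<close> with the derivatives of \<open>\<i>q\<close> and \<open>E q\<close>.\<close>

lemma normal_conn_tangent_deriv:
  assumes p: "p \<in> S" and u: "u \<in> tangent_space S p"
    and U: "open U" "p \<in> U" "smooth_on U Y'" "\<And>q. q \<in> S \<inter> U \<Longrightarrow> Y' q = Y q"
      "smooth_on U \<xi>'" "\<And>q. q \<in> S \<inter> U \<Longrightarrow> \<xi>' q = \<xi> q"
    and t: "\<And>q. q \<in> S \<Longrightarrow> Y q \<in> tangent_space S q"
      "\<And>q. q \<in> S \<Longrightarrow> \<xi> q \<in> normal_space (sphere 0 1) S q"
  defines "h \<equiv> \<xi> p \<bullet> curvature_vector p" and "k \<equiv> \<xi> p \<bullet> (\<i> *s E p)"
  shows "nproj p (tangent_deriv S (normal_conn (sphere 0 1) S Y \<xi>) p u)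
    = nproj p (frechet_derivative (\<lambda>q. frechet_derivative \<xi>' (at q) (Y p)) (at p) u
          + frechet_derivative \<xi>' (at p) (frechet_derivative Y' (at p) u))
      + ((Y p \<bullet> E p) * k * (u \<bullet> E p)) *\<^sub>R (\<i> *s E p)
      + ((Y p \<bullet> E p) * h + (Y p \<bullet> (\<i> *s p)) * k) *\<^sub>R
        ((u \<bullet> E p) *\<^sub>R nproj p (curvature_vector p) + (u \<bullet> (\<i> *s p)) *\<^sub>R (\<i> *s E p))"
proof -
  let ?D\<xi> = "frechet_derivative \<xi>' (at p)"
  define W where "W q = frechet_derivative \<xi>' (at q) (Y' q)" for q
  have W: "smooth_on U W" unfolding W_def by (rule smooth_on_frechet[OF U(1,5,3)])
  have f: "normal_conn (sphere 0 1) S Y \<xi> q = nproj q (W q)" if q: "q \<in> S \<inter> U" for q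
  proof -
    have "tangent_deriv S \<xi> q (Y q) = frechet_derivative \<xi>' (at q) (Y q)"
      by (rule tangent_deriv_eq[OF t(1) smooth_on_has_derivative[OF U(1,5)] U(1) _ U(6)]) (use q in auto)
    then show ?thesis using normal_conn_eq q U(4)[OF q] by (simp add: W_def)
  qed
  note d\<xi> = smooth_on_has_derivative[OF U(1,5,2)] and dY = smooth_on_has_derivative[OF U(1,3,2)]
  have val: "Y' p = Y p" "\<xi>' p = \<xi> p" using U(2,4,6) p by auto
  have DW: "frechet_derivative W (at p) u
      = frechet_derivative (\<lambda>q. frechet_derivative \<xi>' (at q) (Y p)) (at p) u
        + ?D\<xi> (frechet_derivative Y' (at p) u)"
    using frechet_derivative_eqI[OF has_derivative_frechet_along[OF U(1,5,2) dY]]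
    by (simp add: W_def[abs_def] val)
  define a b where "a = Y p \<bullet> E p" and "b = Y p \<bullet> (\<i> *s p)"
  have Y_eq: "Y p = a *\<^sub>R E p + b *\<^sub>R (\<i> *s p)"
    unfolding a_def b_def by (rule tangent_vector_eq[OF p t(1)[OF p]])
  have Wi: "W p \<bullet> (\<i> *s p) = - a * k"
  proof -
    have "\<xi>' p \<bullet> (\<i> *s Y p) + ?D\<xi> (Y p) \<bullet> (\<i> *s p) = 0"
      by (rule derivative_eq_on_tangent_space[OF t(1)[OF p] has_derivative_inner[OF d\<xi> has_derivative_times_i]
            has_derivative_const[of 0] U(1,2)])
         (use U(6) t(2) normal_vector_inner(2) in auto)
    moreover have "\<i> *s Y p = a *\<^sub>R (\<i> *s E p) - b *\<^sub>R p" unfolding Y_eq by (simp add: vec_eq_iff algebra_simps)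
    ultimately show ?thesis
      using normal_vector_inner(1)[OF t(2)[OF p] p] by (simp add: W_def val inner_diff_right k_def)
  qed
  have WE: "W p \<bullet> E p = - (a * h + b * k)"
  proof -
    obtain V E' where V: "open V" "p \<in> V" "smooth_on V E'" "\<And>q. q \<in> S \<inter> V \<Longrightarrow> E' q = E q"
      using smooth_on_local_extension[OF smooth_E p] by metis
    note E' = smooth_on_has_derivative[OF V(1,3,2)]
    have "\<xi>' p \<bullet> frechet_derivative E' (at p) (Y p) + ?D\<xi> (Y p) \<bullet> E' p = 0"
      by (rule derivative_eq_on_tangent_space[OF t(1)[OF p] has_derivative_inner[OF d\<xi> E']
            has_derivative_const[of 0] open_Int[OF U(1) V(1)]])
         (use U V t(2) normal_vector_inner(3) in auto)
    moreover have "frechet_derivative E' (at p) (Y p) = a *\<^sub>R curvature_vector p + b *\<^sub>R (\<i> *s E p)"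
      unfolding a_def b_def by (rule derivative_E[OF p V(1,2,4) E' t(1)[OF p]])
    moreover have "E' p = E p" using V(2,4) p by simp
    ultimately show ?thesis by (simp add: W_def val inner_add_right h_def k_def)
  qed
  show ?thesis
    using tangent_deriv_nproj[OF p U(1,2) W u f]
    unfolding DW Wi WE a_def[symmetric] b_def[symmetric] by (simp add: algebra_simps)
qed

text \<open>This is the Ricci equation for \<open>S\<close>: the second fundamental form has the entries
  \<open>nproj p (curvature_vector p)\<close>, \<open>\<i> *s E p\<close> and \<open>0\<close> with respect to the frame \<open>E p\<close>, \<open>\<i> *s p\<close>.\<close>

lemma normal_curvature_eq:
  assumes p: "p \<in> S" and sm: "smooth_on S X" "smooth_on S Y" "smooth_on S \<xi>"
    and t: "\<And>q. q \<in> S \<Longrightarrow> X q \<in> tangent_space S q" "\<And>q. q \<in> S \<Longrightarrow> Y q \<in> tangent_space S q"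
      "\<And>q. q \<in> S \<Longrightarrow> \<xi> q \<in> normal_space (sphere 0 1) S q"
  shows "normal_curvature (sphere 0 1) S X Y \<xi> p =
    ((X p \<bullet> E p) * (Y p \<bullet> (\<i> *s p)) - (Y p \<bullet> E p) * (X p \<bullet> (\<i> *s p))) *\<^sub>R
      ((\<xi> p \<bullet> (\<i> *s E p)) *\<^sub>R nproj p (curvature_vector p)
        - (\<xi> p \<bullet> curvature_vector p) *\<^sub>R (\<i> *s E p))"
proof -
  obtain U1 X' where 1: "open U1" "p \<in> U1" "smooth_on U1 X'" "\<And>q. q \<in> S \<inter> U1 \<Longrightarrow> X' q = X q"
    using smooth_on_local_extension[OF sm(1) p] by metis
  obtain U2 Y' where 2: "open U2" "p \<in> U2" "smooth_on U2 Y'" "\<And>q. q \<in> S \<inter> U2 \<Longrightarrow> Y' q = Y q"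
    using smooth_on_local_extension[OF sm(2) p] by metis
  obtain U3 \<xi>' where 3: "open U3" "p \<in> U3" "smooth_on U3 \<xi>'" "\<And>q. q \<in> S \<inter> U3 \<Longrightarrow> \<xi>' q = \<xi> q"
    using smooth_on_local_extension[OF sm(3) p] by metis
  define U where "U = U1 \<inter> U2 \<inter> U3"
  have U: "open U" "p \<in> U" unfolding U_def using 1 2 3 by auto
  have X': "smooth_on U X'" "\<And>q. q \<in> S \<inter> U \<Longrightarrow> X' q = X q"
    using 1(4) by (auto simp: U_def intro: smooth_on_subset[OF 1(3)])
  have Y': "smooth_on U Y'" "\<And>q. q \<in> S \<inter> U \<Longrightarrow> Y' q = Y q"
    using 2(4) by (auto simp: U_def intro: smooth_on_subset[OF 2(3)])
  have \<xi>': "smooth_on U \<xi>'" "\<And>q. q \<in> S \<inter> U \<Longrightarrow> \<xi>' q = \<xi> q"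
    using 3(4) by (auto simp: U_def intro: smooth_on_subset[OF 3(3)])
  note dX = smooth_on_has_derivative[OF U(1) X'(1) U(2)]
    and dY = smooth_on_has_derivative[OF U(1) Y'(1) U(2)]
    and d\<xi> = smooth_on_has_derivative[OF U(1) \<xi>'(1) U(2)]
  let ?B = "frechet_derivative Y' (at p) (X p) - frechet_derivative X' (at p) (Y p)"
  have bracket: "lie_bracket S X Y p = ?B"
    unfolding lie_bracket_def
    using tangent_deriv_eq[OF t(1)[OF p] dY U Y'(2)] tangent_deriv_eq[OF t(2)[OF p] dX U X'(2)] by simp
  have "tangent_deriv S \<xi> p ?B = frechet_derivative \<xi>' (at p) ?B"
    by (rule tangent_deriv_eq[OF lie_bracket_tangent[OF p U X' Y' t(1,2)] d\<xi> U \<xi>'(2)])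
  also have "\<dots> = frechet_derivative \<xi>' (at p) (frechet_derivative Y' (at p) (X p))
      - frechet_derivative \<xi>' (at p) (frechet_derivative X' (at p) (Y p))"
    by (rule linear_diff[OF has_derivative_linear[OF d\<xi>]])
  finally have bracket_term: "tangent_deriv S \<xi> p (lie_bracket S X Y p)
      = frechet_derivative \<xi>' (at p) (frechet_derivative Y' (at p) (X p))
        - frechet_derivative \<xi>' (at p) (frechet_derivative X' (at p) (Y p))"
    unfolding bracket .
  show ?thesis
    unfolding normal_curvature_def normal_conn_eq[OF p] bracket_term
    using frechet_derivative_commute[OF U(1) \<xi>'(1) U(2), of "Y p" "X p"] normal_conn_tangent_deriv[OF p t(1)[OF p] U Y' \<xi>' t(2,3)]
      normal_conn_tangent_deriv[OF p t(2)[OF p] U X' \<xi>' t(1,3)]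
    by (simp add: nproj_add nproj_diff algebra_simps)
qed

text \<open>Necessity is tested on the fields \<open>E\<close>, \<open>\<i>q\<close> and the normal projection of the constant vector
  \<open>\<i> *s E p\<close>, which are defined on all of \<open>S\<close> and therefore admissible as they stand.\<close>

theorem flat_normal_bundle_iff:
  "flat_normal_bundle (sphere 0 1) S \<longleftrightarrow>
    (\<forall>p\<in>S. nproj p (curvature_vector p) = (curvature_vector p \<bullet> (\<i> *s E p)) *\<^sub>R (\<i> *s E p))"
    (is "_ \<longleftrightarrow> (\<forall>p\<in>S. ?parallel p)")
proof (intro iffI ballI)
  fix p assume flat: "flat_normal_bundle (sphere 0 1) S" and p: "p \<in> S"
  define \<xi> where "\<xi> q = nproj q (\<i> *s E p)" for q
  have sm: "smooth_on S (\<lambda>q. \<i> *s q)" "smooth_on S \<xi>"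
    unfolding \<xi>_def by (auto intro!: smooth_on_smult smooth_on_nproj)
  have t: "\<And>q. q \<in> S \<Longrightarrow> \<xi> q \<in> normal_space (sphere 0 1) S q"
    unfolding \<xi>_def by (rule nproj_normal)
  have "normal_curvature (sphere 0 1) S E (\<lambda>q. \<i> *s q) \<xi> p = 0"
    using flat[unfolded flat_normal_bundle_def, rule_format, of E "\<lambda>q. \<i> *s q" \<xi> p]
      smooth_E sm t E_tangent ip_tangent p by blast
  then have "nproj p (curvature_vector p) - ((\<i> *s E p) \<bullet> curvature_vector p) *\<^sub>R (\<i> *s E p) = 0"
    using normal_curvature_eq[OF p smooth_E sm E_tangent ip_tangent t]
    by (simp add: \<xi>_def nproj_frame[OF p] frame_inner[OF p] unit_E[OF p])
  then show "?parallel p" by (simp add: inner_commute)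
next
  assume par: "\<forall>p\<in>S. ?parallel p"
  show "flat_normal_bundle (sphere 0 1) S"
    unfolding flat_normal_bundle_def
  proof (intro allI impI ballI, elim conjE)
    fix X Y \<xi> p
    assume sm: "smooth_on S X" "smooth_on S Y" "smooth_on S \<xi>" and p: "p \<in> S"
      and t: "\<forall>p\<in>S. X p \<in> tangent_space S p \<and> Y p \<in> tangent_space S p
        \<and> \<xi> p \<in> normal_space (sphere 0 1) S p"
    let ?m = "curvature_vector p \<bullet> (\<i> *s E p)"
    have "\<xi> p \<bullet> curvature_vector p = \<xi> p \<bullet> nproj p (curvature_vector p)"
      using inner_nproj[OF _ p] t p by simp
    also have "\<dots> = ?m * (\<xi> p \<bullet> (\<i> *s E p))" using par p by simp
    finally show "normal_curvature (sphere 0 1) S X Y \<xi> p = 0"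
      using normal_curvature_eq[OF p sm] t par p by simp
  qed
qed

end

section \<open>The pull-back of a curve of projective space\<close>

lemma openin_cp_topology:
  "openin cp_topology U \<longleftrightarrow> U \<subseteq> CP \<and> openin (top_of_set (sphere 0 1)) (hopf_preimage U)"
proof -
  have "istopology (\<lambda>U :: 'a cpoint set. U \<subseteq> CP \<and> openin (top_of_set (sphere 0 1)) (hopf_preimage U))"
    unfolding istopology_def
  proof (rule conjI)
    show "\<forall>A B :: 'a cpoint set. A \<subseteq> CP \<and> openin (top_of_set (sphere 0 1)) (hopf_preimage A) \<longrightarrow>
        B \<subseteq> CP \<and> openin (top_of_set (sphere 0 1)) (hopf_preimage B) \<longrightarrow>
        A \<inter> B \<subseteq> CP \<and> openin (top_of_set (sphere 0 1)) (hopf_preimage (A \<inter> B))"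
    proof (intro allI impI)
      fix A B :: "'a cpoint set"
      assume "A \<subseteq> CP \<and> openin (top_of_set (sphere 0 1)) (hopf_preimage A)"
        "B \<subseteq> CP \<and> openin (top_of_set (sphere 0 1)) (hopf_preimage B)"
      moreover have "hopf_preimage (A \<inter> B) = hopf_preimage A \<inter> hopf_preimage B"
        by (auto simp: hopf_preimage_def)
      ultimately show "A \<inter> B \<subseteq> CP \<and> openin (top_of_set (sphere 0 1)) (hopf_preimage (A \<inter> B))"
        by (auto intro: openin_Int)
    qed
    show "\<forall>K. (\<forall>A::'a cpoint set\<in>K. A \<subseteq> CP \<and> openin (top_of_set (sphere 0 1)) (hopf_preimage A)) \<longrightarrow>
        \<Union>K \<subseteq> CP \<and> openin (top_of_set (sphere 0 1)) (hopf_preimage (\<Union>K))"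
    proof (intro allI impI)
      fix K :: "'a cpoint set set"
      assume K: "\<forall>A\<in>K. A \<subseteq> CP \<and> openin (top_of_set (sphere 0 1)) (hopf_preimage A)"
      have "hopf_preimage (\<Union>K) = \<Union>(hopf_preimage ` K)" by (auto simp: hopf_preimage_def)
      moreover have "openin (top_of_set (sphere 0 1)) (\<Union>(hopf_preimage ` K))"
        using K by (intro openin_Union) auto
      ultimately show "\<Union>K \<subseteq> CP \<and> openin (top_of_set (sphere 0 1)) (hopf_preimage (\<Union>K))"
        using K by auto
    qed
  qed
  then show ?thesis unfolding cp_topology_def by (simp add: topology_inverse')
qed

text \<open>A parametrization is an embedding onto an open piece of \<open>M\<close>: points of \<open>M\<close> near \<open>\<gamma> t\<close> have parameters
  near \<open>t\<close>.\<close>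

lemma local_param_open_image:
  assumes "local_param M I \<gamma>" "open V" "V \<subseteq> I"
  obtains O' where "open O'" "\<And>p. p \<in> hopf_preimage M \<Longrightarrow> p \<in> O' \<longleftrightarrow> hopf p \<in> \<gamma> ` V"
proof -
  have emb: "homeomorphic_map (top_of_set I) (subtopology cp_topology (\<gamma> ` I)) \<gamma>"
    and I: "openin (subtopology cp_topology M) (\<gamma> ` I)"
    using assms(1) by (auto simp: local_param_def embedding_map_def)
  have "openin (top_of_set I) V" using assms(2,3) by (simp add: open_subset)
  then have "openin (subtopology cp_topology (\<gamma> ` I)) (\<gamma> ` V)"
    using homeomorphic_imp_open_map[OF emb] by (simp add: open_map_def)
  then obtain A where A: "openin cp_topology A" "\<gamma> ` V = A \<inter> \<gamma> ` I"
    by (auto simp: openin_subtopology)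
  obtain B where B: "openin cp_topology B" "\<gamma> ` I = B \<inter> M" using I by (auto simp: openin_subtopology)
  have "openin (top_of_set (sphere 0 1)) (hopf_preimage (A \<inter> B))"
    using openin_Int[OF A(1) B(1)] by (simp add: openin_cp_topology)
  then obtain O' where O': "open O'" "hopf_preimage (A \<inter> B) = sphere 0 1 \<inter> O'"
    by (auto simp: openin_open)
  show ?thesis
  proof (rule that[OF O'(1)])
    fix p assume "p \<in> hopf_preimage M"
    then have "p \<in> sphere 0 1" "hopf p \<in> M" by (auto simp: hopf_preimage_def)
    then show "p \<in> O' \<longleftrightarrow> hopf p \<in> \<gamma> ` V"
      using O'(2) A(2) B(2) by (auto simp: hopf_preimage_def)
  qed
qed

lemma field_along_subset:
  assumes "field_along I \<gamma> X" "open I" "J \<subseteq> I"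
  shows "field_along J \<gamma> X"
proof (rule field_alongI)
  fix t assume "t \<in> J"
  then have "t \<in> I" using assms(3) by blast
  then obtain U c v where "t \<in> U" "field_lift U c v \<gamma> X"
    by (rule field_along_lift[OF assms(1,2)])
  then show "\<exists>U c v. t \<in> U \<and> field_lift U c v \<gamma> X" by blast
qed

lemma cp_curve_lift:
  assumes \<gamma>: "cp_curve_on M I \<gamma>" and t: "t \<in> I" and p: "norm p = 1" "hopf p = \<gamma> t"
  obtains U c where "t \<in> U" "U \<subseteq> I" "lift_of U c \<gamma>" "curve_on (hopf_preimage M) U c" "c t = p"
proof -
  have I: "open I" "cp_smooth_on I \<gamma>" "\<gamma> ` I \<subseteq> M" using \<gamma> by (auto simp: cp_curve_on_def)
  obtain V d where V: "open V" "t \<in> V" "smooth_on V d" "d ` V \<subseteq> sphere 0 1" "\<forall>y\<in>I \<inter> V. hopf (d y) = \<gamma> y"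
    using I(2) t unfolding cp_smooth_on_def by fast
  define z where "z = herm p (d t)"
  have "norm (d t) = 1" "hopf p = hopf (d t)" using V t p by auto
  then have z: "p = z *s d t" "cmod z = 1" unfolding z_def by (rule hopf_eqD)+
  define c where "c s = z *s d s" for s
  have c: "smooth_on (I \<inter> V) c" unfolding c_def
    using smooth_on_subset[OF V(3)] by (intro smooth_on_smult smooth_on_const) auto
  have cs: "c s \<in> sphere 0 1" "hopf (c s) = \<gamma> s" if "s \<in> I \<inter> V" for s
    using V(4,5) that norm_smult_unit[OF z(2), of "d s"] hopf_rotate[OF z(2), of "d s"]
    by (auto simp: c_def)
  have op: "open (I \<inter> V)" using I(1) V(1) by auto
  have "lift_of (I \<inter> V) c \<gamma>" unfolding lift_of_def curve_on_def using c cs op by auto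
  moreover have "curve_on (hopf_preimage M) (I \<inter> V) c"
    unfolding curve_on_def hopf_preimage_def using c cs op I(3) by auto
  ultimately show ?thesis using that[of "I \<inter> V" c] t V(2) z(1) by (simp add: c_def)
qed

lemma lift_of_cp_curve:
  assumes "lift_of U c \<gamma>" "\<gamma> ` U \<subseteq> M"
  shows "cp_curve_on M U \<gamma>"
proof -
  note c = lift_ofD[OF assms(1)]
  have "cp_smooth_on U \<gamma>"
    unfolding cp_smooth_on_def using c(1,2,4,5) by (intro ballI exI[of _ U] exI[of _ c]) auto
  then show ?thesis using c(1) assms(2) by (simp add: cp_curve_on_def)
qed

lemma curve_on_preimage_lift:
  assumes "curve_on (hopf_preimage M) U c"
  shows "lift_of U c (hopf \<circ> c)" "cp_curve_on M U (hopf \<circ> c)"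
proof -
  have c: "open U" "smooth_on U c" "c ` U \<subseteq> sphere 0 1" "\<And>s. s \<in> U \<Longrightarrow> hopf (c s) \<in> M"
    using assms by (auto simp: curve_on_def hopf_preimage_def)
  then show "lift_of U c (hopf \<circ> c)" by (simp add: lift_of_def curve_on_def)
  then show "cp_curve_on M U (hopf \<circ> c)" by (rule lift_of_cp_curve) (use c(4) in auto)
qed

lemma preimage_rotate: "p \<in> hopf_preimage M \<Longrightarrow> cmod z = 1 \<Longrightarrow> z *s p \<in> hopf_preimage M"
  by (simp add: hopf_preimage_def hopf_rotate norm_smult_unit)

locale unit_speed_curve =
  fixes M :: "('n::finite) cpoint set" and T :: "'n cpoint \<Rightarrow> 'n cvector"
  assumes M: "curve_submanifold M" and T: "unit_tangent_field M T"
begin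

abbreviation S :: "(complex^'n) set" where "S \<equiv> hopf_preimage M"

text \<open>The horizontal lift of \<open>T\<close>.\<close>

definition E :: "complex^'n \<Rightarrow> complex^'n" where
  "E p = (THE v. herm v p = 0 \<and> T (hopf p) = dhopf p v)"

lemma S_D: "p \<in> S \<Longrightarrow> norm p = 1" "p \<in> S \<Longrightarrow> hopf p \<in> M"
  by (auto simp: hopf_preimage_def)

lemma M_hopf:
  assumes "x \<in> M"
  obtains p where "p \<in> S" "x = hopf p"
  using assms M unfolding curve_submanifold_def CP_def hopf_preimage_def by auto

lemma curve_tangent_space_lift:
  assumes "X \<in> curve_tangent_space M (hopf p)" "p \<in> S"
  obtains U c t where "curve_on S U c" "t \<in> U" "c t = p" "X = dhopf p (vector_derivative c (at t))"
proof -
  obtain I \<gamma> t where \<gamma>: "X = cp_velocity \<gamma> t" "cp_curve_on M I \<gamma>" "t \<in> I" "\<gamma> t = hopf p"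
    using assms(1) by (auto simp: curve_tangent_space_def)
  obtain U c where c: "t \<in> U" "U \<subseteq> I" "lift_of U c \<gamma>" "curve_on S U c" "c t = p"
    by (rule cp_curve_lift[OF \<gamma>(2,3) S_D(1)[OF assms(2)] \<gamma>(4)[symmetric]])
  show ?thesis using that[OF c(4,1,5)] lift_ofD(7)[OF c(3,1)] \<gamma>(1) c(5) by simp
qed

lemma E_props:
  assumes "p \<in> S"
  shows "herm (E p) p = 0" "T (hopf p) = dhopf p (E p)"
proof -
  have "T (hopf p) \<in> curve_tangent_space M (hopf p)"
    using T S_D(2)[OF assms] by (auto simp: unit_tangent_field_def)
  then obtain w where w: "T (hopf p) = dhopf p w"
    using curve_tangent_space_lift[OF _ assms] by metis
  define v where "v = horizontal_part p w"
  have v: "herm v p = 0 \<and> T (hopf p) = dhopf p v"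
    using herm_horizontal_part[OF S_D(1)[OF assms]] dhopf_horizontal_part[OF S_D(1)[OF assms]] w
    by (simp add: v_def)
  have "E p = v" unfolding E_def
  proof (rule the_equality)
    fix w assume "herm w p = 0 \<and> T (hopf p) = dhopf p w"
    then show "w = v" using v horizontal_unique[OF S_D(1)[OF assms], of w v] by simp
  qed (rule v)
  then show "herm (E p) p = 0" "T (hopf p) = dhopf p (E p)" using v by auto
qed

lemma E_eqI: "p \<in> S \<Longrightarrow> herm v p = 0 \<Longrightarrow> T (hopf p) = dhopf p v \<Longrightarrow> E p = v"
  using E_props[of p] horizontal_unique[OF S_D(1)] by metis

lemma E_unit:
  assumes "p \<in> S"
  shows "E p \<bullet> E p = 1"
proof -
  have "cp_inner (T (hopf p)) (T (hopf p)) = 1"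
    using T S_D(2)[OF assms] by (auto simp: unit_tangent_field_def)
  then show ?thesis
    using cp_inner_dhopf[OF S_D(1)[OF assms]] E_props[OF assms] by (simp add: horizontal_part_ident)
qed

lemma E_rotate:
  assumes "p \<in> S" "cmod z = 1"
  shows "E (z *s p) = z *s E p"
  by (rule E_eqI)
    (use assms E_props[OF assms(1)] preimage_rotate in
      \<open>simp_all add: herm_rotate hopf_rotate dhopf_rotate\<close>)

text \<open>A chart of \<open>M\<close> around \<open>hopf p\<close>, expressed upstairs. The coordinate \<open>\<sigma>\<close> comes from the circle-invariant
  function \<open>Re (\<langle>p, u\<rangle> * cnj \<langle>p, c\<^sub>0\<rangle>)\<close>, where \<open>u\<close> is the horizontal velocity of a lifted parametrization at
  the centre \<open>c\<^sub>0\<close>: its derivative there in direction \<open>u\<close> is the squared length of \<open>u\<close>. Because the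
  parametrization is a topological embedding, nearby points of \<open>M\<close> have nearby parameters.\<close>

lemma chart:
  assumes p0: "p0 \<in> S"
  obtains O' \<sigma> V c v \<gamma> where "open O'" "p0 \<in> O'" "smooth_on O' \<sigma>" "\<sigma> ` O' \<subseteq> V"
    "field_lift V c v \<gamma> (T \<circ> \<gamma>)" "\<forall>p\<in>S \<inter> O'. hopf (c (\<sigma> p)) = hopf p"
proof -
  obtain I \<gamma> where I: "local_param M I \<gamma>" "hopf p0 \<in> \<gamma> ` I"
    using M S_D(2)[OF p0] unfolding curve_submanifold_def by blast
  then obtain s0 where s0: "s0 \<in> I" "hopf p0 = \<gamma> s0" by blast
  have oI: "open I" using I(1) by (simp add: local_param_def cp_curve_on_def)
  have "field_along I \<gamma> (T \<circ> \<gamma>)" using T I(1) by (auto simp: unit_tangent_field_def)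
  then obtain U c v where U: "s0 \<in> U" "U \<subseteq> I" "field_lift U c v \<gamma> (T \<circ> \<gamma>)"
    using field_along_lift[OF _ oI s0(1)] by metis
  note c = lift_ofD[OF field_liftD(1)[OF U(3)]]
  define c0 c' u where "c0 = c s0" and "c' = vector_derivative c (at s0)" and "u = horizontal_part c0 c'"
  have n0: "norm c0 = 1" using c(4)[OF U(1)] by (simp add: c0_def)
  have "cp_inner (cp_velocity \<gamma> s0) (cp_velocity \<gamma> s0) \<noteq> 0" using I(1) s0(1) by (auto simp: local_param_def)
  then have u0: "u \<bullet> u \<noteq> 0"
    using cp_inner_dhopf[OF n0, of c' c'] c(7)[OF U(1)] by (simp add: u_def c0_def c'_def)
  have hu: "herm u c0 = 0" "herm c0 u = 0"
    using herm_horizontal_part[OF n0] cnj_herm[of u c0] by (auto simp: u_def)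
  define G where "G p = Re (herm p u * cnj (herm p c0))" for p
  have Ginv: "G p = G q" if "hopf p = hopf q" "norm q = 1" for p q
  proof -
    have "p = herm p q *s q" "cmod (herm p q) = 1" using hopf_eqD[OF that(2,1)] .
    moreover have "G (z *s q) = G q" if "cmod z = 1" for z
    proof -
      have "herm (z *s q) u * cnj (herm (z *s q) c0) = (z * cnj z) * (herm q u * cnj (herm q c0))"
        by (simp add: herm_simps)
      then show ?thesis using unit_cnj_mult[OF that] by (simp add: G_def)
    qed
    ultimately show ?thesis by metis
  qed
  have smG: "smooth_on UNIV G"
  proof -
    have "smooth_on UNIV (\<lambda>p. herm p u * herm c0 p)"
      by (intro smooth_on_mult smooth_on_herm smooth_on_ident smooth_on_const)
    from smooth_on_linear_compose[OF bounded_linear_Re this] show ?thesis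
      by (simp add: G_def[abs_def] cnj_herm)
  qed
  define g where "g s = G (c s)" for s
  have smg: "smooth_on U g" unfolding g_def
    by (rule smooth_on_compose[OF smG c(2)]) simp
  have "vector_derivative g (at s0) = u \<bullet> u"
  proof -
    note dc = c(6)[OF U(1), folded c'_def]
    have "((\<lambda>s. herm (c s) u * herm c0 (c s)) has_vector_derivative
        herm (c s0) u * (herm c0 c' + herm 0 (c s0)) + (herm (c s0) 0 + herm c' u) * herm c0 (c s0)) (at s0)"
      by (intro has_vector_derivative_mult herm_has_vector_derivative dc has_vector_derivative_const)
    then have "((\<lambda>s. herm (c s) u * herm c0 (c s)) has_vector_derivative herm c' u) (at s0)"
      using hu herm_self[OF n0] by (simp add: c0_def herm_simps)
    from bounded_linear.has_vector_derivative[OF bounded_linear_Re this]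
    have "(g has_vector_derivative Re (herm c' u)) (at s0)"
      by (simp add: g_def[abs_def] G_def cnj_herm)
    moreover have "Re (herm c' u) = u \<bullet> u"
    proof -
      have "herm u u = herm (c' - herm c' c0 *s c0) u" by (simp add: u_def horizontal_part_eq)
      then show ?thesis by (simp add: inner_eq_Re_herm herm_simps hu)
    qed
    ultimately show ?thesis using vector_derivative_at by metis
  qed
  then have "vector_derivative g (at s0) \<noteq> 0" using u0 by simp
  from smooth_local_inverse[OF c(1) smg U(1) this]
  obtain V J h where V: "open V" "s0 \<in> V" "V \<subseteq> U" "open J" "g ` V \<subseteq> J" "smooth_on J h"
    "\<And>t. t \<in> V \<Longrightarrow> h (g t) = t" "h ` J \<subseteq> V" by metis
  have VI: "V \<subseteq> I" using V(3) U(2) by simp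
  obtain O1 where O1: "open O1" "\<And>p. p \<in> S \<Longrightarrow> p \<in> O1 \<longleftrightarrow> hopf p \<in> \<gamma> ` V"
    using local_param_open_image[OF I(1) V(1) VI] by metis
  define O' where "O' = O1 \<inter> G -` J"
  have "open (G -` J)"
    using continuous_open_preimage[OF smooth_on_continuous[OF smG] open_UNIV V(4)] by simp
  then have "open O'" using O1(1) by (auto simp: O'_def)
  moreover have "p0 \<in> O'"
  proof -
    have "G p0 = g s0" unfolding g_def
      by (rule Ginv) (use s0(2) c(4,5)[OF U(1)] in auto)
    then show ?thesis using O1(2)[OF p0] s0(2) V(2,5) by (auto simp: O'_def)
  qed
  moreover have "smooth_on O' (\<lambda>p. h (G p))"
    by (rule smooth_on_compose[OF V(6) smooth_on_subset[OF smG]]) (auto simp: O'_def)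
  moreover have "(\<lambda>p. h (G p)) ` O' \<subseteq> V" using V(8) by (auto simp: O'_def)
  moreover have "field_lift V c v \<gamma> (T \<circ> \<gamma>)" by (rule field_lift_subset[OF U(3) V(1,3)])
  moreover have "\<forall>p\<in>S \<inter> O'. hopf (c (h (G p))) = hopf p"
  proof
    fix p assume p: "p \<in> S \<inter> O'"
    then obtain s where s: "s \<in> V" "hopf p = \<gamma> s" using O1(2)[of p] by (auto simp: O'_def)
    have sU: "s \<in> U" using s(1) V(3) by blast
    have "G p = g s" unfolding g_def by (rule Ginv) (use s c(4,5)[OF sU] in auto)
    then show "hopf (c (h (G p))) = hopf p" using V(7)[OF s(1)] s(2) c(5)[OF sU] by simp
  qed
  ultimately show ?thesis using that[of O' "\<lambda>p. h (G p)" V c v \<gamma>] by blast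
qed

lemma E_smooth: "smooth_on S E"
proof (rule smooth_on_local)
  fix p0 assume p0: "p0 \<in> S"
  obtain O' \<sigma> V c v \<gamma> where C: "open O'" "p0 \<in> O'" "smooth_on O' \<sigma>" "\<sigma> ` O' \<subseteq> V"
    "field_lift V c v \<gamma> (T \<circ> \<gamma>)" "\<forall>p\<in>S \<inter> O'. hopf (c (\<sigma> p)) = hopf p"
    by (rule chart[OF p0])
  note L = field_liftD[OF C(5)]
  note c = lift_ofD[OF L(1)]
  have "smooth_on O' (\<lambda>p. herm p (c (\<sigma> p)) *s v (\<sigma> p))"
    by (intro smooth_on_smult smooth_on_herm smooth_on_ident
        smooth_on_compose[OF c(2) C(3,4)] smooth_on_compose[OF L(2) C(3,4)])
  then have "smooth_on (S \<inter> O') (\<lambda>p. herm p (c (\<sigma> p)) *s v (\<sigma> p))"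
    by (rule smooth_on_subset) simp
  then have "smooth_on (S \<inter> O') E"
  proof (rule smooth_on_cong)
    fix p assume p: "p \<in> S \<inter> O'"
    let ?s = "\<sigma> p"
    let ?z = "herm p (c ?s)"
    have s: "?s \<in> V" using C(4) p by auto
    have hp: "hopf p = hopf (c ?s)" using C(6) p by simp
    have z: "p = ?z *s c ?s" "cmod ?z = 1" using hopf_eqD[OF c(4)[OF s] hp] .
    have "herm (?z *s v ?s) (?z *s c ?s) = 0"
      using herm_rotate[OF z(2), of "v ?s" "c ?s"] L(3)[OF s] by simp
    moreover have "T (hopf p) = dhopf (?z *s c ?s) (?z *s v ?s)"
      using dhopf_rotate[OF z(2), of "c ?s" "v ?s"] L(4)[OF s] hp c(5)[OF s] by simp
    ultimately show "?z *s v ?s = E p" using E_eqI[of p "?z *s v ?s"] p z(1) by simp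
  qed
  then show "\<exists>U. open U \<and> p0 \<in> U \<and> smooth_on (S \<inter> U) E" using C(1,2) by blast
qed

text \<open>In a chart, every curve of \<open>S\<close> through \<open>p\<close> is a rotated reparametrization of the lifted coordinate
  curve, so the horizontal velocities at \<open>p\<close> span a line.\<close>

lemma horizontal_velocity_line:
  assumes p: "p \<in> S"
  obtains b where "\<And>U c t. curve_on S U c \<Longrightarrow> t \<in> U \<Longrightarrow> c t = p \<Longrightarrow>
    \<exists>r. horizontal_part p (vector_derivative c (at t)) = r *\<^sub>R b"
proof -
  obtain O' \<sigma> V d v \<gamma> where C: "open O'" "p \<in> O'" "smooth_on O' \<sigma>" "\<sigma> ` O' \<subseteq> V"
    "field_lift V d v \<gamma> (T \<circ> \<gamma>)" "\<forall>q\<in>S \<inter> O'. hopf (d (\<sigma> q)) = hopf q"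
    by (rule chart[OF p])
  note d = lift_ofD[OF field_liftD(1)[OF C(5)]]
  have s: "\<sigma> p \<in> V" using C(2,4) by blast
  define d' where "d' = vector_derivative d (at (\<sigma> p))"
  have "\<exists>r. horizontal_part p (vector_derivative c (at t))
        = r *\<^sub>R horizontal_part p (herm p (d (\<sigma> p)) *s d')"
    if c: "curve_on S U c" "t \<in> U" "c t = p" for U c t
  proof -
    note c' = curve_onD[OF c(1)]
    define W where "W = U \<inter> c -` O'"
    have W: "open W" unfolding W_def
      using continuous_open_preimage[OF smooth_on_continuous[OF c'(2)] c'(1) C(1)] .
    have tW: "t \<in> W" using c C(2) by (simp add: W_def)
    have cW: "smooth_on W c" by (rule smooth_on_subset[OF c'(2)]) (simp add: W_def)
    define \<phi> where "\<phi> r = \<sigma> (c r)" for r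
    define z where "z r = herm (c r) (d (\<phi> r))" for r
    have sm\<phi>: "smooth_on W \<phi>" unfolding \<phi>_def
      by (rule smooth_on_compose[OF C(3) cW]) (auto simp: W_def)
    have \<phi>V: "\<phi> ` W \<subseteq> V" using C(4) by (auto simp: \<phi>_def W_def)
    have smz: "smooth_on W z" unfolding z_def
      by (intro smooth_on_herm cW smooth_on_compose[OF d(2) sm\<phi> \<phi>V])
    have c_eq: "c r = z r *s d (\<phi> r)" if "r \<in> W" for r
    proof -
      have "\<phi> r \<in> V" using \<phi>V that by blast
      then have "hopf (c r) = hopf (d (\<phi> r))" "norm (d (\<phi> r)) = 1"
        using C(6) that c'(3) d(4) by (auto simp: W_def \<phi>_def)
      then show ?thesis unfolding z_def using hopf_eqD(1) by blast
    qed
    define \<phi>' z' where "\<phi>' = vector_derivative \<phi> (at t)" and "z' = vector_derivative z (at t)"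
    have \<phi>t: "\<phi> t = \<sigma> p" by (simp add: \<phi>_def c(3))
    have "((d \<circ> \<phi>) has_vector_derivative \<phi>' *\<^sub>R d') (at t)"
      unfolding \<phi>'_def d'_def
      using vector_diff_chain_at[OF smooth_on_has_vector_derivative[OF W sm\<phi> tW]] d(6)[OF s] \<phi>t by simp
    then have zd: "((\<lambda>r. z r *s (d \<circ> \<phi>) r) has_vector_derivative z t *s (\<phi>' *\<^sub>R d') + z' *s (d \<circ> \<phi>) t) (at t)"
      unfolding z'_def by (rule smult_has_vector_derivative[OF smooth_on_has_vector_derivative[OF W smz tW]])
    have "(c has_vector_derivative z t *s (\<phi>' *\<^sub>R d') + z' *s (d \<circ> \<phi>) t) (at t)"
      by (rule has_vector_derivative_transform_within_open[OF zd W tW]) (simp add: c_eq)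
    then have "(c has_vector_derivative z t *s (\<phi>' *\<^sub>R d') + z' *s d (\<sigma> p)) (at t)"
      by (simp add: \<phi>t)
    then have "vector_derivative c (at t) = z t *s (\<phi>' *\<^sub>R d') + z' *s d (\<sigma> p)"
      by (rule vector_derivative_at)
    moreover have "horizontal_part p (z' *s d (\<sigma> p)) = 0"
    proof -
      have hp: "hopf (d (\<sigma> p)) = hopf p" using C(6) p C(2) by simp
      have "d (\<sigma> p) = herm (d (\<sigma> p)) p *s p" by (rule hopf_eqD(1)[OF S_D(1)[OF p] hp])
      then have "z' *s d (\<sigma> p) = (z' * herm (d (\<sigma> p)) p) *s p" by (metis vector_smult_assoc)
      then show ?thesis using horizontal_part_fibre[OF S_D(1)[OF p]] by simp
    qed
    moreover have "z t *s (\<phi>' *\<^sub>R d') = \<phi>' *\<^sub>R (herm p (d (\<sigma> p)) *s d')"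
      by (simp add: z_def \<phi>t c(3) vec_eq_iff)
    ultimately show ?thesis by (auto simp: horizontal_part_add horizontal_part_scaleR)
  qed
  then show ?thesis using that by blast
qed

lemma E_velocity:
  assumes "p \<in> S"
  obtains U c t where "curve_on S U c" "t \<in> U" "c t = p" "horizontal_part p (vector_derivative c (at t)) = E p"
proof -
  have "T (hopf p) \<in> curve_tangent_space M (hopf p)"
    using T S_D(2)[OF assms] by (auto simp: unit_tangent_field_def)
  then obtain U c t where c: "curve_on S U c" "t \<in> U" "c t = p"
      "T (hopf p) = dhopf p (vector_derivative c (at t))"
    by (rule curve_tangent_space_lift[OF _ assms])
  have "horizontal_part p (vector_derivative c (at t)) = E p"
    using c(4) E_props[OF assms] dhopf_eq_iff[OF S_D(1)[OF assms]] by (simp add: horizontal_part_ident)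
  then show ?thesis using that c by blast
qed

text \<open>\<open>T\<close> is itself the velocity of a curve in \<open>M\<close> and does not vanish, so its lift spans that line.\<close>

lemma velocity_parallel_E:
  assumes p: "p \<in> S" and c: "curve_on S U c" "t \<in> U" "c t = p"
  shows "\<exists>r. horizontal_part p (vector_derivative c (at t)) = r *\<^sub>R E p"
proof -
  obtain b where b: "\<And>U c t. curve_on S U c \<Longrightarrow> t \<in> U \<Longrightarrow> c t = p \<Longrightarrow>
      \<exists>r. horizontal_part p (vector_derivative c (at t)) = r *\<^sub>R b"
    using horizontal_velocity_line[OF p] by metis
  obtain U0 c0 t0 where c0: "curve_on S U0 c0" "t0 \<in> U0" "c0 t0 = p"
      "horizontal_part p (vector_derivative c0 (at t0)) = E p"
    by (rule E_velocity[OF p])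
  obtain r0 where r0: "E p = r0 *\<^sub>R b" using b[OF c0(1-3)] c0(4) by auto
  have "r0 \<noteq> 0" using E_unit[OF p] r0 by auto
  then have "b = inverse r0 *\<^sub>R E p" using r0 by simp
  moreover obtain r where "horizontal_part p (vector_derivative c (at t)) = r *\<^sub>R b" using b[OF c] by auto
  ultimately have "horizontal_part p (vector_derivative c (at t)) = (r * inverse r0) *\<^sub>R E p" by simp
  then show ?thesis by blast
qed

lemma sphere_velocity_split:
  assumes "p \<in> S" "curve_on S U c" "t \<in> U" "c t = p"
  defines "v \<equiv> vector_derivative c (at t)"
  shows "v = horizontal_part p v + (v \<bullet> (\<i> *s p)) *\<^sub>R (\<i> *s p)" "v \<bullet> p = 0"
proof -
  have "curve_on (sphere 0 1) U c" using assms(2) by (auto simp: curve_on_def hopf_preimage_def)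
  then have "v \<in> tangent_space (sphere 0 1) p" using assms(3,4) by (auto simp: tangent_space_def v_def)
  then show "v \<bullet> p = 0" using tangent_space_sphere[OF S_D(1)[OF assms(1)]] by simp
  then show "v = horizontal_part p v + (v \<bullet> (\<i> *s p)) *\<^sub>R (\<i> *s p)" by (simp add: horizontal_part_def)
qed

lemma tangent_space_S:
  assumes p: "p \<in> S"
  shows "tangent_space S p = {a *\<^sub>R E p + b *\<^sub>R (\<i> *s p) | a b. True}"
proof (intro equalityI subsetI)
  fix v assume "v \<in> tangent_space S p"
  then obtain U c t where c: "curve_on S U c" "t \<in> U" "c t = p" "v = vector_derivative c (at t)"
    by (auto simp: tangent_space_def)
  obtain r where "horizontal_part p v = r *\<^sub>R E p" using velocity_parallel_E[OF p c(1-3)] c(4) by auto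
  then have "v = r *\<^sub>R E p + (v \<bullet> (\<i> *s p)) *\<^sub>R (\<i> *s p)"
    using sphere_velocity_split(1)[OF p c(1-3)] c(4) by simp
  then show "v \<in> {a *\<^sub>R E p + b *\<^sub>R (\<i> *s p) | a b. True}" by blast
next
  fix v assume "v \<in> {a *\<^sub>R E p + b *\<^sub>R (\<i> *s p) | a b. True}"
  then obtain a b where v: "v = a *\<^sub>R E p + b *\<^sub>R (\<i> *s p)" by blast
  obtain U c t where c: "curve_on S U c" "t \<in> U" "c t = p"
      "horizontal_part p (vector_derivative c (at t)) = E p"
    by (rule E_velocity[OF p])
  note c' = curve_onD[OF c(1)]
  define \<beta> where "\<beta> = vector_derivative c (at t) \<bullet> (\<i> *s p)"
  have dc: "vector_derivative c (at t) = E p + \<beta> *\<^sub>R (\<i> *s p)"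
    using sphere_velocity_split(1)[OF p c(1-3)] c(4) by (simp add: \<beta>_def)
  \<comment> \<open>reparametrize \<open>c\<close> and rotate it in the fibre, compensating its own vertical velocity \<open>\<beta>\<close>\<close>
  define e where "e r = cis ((b - a * \<beta>) * r) *s c (t + r *\<^sub>R a)" for r
  have W: "open {r. t + r *\<^sub>R a \<in> U}" "smooth_on {r. t + r *\<^sub>R a \<in> U} (\<lambda>r. c (t + r *\<^sub>R a))"
    using smooth_on_line(1,2)[OF c'(1,2), of t a] by auto
  have "smooth_on {r. t + r *\<^sub>R a \<in> U} e" unfolding e_def
    by (intro smooth_on_smult smooth_on_cis smooth_on_mult smooth_on_const smooth_on_ident W(2))
  moreover have "e r \<in> S" if "t + r *\<^sub>R a \<in> U" for r
    unfolding e_def using c'(3)[OF that] by (intro preimage_rotate) auto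
  ultimately have e: "curve_on S {r. t + r *\<^sub>R a \<in> U} e" using W(1) by (auto simp: curve_on_def)
  have d1: "((\<lambda>r. cis ((b - a * \<beta>) * r)) has_vector_derivative (b - a * \<beta>) *\<^sub>R \<i>) (at 0)"
  proof -
    have "((\<lambda>r. (b - a * \<beta>) * r) has_vector_derivative (b - a * \<beta>)) (at 0)"
      by (auto intro!: derivative_eq_intros)
    moreover have "(cis has_vector_derivative \<i>) (at ((b - a * \<beta>) * 0))"
      using cis_has_derivative[of 0] by (simp add: has_vector_derivative_def)
    ultimately show ?thesis using vector_diff_chain_at[of _ _ 0 cis] by (simp add: o_def)
  qed
  have "((\<lambda>r. t + r *\<^sub>R a) has_vector_derivative a) (at 0)"
    by (auto intro!: derivative_eq_intros)
  moreover have "(c has_vector_derivative vector_derivative c (at t)) (at (t + 0 *\<^sub>R a))"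
    using c'(4)[OF c(2)] by simp
  ultimately have d2: "((\<lambda>r. c (t + r *\<^sub>R a)) has_vector_derivative a *\<^sub>R (E p + \<beta> *\<^sub>R (\<i> *s p))) (at 0)"
    using vector_diff_chain_at[of _ _ 0 c] dc by (simp add: o_def)
  have "(e has_vector_derivative v) (at 0)"
  proof -
    have "v = cis ((b - a * \<beta>) * 0) *s (a *\<^sub>R (E p + \<beta> *\<^sub>R (\<i> *s p)))
        + ((b - a * \<beta>) *\<^sub>R \<i>) *s c (t + 0 *\<^sub>R a)"
      using c(3) by (simp add: v vec_eq_iff algebra_simps)
    then show ?thesis using smult_has_vector_derivative[OF d1 d2] by (simp add: e_def[abs_def])
  qed
  then have "vector_derivative e (at 0) = v" by (rule vector_derivative_at)
  moreover have "e 0 = p" using c(3) by (simp add: e_def)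
  ultimately show "v \<in> tangent_space S p"
    unfolding tangent_space_def using e c(2) by (intro CollectI exI[of _ "{r. t + r *\<^sub>R a \<in> U}"] exI[of _ e] exI[of _ 0]) auto
qed

sublocale circle_surface S E
  by unfold_locales
    (use S_D preimage_rotate E_smooth E_unit E_props E_rotate tangent_space_S in auto)

section \<open>Covariant derivative and shape operator of the curve\<close>

lemma curve_tangent_space_S:
  assumes p: "p \<in> S"
  shows "curve_tangent_space M (hopf p) = {dhopf p (r *\<^sub>R E p) | r. True}"
proof (intro equalityI subsetI)
  fix X assume "X \<in> curve_tangent_space M (hopf p)"
  then obtain U c t where c: "curve_on S U c" "t \<in> U" "c t = p" "X = dhopf p (vector_derivative c (at t))"
    by (rule curve_tangent_space_lift[OF _ p])
  obtain r where "horizontal_part p (vector_derivative c (at t)) = r *\<^sub>R E p"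
    using velocity_parallel_E[OF p c(1-3)] by blast
  then have "X = dhopf p (r *\<^sub>R E p)"
    using c(4) dhopf_horizontal_part[OF norm_S[OF p], of "vector_derivative c (at t)"] by simp
  then show "X \<in> {dhopf p (r *\<^sub>R E p) | r. True}" by blast
next
  fix X assume "X \<in> {dhopf p (r *\<^sub>R E p) | r. True}"
  then obtain r where X: "X = dhopf p (r *\<^sub>R E p)" by blast
  have "r *\<^sub>R E p + 0 *\<^sub>R (\<i> *s p) \<in> tangent_space S p" unfolding tangent_S[OF p] by blast
  then obtain U c t where c: "curve_on S U c" "t \<in> U" "c t = p" "r *\<^sub>R E p = vector_derivative c (at t)"
    by (auto simp: tangent_space_def)
  note L = curve_on_preimage_lift[OF c(1)]
  have "X = cp_velocity (hopf \<circ> c) t" using lift_ofD(7)[OF L(1) c(2)] c(3,4) X by simp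
  moreover have "(hopf \<circ> c) t = hopf p" using c(3) by simp
  ultimately show "X \<in> curve_tangent_space M (hopf p)"
    unfolding curve_tangent_space_def using L(2) c(2) by blast
qed

lemma cp_inner_horizontal:
  "p \<in> S \<Longrightarrow> herm w p = 0 \<Longrightarrow> cp_inner (dhopf p v) (dhopf p w) = v \<bullet> w"
  using cp_inner_dhopf[OF norm_S, of p v w] cnj_herm[of w p]
  by (simp add: horizontal_part_ident) (simp add: horizontal_part_eq inner_eq_Re_herm herm_simps)

lemma curve_normal_space_S:
  assumes p: "p \<in> S"
  shows "curve_normal_space M (hopf p) = {dhopf p \<xi> | \<xi>. herm \<xi> p = 0 \<and> \<xi> \<bullet> E p = 0}"
proof -
  have "(\<forall>X\<in>curve_tangent_space M (hopf p). cp_inner (dhopf p \<xi>) X = 0) \<longleftrightarrow> \<xi> \<bullet> E p = 0" for \<xi>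
  proof -
    have "cp_inner (dhopf p \<xi>) (dhopf p (r *\<^sub>R E p)) = r * (\<xi> \<bullet> E p)" for r
      using horizontal_E[OF p] by (simp add: cp_inner_horizontal[OF p] herm_simps)
    then show ?thesis unfolding curve_tangent_space_S[OF p] by (auto dest: spec[of _ 1])
  qed
  then show ?thesis
    unfolding curve_normal_space_def cp_tangent_space_hopf[OF norm_S[OF p]] by auto
qed

lemma T_field_lift:
  assumes c: "lift_of U c \<gamma>" "curve_on S U c"
  shows "field_lift U c (E \<circ> c) \<gamma> (T \<circ> \<gamma>)"
proof -
  note c' = curve_onD[OF c(2)]
  have "smooth_on U (E \<circ> c)" unfolding o_def
    by (rule smooth_on_compose[OF smooth_E c'(2)]) (use c'(3) in blast)
  moreover have "herm ((E \<circ> c) s) (c s) = 0 \<and> (T \<circ> \<gamma>) s = dhopf (c s) ((E \<circ> c) s)" if "s \<in> U" for s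
    using E_props[OF c'(3)[OF that]] lift_ofD(5)[OF c(1) that] by simp
  ultimately show ?thesis using c(1) by (simp add: field_lift_def)
qed

text \<open>A lift of the curve has velocity \<open>E + \<beta> \<i>p\<close> for some \<open>\<beta>\<close>. By equivariance its vertical part contributes
  \<open>\<beta> \<i>E\<close> to the derivative of \<open>E\<close>, which is exactly what the correction in \<^const>\<open>cov_lift\<close> removes.\<close>

lemma cp_conn_T:
  assumes \<gamma>: "cp_curve_on M I \<gamma>" "t \<in> I" "cp_velocity \<gamma> t = T (\<gamma> t)" and p: "p \<in> S" "hopf p = \<gamma> t"
  shows "cp_conn \<gamma> (T \<circ> \<gamma>) t = dhopf p (curvature_vector p)"
proof -
  obtain U c where c: "t \<in> U" "U \<subseteq> I" "lift_of U c \<gamma>" "curve_on S U c" "c t = p"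
    by (rule cp_curve_lift[OF \<gamma>(1,2) norm_S[OF p(1)] p(2)])
  note F = T_field_lift[OF c(3,4)]
  define v where "v = vector_derivative c (at t)"
  have "dhopf p v = dhopf p (E p)"
    using lift_ofD(7)[OF c(3,1)] \<gamma>(3) E_props(2)[OF p(1)] p(2) c(5) by (simp add: v_def)
  then have hv: "horizontal_part p v = E p"
    using dhopf_eq_iff[OF norm_S[OF p(1)]] horizontal_E[OF p(1)] by (simp add: horizontal_part_ident)
  define \<beta> where "\<beta> = v \<bullet> (\<i> *s p)"
  have v: "v = E p + \<beta> *\<^sub>R (\<i> *s p)" "herm v p = \<i> * \<beta>"
    using sphere_velocity_split[OF p(1) c(4,1,5)] hv by (simp_all add: v_def \<beta>_def herm_eq_inner complex_eq_iff)
  have vt: "v \<in> tangent_space S p" using c unfolding tangent_space_def v_def by blast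
  obtain V E' where V: "open V" "p \<in> V" "smooth_on V E'" "\<And>q. q \<in> S \<inter> V \<Longrightarrow> E' q = E q"
    using smooth_on_local_extension[OF smooth_E p(1)] by metis
  note E' = smooth_on_has_derivative[OF V(1,3,2)]
  have DE: "frechet_derivative E' (at p) v = curvature_vector p + \<beta> *\<^sub>R (\<i> *s E p)"
  proof -
    have "v \<bullet> E p = 1" unfolding v(1) by (simp add: inner_add_left frame_inner[OF p(1)] unit_E[OF p(1)])
    moreover have "frechet_derivative E' (at p) v
        = (v \<bullet> E p) *\<^sub>R curvature_vector p + (v \<bullet> (\<i> *s p)) *\<^sub>R (\<i> *s E p)"
      by (rule derivative_E[OF p(1) V(1,2,4) E' vt])
    ultimately show ?thesis by (simp add: \<beta>_def)
  qed
  have "((E \<circ> c) has_vector_derivative frechet_derivative E' (at p) v) (at t)"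
    unfolding v_def
    by (rule has_vector_derivative_along_curve[OF c(4,1), of E' _ V]) (use V E' c(5) in auto)
  then have dEc: "vector_derivative (E \<circ> c) (at t) = curvature_vector p + \<beta> *\<^sub>R (\<i> *s E p)"
    unfolding DE by (rule vector_derivative_at)
  have "cov_lift c (E \<circ> c) t
      = horizontal_part p (curvature_vector p + \<beta> *\<^sub>R (\<i> *s E p) - (\<i> * \<beta>) *s E p)"
    unfolding cov_lift_def dEc v_def[symmetric] c(5) v(2) by (simp add: c(5))
  also have "curvature_vector p + \<beta> *\<^sub>R (\<i> *s E p) - (\<i> * \<beta>) *s E p = curvature_vector p"
    by (simp add: vec_eq_iff scaleR_conv_of_real[where 'a=complex])
  finally have cl: "cov_lift c (E \<circ> c) t = horizontal_part p (curvature_vector p)" .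
  have "fs_conn \<gamma> (T \<circ> \<gamma>) t = dhopf p (curvature_vector p)"
    unfolding fs_conn_eq[OF F c(1)] cl c(5) by (rule dhopf_horizontal_part[OF norm_S[OF p(1)]])
  moreover have "cp_conn \<gamma> (T \<circ> \<gamma>) t = fs_conn \<gamma> (T \<circ> \<gamma>) t"
    by (rule cp_conn_eq_fs_conn[OF F c(1)]) (simp add: \<gamma>(3))
  ultimately show ?thesis by simp
qed

lemma unit_speed_param:
  assumes p: "p \<in> S"
  obtains I \<gamma> t where "cp_curve_on M I \<gamma>" "t \<in> I" "\<gamma> t = hopf p" "cp_velocity \<gamma> t = T (hopf p)"
proof -
  have "T (hopf p) \<in> curve_tangent_space M (hopf p)"
    using T S_D(2)[OF p] by (auto simp: unit_tangent_field_def)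
  then show ?thesis using that unfolding curve_tangent_space_def by auto
qed

lemma cov_deriv_T:
  assumes p: "p \<in> S"
  shows "cov_deriv M T T (hopf p) = dhopf p (curvature_vector p)"
  unfolding cov_deriv_def
proof (rule the_equality)
  show "\<forall>I \<gamma> t. cp_curve_on M I \<gamma> \<and> t \<in> I \<and> \<gamma> t = hopf p \<and> cp_velocity \<gamma> t = T (hopf p) \<longrightarrow>
      dhopf p (curvature_vector p) = cp_conn \<gamma> (T \<circ> \<gamma>) t"
    using cp_conn_T[OF _ _ _ p] by (intro allI impI) (elim conjE, simp)
next
  fix Z assume Z: "\<forall>I \<gamma> t. cp_curve_on M I \<gamma> \<and> t \<in> I \<and> \<gamma> t = hopf p \<and> cp_velocity \<gamma> t = T (hopf p) \<longrightarrow>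
      Z = cp_conn \<gamma> (T \<circ> \<gamma>) t"
  obtain I \<gamma> t where \<gamma>: "cp_curve_on M I \<gamma>" "t \<in> I" "\<gamma> t = hopf p" "cp_velocity \<gamma> t = T (hopf p)"
    by (rule unit_speed_param[OF p])
  have "Z = cp_conn \<gamma> (T \<circ> \<gamma>) t"
    by (rule Z[rule_format, of I \<gamma> t]) (intro conjI \<gamma>)
  also have "\<dots> = dhopf p (curvature_vector p)"
    by (rule cp_conn_T[OF \<gamma>(1,2) _ p]) (simp_all add: \<gamma>(3,4))
  finally show "Z = dhopf p (curvature_vector p)" .
qed

text \<open>Differentiating \<open>\<langle>N, T\<rangle> = 0\<close> moves the derivative from the normal field to \<open>T\<close>.\<close>

lemma cp_conn_normal_field:
  assumes \<gamma>: "cp_curve_on M I \<gamma>" "t \<in> I" "\<gamma> t = hopf p" "cp_velocity \<gamma> t = T (hopf p)"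
    and N: "field_along I \<gamma> N" "\<forall>s\<in>I. N s \<in> curve_normal_space M (\<gamma> s)" "N t = dhopf p \<xi>"
    and p: "p \<in> S" and \<xi>: "herm \<xi> p = 0"
  shows "cp_inner (cp_conn \<gamma> N t) (dhopf p (r *\<^sub>R E p)) = - r * (\<xi> \<bullet> curvature_vector p)"
proof -
  have oI: "open I" using \<gamma>(1) by (simp add: cp_curve_on_def)
  obtain U c where c: "t \<in> U" "U \<subseteq> I" "lift_of U c \<gamma>" "curve_on S U c" "c t = p"
    by (rule cp_curve_lift[OF \<gamma>(1,2) norm_S[OF p] \<gamma>(3)[symmetric]])
  have oU: "open U" by (rule lift_ofD(1)[OF c(3)])
  have TU: "field_along U \<gamma> (T \<circ> \<gamma>)" by (rule field_lift_imp_field_along[OF T_field_lift[OF c(3,4)]])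
  have NU: "field_along U \<gamma> N" by (rule field_along_subset[OF N(1) oI c(2)])
  have "((\<lambda>s. cp_inner (N s) ((T \<circ> \<gamma>) s)) has_real_derivative
      cp_inner (cp_conn \<gamma> N t) ((T \<circ> \<gamma>) t) + cp_inner (N t) (cp_conn \<gamma> (T \<circ> \<gamma>) t)) (at t)"
    by (rule levi_civita_metric[OF levi_civita_cp_conn oU NU TU c(1)])
  moreover have "((\<lambda>s. cp_inner (N s) ((T \<circ> \<gamma>) s)) has_real_derivative 0) (at t)"
  proof (rule has_field_derivative_transform_within_open[OF DERIV_const oU c(1)])
    fix s assume "s \<in> U"
    then have "N s \<in> curve_normal_space M (\<gamma> s)" "\<gamma> s \<in> M"
      using N(2) c(2) \<gamma>(1) by (auto simp: cp_curve_on_def)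
    then show "0 = cp_inner (N s) ((T \<circ> \<gamma>) s)"
      using T by (auto simp: curve_normal_space_def unit_tangent_field_def)
  qed
  ultimately have sum0: "cp_inner (cp_conn \<gamma> N t) ((T \<circ> \<gamma>) t) + cp_inner (N t) (cp_conn \<gamma> (T \<circ> \<gamma>) t) = 0"
    by (rule DERIV_unique)
  have "cp_conn \<gamma> (T \<circ> \<gamma>) t = dhopf p (curvature_vector p)"
    by (rule cp_conn_T[OF \<gamma>(1,2) _ p]) (simp_all add: \<gamma>)
  then have "cp_inner (N t) (cp_conn \<gamma> (T \<circ> \<gamma>) t) = \<xi> \<bullet> curvature_vector p"
    using cp_inner_horizontal[OF p \<xi>, of "curvature_vector p"] N(3)
    by (simp add: cp_inner_commute inner_commute)
  moreover have "\<exists>w. cp_conn \<gamma> N t = dhopf p w"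
  proof -
    obtain V d w where V: "t \<in> V" "V \<subseteq> U" "field_lift V d w \<gamma> (cp_conn \<gamma> N)"
      by (rule field_along_lift[OF levi_civita_field_along[OF levi_civita_cp_conn oU NU] oU c(1)])
    have "t \<in> V \<inter> U" using V(1) c(1) by simp
    note L = field_liftD(4)[OF field_lift_change[OF V(3) c(3)] this]
    show ?thesis by (rule exI, rule L[unfolded c(5)])
  qed
  then obtain w where w: "cp_conn \<gamma> N t = dhopf p w" by blast
  moreover have "(T \<circ> \<gamma>) t = dhopf p (E p)" using \<gamma>(3) E_props(2)[OF p] by simp
  ultimately have "w \<bullet> E p = - (\<xi> \<bullet> curvature_vector p)"
    using sum0 cp_inner_horizontal[OF p horizontal_E[OF p], of w] by simp
  then show ?thesis
    using cp_inner_horizontal[OF p, of "r *\<^sub>R E p" w] horizontal_E[OF p] w by (simp add: herm_simps)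
qed

text \<open>The shape operator is defined by a condition on all normal extensions of \<open>\<xi>\<close>; it determines a value
  because such an extension exists.\<close>

lemma normal_field_extension:
  assumes p: "p \<in> S" and \<xi>: "herm \<xi> p = 0" "\<xi> \<bullet> E p = 0"
  obtains I \<gamma> t N where "cp_curve_on M I \<gamma>" "t \<in> I" "\<gamma> t = hopf p" "cp_velocity \<gamma> t = T (hopf p)"
    "field_along I \<gamma> N" "\<forall>s\<in>I. N s \<in> curve_normal_space M (\<gamma> s)" "N t = dhopf p \<xi>"
proof -
  obtain I \<gamma> t where \<gamma>: "cp_curve_on M I \<gamma>" "t \<in> I" "\<gamma> t = hopf p" "cp_velocity \<gamma> t = T (hopf p)"
    by (rule unit_speed_param[OF p])
  obtain U c where c: "t \<in> U" "U \<subseteq> I" "lift_of U c \<gamma>" "curve_on S U c" "c t = p"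
    by (rule cp_curve_lift[OF \<gamma>(1,2) norm_S[OF p] \<gamma>(3)[symmetric]])
  note L = lift_ofD[OF c(3)]
  have cS: "c s \<in> S" if "s \<in> U" for s using curve_onD(3)[OF c(4) that] .
  define N where "N s = dhopf (c s) (nproj (c s) \<xi>)" for s
  have np: "herm (nproj (c s) \<xi>) (c s) = 0 \<and> nproj (c s) \<xi> \<bullet> E (c s) = 0" if "s \<in> U" for s
    using nproj_normal[OF cS[OF that], of \<xi>] unfolding normal_space_S[OF cS[OF that]] by simp
  have "smooth_on S (\<lambda>q. nproj q \<xi>)" by (rule smooth_on_nproj) simp
  then have "smooth_on U (\<lambda>s. nproj (c s) \<xi>)"
    by (rule smooth_on_compose[OF _ L(2)]) (use cS in blast)
  then have "field_lift U c (\<lambda>s. nproj (c s) \<xi>) \<gamma> N"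
    using c(3) np by (simp add: field_lift_def N_def)
  then have 1: "field_along U \<gamma> N" by (rule field_lift_imp_field_along)
  have 2: "\<forall>s\<in>U. N s \<in> curve_normal_space M (\<gamma> s)"
  proof
    fix s assume s: "s \<in> U"
    show "N s \<in> curve_normal_space M (\<gamma> s)"
      using curve_normal_space_S[OF cS[OF s]] np[OF s] L(5)[OF s] by (auto simp: N_def)
  qed
  have 3: "N t = dhopf p \<xi>" using \<xi> c(5) by (simp add: N_def nproj_def horizontal_part_ident)
  have 4: "cp_curve_on M U \<gamma>"
    by (rule lift_of_cp_curve[OF c(3)]) (use \<gamma>(1) c(2) in \<open>auto simp: cp_curve_on_def\<close>)
  show ?thesis by (rule that[OF 4 c(1) \<gamma>(3,4) 1 2 3])
qed

lemma shape_operator_T: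
  assumes p: "p \<in> S" and \<xi>: "herm \<xi> p = 0" "\<xi> \<bullet> E p = 0"
  shows "shape_operator M (hopf p) (dhopf p \<xi>) (T (hopf p))
    = dhopf p ((\<xi> \<bullet> curvature_vector p) *\<^sub>R E p)"
  unfolding shape_operator_def
proof (rule the_equality, intro conjI allI impI ballI)
  let ?k = "\<xi> \<bullet> curvature_vector p"
  have inner: "cp_inner (dhopf p (k *\<^sub>R E p)) (dhopf p (r *\<^sub>R E p)) = k * r" for k r
    using cp_inner_horizontal[OF p, of "r *\<^sub>R E p"] horizontal_E[OF p] unit_E[OF p]
    by (simp add: herm_simps)
  show "dhopf p (?k *\<^sub>R E p) \<in> curve_tangent_space M (hopf p)"
    unfolding curve_tangent_space_S[OF p] by blast
  {
    fix I \<gamma> t N Y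
    assume H: "cp_curve_on M I \<gamma> \<and> t \<in> I \<and> \<gamma> t = hopf p \<and> cp_velocity \<gamma> t = T (hopf p) \<and>
        field_along I \<gamma> N \<and> (\<forall>s\<in>I. N s \<in> curve_normal_space M (\<gamma> s)) \<and> N t = dhopf p \<xi>"
      and Y: "Y \<in> curve_tangent_space M (hopf p)"
    obtain r where "Y = dhopf p (r *\<^sub>R E p)" using Y unfolding curve_tangent_space_S[OF p] by blast
    then show "cp_inner (dhopf p (?k *\<^sub>R E p)) Y = - cp_inner (cp_conn \<gamma> N t) Y"
      using cp_conn_normal_field[of I \<gamma> t p N \<xi> r] H p \<xi>(1) inner by simp
  }
  fix Z
  assume Z: "Z \<in> curve_tangent_space M (hopf p) \<and>
    (\<forall>I \<gamma> t N. cp_curve_on M I \<gamma> \<and> t \<in> I \<and> \<gamma> t = hopf p \<and> cp_velocity \<gamma> t = T (hopf p) \<and>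
       field_along I \<gamma> N \<and> (\<forall>s\<in>I. N s \<in> curve_normal_space M (\<gamma> s)) \<and> N t = dhopf p \<xi> \<longrightarrow>
       (\<forall>Y\<in>curve_tangent_space M (hopf p). cp_inner Z Y = - cp_inner (cp_conn \<gamma> N t) Y))"
  obtain k where k: "Z = dhopf p (k *\<^sub>R E p)" using Z unfolding curve_tangent_space_S[OF p] by blast
  obtain I \<gamma> t N where N: "cp_curve_on M I \<gamma>" "t \<in> I" "\<gamma> t = hopf p" "cp_velocity \<gamma> t = T (hopf p)"
    "field_along I \<gamma> N" "\<forall>s\<in>I. N s \<in> curve_normal_space M (\<gamma> s)" "N t = dhopf p \<xi>"
    by (rule normal_field_extension[OF p \<xi>])
  have ET: "dhopf p (1 *\<^sub>R E p) \<in> curve_tangent_space M (hopf p)"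
    unfolding curve_tangent_space_S[OF p] by blast
  have "cp_inner Z (dhopf p (1 *\<^sub>R E p)) = - cp_inner (cp_conn \<gamma> N t) (dhopf p (1 *\<^sub>R E p))"
    by (rule Z[THEN conjunct2, rule_format, of I \<gamma> t N, OF _ ET]) (simp add: N)
  also have "\<dots> = ?k" using cp_conn_normal_field[OF N p \<xi>(1), where r = 1] by simp
  finally have "k = ?k" unfolding k inner by simp
  then show "Z = dhopf p (?k *\<^sub>R E p)" using k by simp
qed

abbreviation parallel :: "complex^'n \<Rightarrow> bool" where
  "parallel p \<equiv> nproj p (curvature_vector p) = (curvature_vector p \<bullet> (\<i> *s E p)) *\<^sub>R (\<i> *s E p)"

lemma shape_operator_condition_iff:
  "(\<forall>x\<in>M. \<forall>\<xi>\<in>curve_normal_space M x.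
      cp_inner \<xi> (cp_J (T x)) = 0 \<longrightarrow> cp_inner (shape_operator M x \<xi> (T x)) (T x) = 0)
   \<longleftrightarrow> (\<forall>p\<in>S. parallel p)"
proof -
  have J: "cp_inner (dhopf p \<xi>) (cp_J (T (hopf p))) = \<xi> \<bullet> (\<i> *s E p)" if p: "p \<in> S" for p \<xi>
    using cp_inner_horizontal[OF p, of "\<i> *s E p" \<xi>] E_props[OF p] by (simp add: cp_J_dhopf herm_simps)
  have A: "cp_inner (shape_operator M (hopf p) (dhopf p \<xi>) (T (hopf p))) (T (hopf p)) = \<xi> \<bullet> curvature_vector p"
    if p: "p \<in> S" and "herm \<xi> p = 0" "\<xi> \<bullet> E p = 0" for p \<xi>
    using cp_inner_horizontal[OF p horizontal_E[OF p]] shape_operator_T[OF that] E_props(2)[OF p] unit_E[OF p]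
    by simp
  show ?thesis
  proof (intro iffI ballI impI)
    fix p assume H: "\<forall>x\<in>M. \<forall>\<xi>\<in>curve_normal_space M x.
        cp_inner \<xi> (cp_J (T x)) = 0 \<longrightarrow> cp_inner (shape_operator M x \<xi> (T x)) (T x) = 0"
      and p: "p \<in> S"
    let ?H = "curvature_vector p"
    \<comment> \<open>test the condition on the component of the curvature vector that ought to vanish\<close>
    define \<xi> where "\<xi> = nproj p ?H - (?H \<bullet> (\<i> *s E p)) *\<^sub>R (\<i> *s E p)"
    have iE: "\<i> *s E p \<in> normal_space (sphere 0 1) S p"
      using nproj_normal[OF p, of "\<i> *s E p"] nproj_frame[OF p] by simp
    have HiE: "nproj p ?H \<bullet> (\<i> *s E p) = ?H \<bullet> (\<i> *s E p)"
      using inner_nproj[OF iE p, of ?H] by (simp add: inner_commute)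
    have \<xi>: "herm \<xi> p = 0" "\<xi> \<bullet> E p = 0"
      using nproj_normal[OF p, of ?H] iE unfolding normal_space_S[OF p] \<xi>_def
      by (simp_all add: herm_simps inner_diff_left)
    have \<xi>J: "\<xi> \<bullet> (\<i> *s E p) = 0" unfolding \<xi>_def
      using HiE by (simp add: inner_diff_left frame_inner[OF p])
    have "dhopf p \<xi> \<in> curve_normal_space M (hopf p)" unfolding curve_normal_space_S[OF p] using \<xi> by blast
    then have "\<xi> \<bullet> ?H = 0" using H S_D(2)[OF p] J[OF p] A[OF p \<xi>] \<xi>J by metis
    moreover have "\<xi> \<in> normal_space (sphere 0 1) S p" unfolding normal_space_S[OF p] using \<xi> by simp
    ultimately have "\<xi> \<bullet> nproj p ?H = 0" using inner_nproj[OF _ p] by simp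
    then have "\<xi> \<bullet> \<xi> = 0" using \<xi>J by (subst (2) \<xi>_def) (simp add: inner_diff_right)
    then show "parallel p" by (simp add: \<xi>_def)
  next
    fix x \<xi>' assume par: "\<forall>p\<in>S. parallel p" and x: "x \<in> M" "\<xi>' \<in> curve_normal_space M x"
      "cp_inner \<xi>' (cp_J (T x)) = 0"
    obtain p where p: "p \<in> S" "x = hopf p" by (rule M_hopf[OF x(1)])
    obtain \<xi> where \<xi>: "\<xi>' = dhopf p \<xi>" "herm \<xi> p = 0" "\<xi> \<bullet> E p = 0"
      using x(2) curve_normal_space_S[OF p(1)] p(2) by auto
    have "\<xi> \<bullet> (\<i> *s E p) = 0" using J[OF p(1)] x(3) \<xi>(1) p(2) by simp
    moreover have "\<xi> \<in> normal_space (sphere 0 1) S p" using \<xi> by (simp add: normal_space_S[OF p(1)])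
    ultimately have "\<xi> \<bullet> curvature_vector p = 0"
      using inner_nproj[OF _ p(1), of \<xi> "curvature_vector p"] bspec[OF par p(1)] by simp
    then show "cp_inner (shape_operator M x \<xi>' (T x)) (T x) = 0" using A[OF p(1) \<xi>(2,3)] \<xi>(1) p(2) by simp
  qed
qed

lemma smooth_curvature_vector: "smooth_on S curvature_vector"
proof (rule smooth_onI_extension)
  fix p assume p: "p \<in> S"
  obtain V E' where V: "open V" "p \<in> V" "smooth_on V E'" "\<And>q. q \<in> S \<inter> V \<Longrightarrow> E' q = E q"
    using smooth_on_local_extension[OF smooth_E p] by metis
  have "frechet_derivative E' (at q) (E' q) = curvature_vector q" if q: "q \<in> S \<inter> V" for q
  proof -
    have "tangent_deriv S E q (E q) = frechet_derivative E' (at q) (E q)"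
      by (rule tangent_deriv_eq[OF E_tangent smooth_on_has_derivative[OF V(1,3)] V(1) _ V(4)])
        (use q in auto)
    then show ?thesis using V(4)[OF q] by (simp add: curvature_vector_def)
  qed
  then show "\<exists>U g. open U \<and> p \<in> U \<and> smooth_on U g \<and> (\<forall>q\<in>S \<inter> U. g q = curvature_vector q)"
    using V(1,2) smooth_on_frechet[OF V(1,3,3)] by blast
qed

lemma holomorphic_circle_iff: "holomorphic_circle M T \<longleftrightarrow> (\<forall>p\<in>S. parallel p)"
proof -
  have eq: "cov_deriv M T T (hopf p) = cp_scale k (cp_J (T (hopf p)))
      \<longleftrightarrow> nproj p (curvature_vector p) = k *\<^sub>R (\<i> *s E p)" if p: "p \<in> S" for p k
  proof -
    have "cp_scale k (cp_J (T (hopf p))) = dhopf p (k *\<^sub>R (\<i> *s E p))"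
      using E_props(2)[OF p] by (simp add: cp_J_dhopf cp_scale_dhopf)
    moreover have "horizontal_part p (k *\<^sub>R (\<i> *s E p)) = k *\<^sub>R (\<i> *s E p)"
      using horizontal_E[OF p] by (intro horizontal_part_ident) (simp add: herm_simps)
    ultimately show ?thesis
      using cov_deriv_T[OF p] dhopf_eq_iff[OF norm_S[OF p]] inner_curvature_vector_E[OF p]
      by (simp add: nproj_def)
  qed
  show ?thesis
  proof
    assume "holomorphic_circle M T"
    then obtain \<kappa> where \<kappa>: "\<forall>x\<in>M. cov_deriv M T T x = cp_scale (\<kappa> x) (cp_J (T x))"
      by (auto simp: holomorphic_circle_def)
    show "\<forall>p\<in>S. parallel p"
    proof
      fix p assume p: "p \<in> S"
      let ?H = "curvature_vector p"
      have par: "nproj p ?H = \<kappa> (hopf p) *\<^sub>R (\<i> *s E p)" using eq[OF p] \<kappa> S_D(2)[OF p] by blast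
      have "\<i> *s E p \<in> normal_space (sphere 0 1) S p"
        using nproj_normal[OF p, of "\<i> *s E p"] nproj_frame[OF p] by simp
      from inner_nproj[OF this p, of ?H] have "?H \<bullet> (\<i> *s E p) = \<kappa> (hopf p)"
        using par by (simp add: frame_inner[OF p] inner_commute)
      then show "parallel p" using par by simp
    qed
  next
    assume par: "\<forall>p\<in>S. parallel p"
    define \<kappa> where "\<kappa> x = cp_inner (cov_deriv M T T x) (cp_J (T x))" for x
    have \<kappa>: "\<kappa> (hopf p) = curvature_vector p \<bullet> (\<i> *s E p)" if p: "p \<in> S" for p
      using cp_inner_horizontal[OF p, of "\<i> *s E p" "curvature_vector p"] cov_deriv_T[OF p] E_props[OF p]
      by (simp add: \<kappa>_def cp_J_dhopf herm_simps)
    have "smooth_on I (\<kappa> \<circ> \<gamma>)" if \<gamma>: "local_param M I \<gamma>" for I \<gamma>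
    proof (rule smooth_on_local)
      fix t assume t: "t \<in> I"
      have \<gamma>': "cp_curve_on M I \<gamma>" using \<gamma> by (simp add: local_param_def)
      then have "\<gamma> t \<in> M" using t by (auto simp: cp_curve_on_def)
      then obtain p where p: "p \<in> S" "\<gamma> t = hopf p" by (rule M_hopf)
      obtain U c where c: "t \<in> U" "U \<subseteq> I" "lift_of U c \<gamma>" "curve_on S U c" "c t = p"
        by (rule cp_curve_lift[OF \<gamma>' t norm_S[OF p(1)] p(2)[symmetric]])
      have cS: "c ` U \<subseteq> S" using curve_onD(3)[OF c(4)] by blast
      have "smooth_on S (\<lambda>q. curvature_vector q \<bullet> (\<i> *s E q))"
        by (intro smooth_on_inner smooth_on_smult smooth_curvature_vector smooth_E smooth_on_const)
      then have "smooth_on U (\<lambda>s. curvature_vector (c s) \<bullet> (\<i> *s E (c s)))"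
        by (rule smooth_on_compose[OF _ lift_ofD(2)[OF c(3)] cS])
      then have "smooth_on U (\<kappa> \<circ> \<gamma>)"
      proof (rule smooth_on_cong)
        fix s assume s: "s \<in> U"
        show "curvature_vector (c s) \<bullet> (\<i> *s E (c s)) = (\<kappa> \<circ> \<gamma>) s"
          using \<kappa>[of "c s"] cS s lift_ofD(5)[OF c(3) s] by auto
      qed
      then have "smooth_on (I \<inter> U) (\<kappa> \<circ> \<gamma>)" by (rule smooth_on_subset) simp
      then show "\<exists>U. open U \<and> t \<in> U \<and> smooth_on (I \<inter> U) (\<kappa> \<circ> \<gamma>)"
        using c(1) lift_ofD(1)[OF c(3)] by blast
    qed
    moreover have "cov_deriv M T T x = cp_scale (\<kappa> x) (cp_J (T x))" if x: "x \<in> M" for x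
    proof -
      obtain p where p: "p \<in> S" "x = hopf p" by (rule M_hopf[OF x])
      show ?thesis using eq[OF p(1)] \<kappa>[OF p(1)] bspec[OF par p(1)] p(2) by simp
    qed
    ultimately show "holomorphic_circle M T"
      unfolding holomorphic_circle_def smooth_fun_on_curve_def by blast
  qed
qed

end

theorem proposition5p1:
  fixes M :: "('n::finite) cpoint set" and T :: "'n cpoint \<Rightarrow> 'n cvector"
  assumes "curve_submanifold M" and "unit_tangent_field M T"
  shows
    "(flat_normal_bundle (sphere 0 1) (hopf_preimage M) \<longleftrightarrow>
        (\<forall>x\<in>M. \<forall>\<xi>\<in>curve_normal_space M x.
           cp_inner \<xi> (cp_J (T x)) = 0 \<longrightarrow> cp_inner (shape_operator M x \<xi> (T x)) (T x) = 0)) \<and>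
     (flat_normal_bundle (sphere 0 1) (hopf_preimage M) \<longleftrightarrow> holomorphic_circle M T)"
proof -
  interpret unit_speed_curve M T using assms by unfold_locales
  show ?thesis
    unfolding flat_normal_bundle_iff shape_operator_condition_iff holomorphic_circle_iff by simp
qed

end
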